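(* Let $d\ge2$, let $N\ge0$ be an integer and $0<b<1$. Let $\mu$ be a pseudo-positive signed measure on $\mathbb{R}^d$ with support in the closed ball of radius $b$, with component measures $\mu_{k,\ell}$ on $[0,b]$. For each $(k,\ell)$ let distinct points $t_{k,\ell;j}\in[0,b]$, $j=0,1,\dots,N$, and numbers $\lambda_{k,\ell;j}$, $j=0,\dots,N$, be such that the interpolatory quadrature formula $$\int_0^bQ(r)\,d\mu_{k,\ell}(r)=\sum_{j=0}^N\lambda_{k,\ell;j}\,Q(t_{k,\ell;j})$$ holds for every $Q$ in the linear span of $\{r^{k+2j}\}_{j=0}^N$. Let $f\in H^2(\mathcal{B})$ with Laplace-Fourier coefficients $f_{k,\ell}$. Then the polyharmonic interpolatory cubature formula $$\mathcal{C}_N(f)=\sum_{k=0}^\infty\sum_{\ell=1}^{a_k}\sum_{j=0}^N\lambda_{k,\ell;j}f_{k,\ell}(t_{k,\ell;j}),$$ with remainder $E(f)=\int_Bf(x)\,d\mu(x)-\mathcal{C}_N(f)$, satisfies the estimate $$|E(f)|\le\frac{C_N}{(1-b)^{N+2}}\,\frac{L_\Gamma}{2\pi}\sum_{k=0}^\infty\sum_{\ell=1}^{a_k}\|f_{k,\ell}\|_{H^2(\mathbb{D})}\times\int_0^1r^k\,d\mu_{k,\ell}(r),$$ where $C_N$ is a constant depending only on $N$, and $L_\Gamma=2\pi$ is the length of the unit circle $\Gamma(t)=e^{it}$, $t\in[0,2\pi]$.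
   Context: $B=\{x\in\mathbb{R}^d:|x|<1\}$, $\mathbb{D}=\{z\in\mathbb{C}:|z|<1\}$; $\mathbb{S}^{d-1}$ is the unit sphere with rotation-invariant measure $d\theta$. $\mathcal{H}_k(\mathbb{R}^d)$ is the space of harmonic homogeneous polynomials of degree $k$, $a_k=\dim\mathcal{H}_k(\mathbb{R}^d)$, and $Y_{k,\ell}$ ($\ell=1,\dots,a_k$) is a fixed real-valued basis of $\mathcal{H}_k(\mathbb{R}^d)$ orthonormal for $\int_{\mathbb{S}^{d-1}}f\overline g\,d\theta$. A (finite) signed measure $\mu$ is pseudo-positive with respect to the basis $Y_{k,\ell}$ if $\int_{\mathbb{R}^d}h(|x|)Y_{k,\ell}(x)\,d\mu(x)\ge0$ for every non-negative continuous function $h$ and all $k\in\mathbb{N}_0$, $\ell=1,\dots,a_k$. The component measures $\mu_{k,\ell}$ are the (non-negative) measures on $[0,b]$ defined by $$\int_0^bg(r)\,d\mu_{k,\ell}(r)=\int g(|x|)\,Y_{k,\ell}(x/|x|)\,d\mu(x)$$ for functions $g$ on $[0,b]$, where for $k\ge1$ the point $x=0$ contributes zero (for $k=0$, $Y_{0,1}$ is a constant); they are regarded as measures on $[0,1]$ by zero extension. $\mathcal{B}=\mathbb{D}\times\mathbb{S}^{d-1}/\mathbb{Z}_2$ (with $(z,\theta)$ and $(-z,-\theta)$ identified) is the unit ball of the Klein-Dirac quadric. $H^2(\mathbb{D})$ is the classical Hardy space with $\|g\|^2_{H^2(\mathbb{D})}=\sup_{r<1}\frac1{2\pi}\int_0^{2\pi}|g(re^{i\varphi})|^2d\varphi$.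 The polyharmonic Hardy space $H^2(\mathcal{B})$ is the space of functions $f(z,\theta)=\sum_{k=0}^\infty\sum_{\ell=1}^{a_k}f_{k,\ell}(z)Y_{k,\ell}(\theta)$ with each $f_{k,\ell}$ of the form $f_{k,\ell}(z)=g_{k,\ell}(z^2)z^k$, $g_{k,\ell}\in H^2(\mathbb{D})$, and $\sum_{k,\ell}\|f_{k,\ell}\|^2_{H^2(\mathbb{D})}<\infty$. The $f_{k,\ell}$ are the Laplace-Fourier coefficients of $f$: $f_{k,\ell}(r)=\int_{\mathbb{S}^{d-1}}f(r\theta)Y_{k,\ell}(\theta)\,d\theta$ for $0\le r<1$. On $B$, $f(x)$ means $f(r,\theta)$ with $x=r\theta$. *)

theory Defs
  imports "HOL-Complex_Analysis.Complex_Analysis" "HOL-Library.Function_Algebras"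
begin

text \<open>
  The dimension \<open>d\<close> has to be a term and not a type, because the constant in the final estimate
  must not depend on it. Points of \<open>\<real>\<^sup>d\<close> are therefore the extensional functions on \<open>{..<d}\<close>,
  i.e. the elements of the space of the product measure below.
\<close>

definition borel_Rd :: "nat \<Rightarrow> (nat \<Rightarrow> real) measure" where
  "borel_Rd d = (\<Pi>\<^sub>M i\<in>{..<d}. borel)"

definition nrm :: "nat \<Rightarrow> (nat \<Rightarrow> real) \<Rightarrow> real" where
  "nrm d x = L2_set x {..<d}"

definition usphere :: "nat \<Rightarrow> (nat \<Rightarrow> real) set" where
  "usphere d = {x \<in> space (borel_Rd d). nrm d x = 1}"

text \<open>Since \<open>x / 0 = 0\<close>, the direction of the origin is the zero vector.\<close>

definition direction :: "nat \<Rightarrow> (nat \<Rightarrow> real) \<Rightarrow> nat \<Rightarrow> real" where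
  "direction d x = (\<lambda>i\<in>{..<d}. x i / nrm d x)"

text \<open>
  Surface measure of the unit sphere, by polar coordinates: the area of \<open>A\<close> is \<open>d\<close> times the
  Lebesgue measure of the cone \<open>{r \<theta> | 0 < r \<le> 1, \<theta> \<in> A}\<close>.
\<close>

definition sphere_measure :: "nat \<Rightarrow> (nat \<Rightarrow> real) measure" where
  "sphere_measure d =
     distr (scale_measure (of_nat d)
             (restrict_space (\<Pi>\<^sub>M i\<in>{..<d}. lborel) {x. 0 < nrm d x \<and> nrm d x \<le> 1}))
           (restrict_space (borel_Rd d) (usphere d)) (direction d)"


section \<open>Spherical harmonics\<close>

global_interpretation fun_space: vector_space "\<lambda>(c::real) (p :: 'a \<Rightarrow> real) x. c * p x"
  defines fun_dim = fun_space.dim and fun_span = fun_space.span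
  by unfold_locales (auto simp: fun_eq_iff algebra_simps)

definition multi_indices :: "nat \<Rightarrow> nat \<Rightarrow> (nat \<Rightarrow> nat) set" where
  "multi_indices d k = {\<alpha> \<in> {..<d} \<rightarrow>\<^sub>E {..k}. (\<Sum>i<d. \<alpha> i) = k}"

definition homogeneous_polys :: "nat \<Rightarrow> nat \<Rightarrow> ((nat \<Rightarrow> real) \<Rightarrow> real) set" where
  "homogeneous_polys d k =
     {p. \<exists>c. p = (\<lambda>x. \<Sum>\<alpha>\<in>multi_indices d k. c \<alpha> * (\<Prod>i<d. x i ^ \<alpha> i))}"

definition laplacian :: "nat \<Rightarrow> ((nat \<Rightarrow> real) \<Rightarrow> real) \<Rightarrow> (nat \<Rightarrow> real) \<Rightarrow> real" where
  "laplacian d p x = (\<Sum>i<d. (deriv ^^ 2) (\<lambda>s. p (x(i := s))) (x i))"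

definition harmonic_polys :: "nat \<Rightarrow> nat \<Rightarrow> ((nat \<Rightarrow> real) \<Rightarrow> real) set" where
  "harmonic_polys d k = {p \<in> homogeneous_polys d k. \<forall>x. laplacian d p x = 0}"

definition harm_dim :: "nat \<Rightarrow> nat \<Rightarrow> nat" where
  "harm_dim d k = fun_dim (harmonic_polys d k)"

definition harmonic_basis :: "nat \<Rightarrow> (nat \<Rightarrow> nat \<Rightarrow> (nat \<Rightarrow> real) \<Rightarrow> real) \<Rightarrow> bool" where
  "harmonic_basis d Y \<longleftrightarrow>
     (\<forall>k. (\<forall>l\<in>{1..harm_dim d k}. Y k l \<in> harmonic_polys d k) \<and>
          fun_span (Y k ` {1..harm_dim d k}) = harmonic_polys d k \<and>
          (\<forall>l\<in>{1..harm_dim d k}. \<forall>m\<in>{1..harm_dim d k}.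
             (\<integral>\<theta>. Y k l \<theta> * Y k m \<theta> \<partial>sphere_measure d) = (if l = m then 1 else 0)))"


section \<open>Signed measures\<close>

definition signed_measure :: "'a measure \<Rightarrow> ('a set \<Rightarrow> real) \<Rightarrow> bool" where
  "signed_measure M \<mu> \<longleftrightarrow>
     \<mu> {} = 0 \<and>
     (\<forall>A. range A \<subseteq> sets M \<longrightarrow> disjoint_family A \<longrightarrow>
        (\<lambda>i::nat. \<mu> (A i)) sums \<mu> (\<Union>i. A i))"

text \<open>
  The positive part of the Jordan decomposition; \<^const>\<open>ennreal\<close> truncates negative values to 0.
  The negative part of \<open>\<mu>\<close> is the positive part of \<open>-\<mu>\<close>.
\<close>

definition upper_variation :: "'a measure \<Rightarrow> ('a set \<Rightarrow> real) \<Rightarrow> 'a measure" where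
  "upper_variation M \<mu> =
     measure_of (space M) (sets M) (\<lambda>A. SUP E\<in>{E \<in> sets M. E \<subseteq> A}. ennreal (\<mu> E))"

definition signed_integrable ::
    "'a measure \<Rightarrow> ('a set \<Rightarrow> real) \<Rightarrow> ('a \<Rightarrow> 'b::{banach, second_countable_topology}) \<Rightarrow> bool" where
  "signed_integrable M \<mu> f \<longleftrightarrow>
     integrable (upper_variation M \<mu>) f \<and> integrable (upper_variation M (\<lambda>A. - \<mu> A)) f"

definition signed_integral ::
    "'a measure \<Rightarrow> ('a set \<Rightarrow> real) \<Rightarrow> ('a \<Rightarrow> 'b::{banach, second_countable_topology}) \<Rightarrow> 'b" where
  "signed_integral M \<mu> f =
     (\<integral>x. f x \<partial>upper_variation M \<mu>) - (\<integral>x. f x \<partial>upper_variation M (\<lambda>A. - \<mu> A))"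

definition supported_in_cball :: "nat \<Rightarrow> real \<Rightarrow> ((nat \<Rightarrow> real) set \<Rightarrow> real) \<Rightarrow> bool" where
  "supported_in_cball d b \<mu> \<longleftrightarrow>
     (\<forall>A\<in>sets (borel_Rd d). (\<forall>x\<in>A. nrm d x > b) \<longrightarrow> \<mu> A = 0)"

lemma signed_measure_Un:
  assumes \<mu>: "signed_measure M \<mu>" and A: "A \<in> sets M" and B: "B \<in> sets M" and "A \<inter> B = {}"
  shows "\<mu> (A \<union> B) = \<mu> A + \<mu> B"
proof -
  define F where "F = (\<lambda>i::nat. if i = 0 then A else if i = 1 then B else {})"
  have U: "(\<Union>i. F i) = A \<union> B"
    by (auto simp: F_def split: if_splits)
  have "range F \<subseteq> sets M" "disjoint_family F"
    using A B \<open>A \<inter> B = {}\<close> by (auto simp: F_def disjoint_family_on_def)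
  then have "(\<lambda>i. \<mu> (F i)) sums \<mu> (A \<union> B)"
    using \<mu> U unfolding signed_measure_def by metis
  moreover have "(\<lambda>i. \<mu> (F i)) sums (\<Sum>i\<in>{0,1}. \<mu> (F i))"
    by (rule sums_finite) (use \<mu> in \<open>auto simp: F_def signed_measure_def\<close>)
  ultimately show ?thesis
    by (auto simp: F_def dest: sums_unique2)
qed

lemma upper_variation_measure_space:
  assumes \<mu>: "signed_measure M \<mu>"
  shows "measure_space (space M) (sets M) (\<lambda>A. SUP E\<in>{E \<in> sets M. E \<subseteq> A}. ennreal (\<mu> E))"
    (is "measure_space _ _ ?V")
proof -
  have empty: "\<mu> {} = 0"
    using \<mu> by (simp add: signed_measure_def)
  have ge: "ennreal (\<mu> E) \<le> ?V A" if "E \<in> sets M" "E \<subseteq> A" for E A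
    using that by (intro SUP_upper) auto
  have mono: "?V A \<le> ?V B" if "A \<subseteq> B" for A B
    using that by (intro SUP_subset_mono) auto
  have nonneg: "\<exists>E'\<in>sets M. E' \<subseteq> A \<and> 0 \<le> \<mu> E' \<and> ennreal (\<mu> E') = ennreal (\<mu> E)"
    if "E \<in> sets M" "E \<subseteq> A" for E A
  proof (cases "0 \<le> \<mu> E")
    case True
    then show ?thesis using that by blast
  next
    case False
    then show ?thesis using empty by (intro bexI[of _ "{}"]) (auto simp: ennreal_neg)
  qed
  have super: "?V A + ?V B \<le> ?V (A \<union> B)" if "A \<inter> B = {}" for A B
  proof -
    have 1: "ennreal (\<mu> E) + ennreal (\<mu> F) \<le> ?V (A \<union> B)"
      if E: "E \<in> sets M" "E \<subseteq> A" and F: "F \<in> sets M" "F \<subseteq> B" for E F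
    proof -
      obtain E' where E': "E' \<in> sets M" "E' \<subseteq> A" "0 \<le> \<mu> E'" "ennreal (\<mu> E') = ennreal (\<mu> E)"
        using nonneg[OF E] by blast
      obtain F' where F': "F' \<in> sets M" "F' \<subseteq> B" "0 \<le> \<mu> F'" "ennreal (\<mu> F') = ennreal (\<mu> F)"
        using nonneg[OF F] by blast
      have "\<mu> (E' \<union> F') = \<mu> E' + \<mu> F'"
        using E' F' \<open>A \<inter> B = {}\<close> by (intro signed_measure_Un[OF \<mu>]) auto
      then have "ennreal (\<mu> E) + ennreal (\<mu> F) = ennreal (\<mu> (E' \<union> F'))"
        using E' F' by (metis ennreal_plus)
      also have "\<dots> \<le> ?V (A \<union> B)"
        using E' F' by (intro ge) auto
      finally show ?thesis .
    qed
    have ne: "{E \<in> sets M. E \<subseteq> C} \<noteq> {}" for C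
      by auto
    have 2: "ennreal (\<mu> E) + ?V B \<le> ?V (A \<union> B)" if "E \<in> sets M" "E \<subseteq> A" for E
      unfolding ennreal_SUP_add_right[OF ne] using 1 that by (intro SUP_least) auto
    have "?V A + ?V B = (SUP E\<in>{E \<in> sets M. E \<subseteq> A}. ennreal (\<mu> E) + ?V B)"
      by (rule ennreal_SUP_add_left[OF ne, symmetric])
    also have "\<dots> \<le> ?V (A \<union> B)"
      using 2 by (intro SUP_least) auto
    finally show ?thesis .
  qed
  have "countably_additive (sets M) ?V"
  proof (rule countably_additiveI)
    fix A :: "nat \<Rightarrow> 'a set"
    assume A: "range A \<subseteq> sets M" "disjoint_family A" "(\<Union>i. A i) \<in> sets M"
    have "(\<Sum>i<n. ?V (A i)) \<le> ?V (\<Union>i<n. A i)" for n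
    proof (induction n)
      case 0
      then show ?case by simp
    next
      case (Suc n)
      have disj: "(\<Union>i<n. A i) \<inter> A n = {}"
      proof -
        have "A i \<inter> A n = {}" if "i < n" for i
          using A(2) that by (intro disjoint_family_onD) auto
        then show ?thesis by blast
      qed
      have "(\<Sum>i<Suc n. ?V (A i)) \<le> ?V (\<Union>i<n. A i) + ?V (A n)"
        unfolding sum.lessThan_Suc by (intro add_right_mono Suc.IH)
      also have "\<dots> \<le> ?V ((\<Union>i<n. A i) \<union> A n)"
        by (rule super[OF disj])
      finally show ?case
        unfolding lessThan_Suc UN_insert Un_commute[of "A n"] .
    qed
    then have "(\<Sum>i<n. ?V (A i)) \<le> ?V (\<Union>i. A i)" for n
      by (rule order_trans) (auto intro!: mono)
    then have le: "(\<Sum>i. ?V (A i)) \<le> ?V (\<Union>i. A i)"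
      by (intro suminf_le_const) auto
    have "ennreal (\<mu> E) \<le> (\<Sum>i. ?V (A i))" if E: "E \<in> sets M" "E \<subseteq> (\<Union>i. A i)" for E
    proof -
      have "(\<Union>i. E \<inter> A i) = E"
        using E by auto
      moreover have "range (\<lambda>i. E \<inter> A i) \<subseteq> sets M" "disjoint_family (\<lambda>i. E \<inter> A i)"
        using A E by (auto simp: disjoint_family_on_def)
      ultimately have "(\<lambda>i. \<mu> (E \<inter> A i)) sums \<mu> E"
        using \<mu> unfolding signed_measure_def by metis
      then have lim: "(\<lambda>n. ennreal (\<Sum>i<n. \<mu> (E \<inter> A i))) \<longlonglongrightarrow> ennreal (\<mu> E)"
        by (intro tendsto_ennrealI) (simp add: sums_def)
      have "ennreal (\<Sum>i<n. \<mu> (E \<inter> A i)) \<le> (\<Sum>i. ?V (A i))" for n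
      proof -
        have "ennreal (\<Sum>i<n. \<mu> (E \<inter> A i)) \<le> ennreal (\<Sum>i<n. max 0 (\<mu> (E \<inter> A i)))"
          by (intro ennreal_leI sum_mono) auto
        also have "\<dots> = (\<Sum>i<n. ennreal (\<mu> (E \<inter> A i)))"
        proof -
          have "ennreal y = ennreal (max 0 y)" for y :: real
            by (simp add: max_def ennreal_neg)
          then have "(\<Sum>i<n. ennreal (\<mu> (E \<inter> A i))) = (\<Sum>i<n. ennreal (max 0 (\<mu> (E \<inter> A i))))"
            by (intro sum.cong) auto
          also have "\<dots> = ennreal (\<Sum>i<n. max 0 (\<mu> (E \<inter> A i)))"
            by (intro sum_ennreal) auto
          finally show ?thesis by simp
        qed
        also have "\<dots> \<le> (\<Sum>i<n. ?V (A i))"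
          using A E by (intro sum_mono ge) auto
        also have "\<dots> \<le> (\<Sum>i. ?V (A i))"
          by (intro sum_le_suminf) auto
        finally show ?thesis .
      qed
      then show ?thesis
        by (intro LIMSEQ_le_const2[OF lim]) auto
    qed
    then have "?V (\<Union>i. A i) \<le> (\<Sum>i. ?V (A i))"
      by (intro SUP_least) auto
    with le show "(\<Sum>i. ?V (A i)) = ?V (\<Union>i. A i)"
      by simp
  qed
  moreover have "positive (sets M) ?V"
    using empty by (auto simp: positive_def intro!: antisym SUP_least)
  ultimately show ?thesis
    by (simp add: measure_space_def sets.sigma_algebra_axioms)
qed

lemma sets_upper_variation [simp]: "sets (upper_variation M \<mu>) = sets M"
  and space_upper_variation [simp]: "space (upper_variation M \<mu>) = space M"
  by (simp_all add: upper_variation_def)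

lemma emeasure_upper_variation:
  assumes "signed_measure M \<mu>" and "A \<in> sets M"
  shows "emeasure (upper_variation M \<mu>) A = (SUP E\<in>{E \<in> sets M. E \<subseteq> A}. ennreal (\<mu> E))"
  using upper_variation_measure_space[OF assms(1)] assms(2)
  unfolding upper_variation_def measure_space_def
  by (intro emeasure_measure_of_sigma) auto

text \<open>
  Only used for \<open>\<mu>\<close> with bounded support, where all the integrals exist.
\<close>

definition pseudo_positive ::
    "nat \<Rightarrow> (nat \<Rightarrow> nat \<Rightarrow> (nat \<Rightarrow> real) \<Rightarrow> real) \<Rightarrow> ((nat \<Rightarrow> real) set \<Rightarrow> real) \<Rightarrow> bool" where
  "pseudo_positive d Y \<mu> \<longleftrightarrow>
     (\<forall>h. continuous_on {0..} h \<and> (\<forall>r\<ge>0. 0 \<le> h r) \<longrightarrow>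
        (\<forall>k. \<forall>l\<in>{1..harm_dim d k}.
           0 \<le> signed_integral (borel_Rd d) \<mu> (\<lambda>x. h (nrm d x) * Y k l x)))"

text \<open>
  The component measures \<open>\<nu> k l\<close> on \<open>[0,b]\<close>, extended by zero to the real line. At \<open>x = 0\<close> the
  factor \<open>Y k l (direction d x)\<close> is \<open>Y k l 0\<close>, which is 0 for \<open>k \<ge> 1\<close> and the constant value of
  \<open>Y 0 1\<close> for \<open>k = 0\<close>. The indicator function is needed because \<open>g\<close> is arbitrary outside \<open>[0,b]\<close>.
\<close>

definition component_measures ::
    "nat \<Rightarrow> (nat \<Rightarrow> nat \<Rightarrow> (nat \<Rightarrow> real) \<Rightarrow> real) \<Rightarrow> real \<Rightarrow> ((nat \<Rightarrow> real) set \<Rightarrow> real) \<Rightarrow>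
     (nat \<Rightarrow> nat \<Rightarrow> real measure) \<Rightarrow> bool" where
  "component_measures d Y b \<mu> \<nu> \<longleftrightarrow>
     (\<forall>k. \<forall>l\<in>{1..harm_dim d k}.
        finite_measure (\<nu> k l) \<and> sets (\<nu> k l) = sets borel \<and> emeasure (\<nu> k l) (- {0..b}) = 0 \<and>
        (\<forall>g. continuous_on {0..b} g \<longrightarrow>
           (LINT r:{0..b}|\<nu> k l. g r) =
           signed_integral (borel_Rd d) \<mu>
             (\<lambda>x. indicator {0..b} (nrm d x) * g (nrm d x) * Y k l (direction d x))))"


section \<open>Hardy spaces\<close>

definition hardy_mean :: "(complex \<Rightarrow> complex) \<Rightarrow> real \<Rightarrow> real" where
  "hardy_mean g r = 1 / (2 * pi) * integral {0..2 * pi} (\<lambda>\<phi>. (cmod (g (rcis r \<phi>)))\<^sup>2)"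

definition hardy_space :: "(complex \<Rightarrow> complex) set" where
  "hardy_space = {g. g holomorphic_on ball 0 1 \<and> bdd_above (hardy_mean g ` {0..<1})}"

definition hardy_norm :: "(complex \<Rightarrow> complex) \<Rightarrow> real" where
  "hardy_norm g = sqrt (SUP r\<in>{0..<1}. hardy_mean g r)"

text \<open>
  A function on the unit ball of the Klein-Dirac quadric is a function of \<open>(z, \<theta>)\<close> that takes the
  same value at \<open>(z, \<theta>)\<close> and \<open>(-z, -\<theta>)\<close>. Only the values for \<open>\<bar>z\<bar> < 1\<close> and \<open>\<bar>\<theta>\<bar> = 1\<close> matter.
\<close>

definition klein_dirac_function :: "nat \<Rightarrow> (complex \<Rightarrow> (nat \<Rightarrow> real) \<Rightarrow> complex) \<Rightarrow> bool" where
  "klein_dirac_function d f \<longleftrightarrow>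
     (\<forall>z\<in>ball 0 1. \<forall>\<theta>\<in>usphere d. f (- z) (\<lambda>i\<in>{..<d}. - \<theta> i) = f z \<theta>)"

definition polyharmonic_hardy_space ::
    "nat \<Rightarrow> (nat \<Rightarrow> nat \<Rightarrow> (nat \<Rightarrow> real) \<Rightarrow> real) \<Rightarrow> (complex \<Rightarrow> (nat \<Rightarrow> real) \<Rightarrow> complex) set" where
  "polyharmonic_hardy_space d Y =
     {f. klein_dirac_function d f \<and>
         (\<exists>F :: nat \<Rightarrow> nat \<Rightarrow> complex \<Rightarrow> complex.
            (\<forall>k. \<forall>l\<in>{1..harm_dim d k}. \<exists>g\<in>hardy_space.
               \<forall>z\<in>ball 0 1. F k l z = g (z\<^sup>2) * z ^ k) \<and>
            summable (\<lambda>k. \<Sum>l=1..harm_dim d k. (hardy_norm (F k l))\<^sup>2) \<and>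
            (\<forall>z\<in>ball 0 1. \<forall>\<theta>\<in>usphere d.
               (\<lambda>k. \<Sum>l=1..harm_dim d k. F k l z * complex_of_real (Y k l \<theta>)) sums f z \<theta>))}"

definition laplace_fourier ::
    "nat \<Rightarrow> (nat \<Rightarrow> nat \<Rightarrow> (nat \<Rightarrow> real) \<Rightarrow> real) \<Rightarrow> (complex \<Rightarrow> (nat \<Rightarrow> real) \<Rightarrow> complex) \<Rightarrow>
     nat \<Rightarrow> nat \<Rightarrow> complex \<Rightarrow> complex" where
  "laplace_fourier d Y f k l z = (\<integral>\<theta>. f z \<theta> * complex_of_real (Y k l \<theta>) \<partial>sphere_measure d)"

text \<open>
  The restriction to the unit ball of \<open>\<real>\<^sup>d\<close>: \<open>f(x) = f(r, \<theta>)\<close> where \<open>x = r \<theta>\<close> and \<open>r = \<bar>x\<bar>\<close>. For \<open>x = 0\<close>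
  the choice of \<open>\<theta>\<close> is immaterial, as \<open>f(0, \<theta>)\<close> does not depend on \<open>\<theta>\<close> for \<open>f\<close> in the space above.
\<close>

definition on_ball ::
    "nat \<Rightarrow> (complex \<Rightarrow> (nat \<Rightarrow> real) \<Rightarrow> complex) \<Rightarrow> (nat \<Rightarrow> real) \<Rightarrow> complex" where
  "on_ball d f x =
     f (complex_of_real (nrm d x)) (SOME \<theta>. \<theta> \<in> usphere d \<and> (\<forall>i<d. x i = nrm d x * \<theta> i))"

definition unit_ball_Rd :: "nat \<Rightarrow> (nat \<Rightarrow> real) set" where
  "unit_ball_Rd d = {x \<in> space (borel_Rd d). nrm d x < 1}"


section \<open>Quadrature and cubature\<close>

definition interpolatory_quadrature ::
    "nat \<Rightarrow> nat \<Rightarrow> real \<Rightarrow> real measure \<Rightarrow> (nat \<Rightarrow> real) \<Rightarrow> (nat \<Rightarrow> real) \<Rightarrow> bool" where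
  "interpolatory_quadrature N k b \<nu> t w \<longleftrightarrow>
     (\<forall>j\<le>N. t j \<in> {0..b}) \<and> inj_on t {..N} \<and>
     (\<forall>Q \<in> fun_span ((\<lambda>j r. r ^ (k + 2 * j)) ` {..N}).
        (LINT r:{0..b}|\<nu>. Q r) = (\<Sum>j\<le>N. w j * Q (t j)))"

definition cubature_term ::
    "nat \<Rightarrow> nat \<Rightarrow> (nat \<Rightarrow> nat \<Rightarrow> (nat \<Rightarrow> real) \<Rightarrow> real) \<Rightarrow> (nat \<Rightarrow> nat \<Rightarrow> nat \<Rightarrow> real) \<Rightarrow>
     (nat \<Rightarrow> nat \<Rightarrow> nat \<Rightarrow> real) \<Rightarrow> (complex \<Rightarrow> (nat \<Rightarrow> real) \<Rightarrow> complex) \<Rightarrow> nat \<Rightarrow> complex" where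
  "cubature_term N d Y t w f k =
     (\<Sum>l=1..harm_dim d k. \<Sum>j\<le>N.
        complex_of_real (w k l j) * laplace_fourier d Y f k l (complex_of_real (t k l j)))"

definition cubature ::
    "nat \<Rightarrow> nat \<Rightarrow> (nat \<Rightarrow> nat \<Rightarrow> (nat \<Rightarrow> real) \<Rightarrow> real) \<Rightarrow> (nat \<Rightarrow> nat \<Rightarrow> nat \<Rightarrow> real) \<Rightarrow>
     (nat \<Rightarrow> nat \<Rightarrow> nat \<Rightarrow> real) \<Rightarrow> (complex \<Rightarrow> (nat \<Rightarrow> real) \<Rightarrow> complex) \<Rightarrow> complex" where
  "cubature N d Y t w f = (\<Sum>k. cubature_term N d Y t w f k)"

definition cubature_error ::
    "nat \<Rightarrow> nat \<Rightarrow> (nat \<Rightarrow> nat \<Rightarrow> (nat \<Rightarrow> real) \<Rightarrow> real) \<Rightarrow> ((nat \<Rightarrow> real) set \<Rightarrow> real) \<Rightarrow>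
     (nat \<Rightarrow> nat \<Rightarrow> nat \<Rightarrow> real) \<Rightarrow> (nat \<Rightarrow> nat \<Rightarrow> nat \<Rightarrow> real) \<Rightarrow>
     (complex \<Rightarrow> (nat \<Rightarrow> real) \<Rightarrow> complex) \<Rightarrow> complex" where
  "cubature_error N d Y \<mu> t w f =
     signed_integral (borel_Rd d) \<mu> (\<lambda>x. indicator (unit_ball_Rd d) x *\<^sub>R on_ball d f x)
     - cubature N d Y t w f"

definition curve_length :: "real \<Rightarrow> real \<Rightarrow> (real \<Rightarrow> complex) \<Rightarrow> real" where
  "curve_length a b \<gamma> = integral {a..b} (\<lambda>t. norm (vector_derivative \<gamma> (at t)))"

definition L_Gamma :: real where
  "L_Gamma = curve_length 0 (2 * pi) (\<lambda>t. exp (\<i> * complex_of_real t))"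

lemma L_Gamma_eq: "L_Gamma = 2 * pi"
proof -
  have "vector_derivative (\<lambda>t. exp (\<i> * complex_of_real t)) (at t) = \<i> * exp (\<i> * complex_of_real t)" for t
    by (rule vector_derivative_at) (auto intro!: derivative_eq_intros has_vector_derivative_real_field)
  then show ?thesis
    by (simp add: L_Gamma_def curve_length_def norm_mult)
qed

end

theory Submission
  imports Defs "HOL-Probability.Distributions"
begin

text \<open>
  The constant \<open>C\<^sub>N = 1\<close> works. Write \<open>f\<^sub>k\<^sub>l(z) = \<Sum>\<^sub>m c\<^sub>m z\<^sup>k\<^sup>+\<^sup>2\<^sup>m\<close>; Cauchy's estimate gives \<open>\<bar>c\<^sub>m\<bar> \<le> \<parallel>f\<^sub>k\<^sub>l\<parallel>\<close>.
  The quadrature error for \<open>r\<^sup>k\<^sup>+\<^sup>2\<^sup>m\<close> is the integral of \<open>r\<^sup>k\<close> against the error of the interpolation of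
  \<open>u\<^sup>m\<close> at the nodes \<open>t\<^sub>j\<^sup>2\<close>, which is \<open>\<Prod>(u - t\<^sub>j\<^sup>2)\<close> times a complete homogeneous symmetric sum of
  \<open>N + 2\<close> variables in \<open>[0,b\<^sup>2]\<close>; these sums add up to at most \<open>(1 - b\<^sup>2)\<^sup>-\<^sup>N\<^sup>-\<^sup>2\<close> over \<open>m\<close>.

  The interchange of sums and integrals rests on \<open>\<Sum>\<^sub>l Y\<^sub>k\<^sub>l(\<theta>)\<^sup>2 \<le> K (k + 1)\<^sup>d\<close> and on the orthogonality of
  harmonic polynomials of different degrees. Both are obtained from Gaussian integrals over
  \<open>\<real>\<^sup>d\<close>, where coordinates are independent and integration by parts is one-dimensional, and are
  carried over to the sphere by polar coordinates.
\<close>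

section \<open>Polynomial functions\<close>

text \<open>The remainder splits over (k,l), but \<mu> acts on whole functions. Before sums and
  integrals may be exchanged, the entire layer of degree k needs a bound uniform in x; bounding each
  harmonic separately would bring in the number of basis elements. The sum of squares of the basis
  avoids the count. Its growth is polynomial in k, while a coefficient starting with the power z^k
  is O(b^k) up to radius b, so the layer series converges geometrically. The second obstacle is that
  the quadrature weights come without any bound. They enter only through exactness: the cubature
  series converges because the series of exact integrals and the series of errors both do. The
  constant is 1 because each of the N + 1 factors of the node polynomial has modulus at most 1 on
  [0,b^2], and because 1 - b^2 is at least 1 - b. Membership in the Hardy space only asserts that
  some coefficient family exists. Orthogonality across degrees is what identifies it with the
  integrals of f against the basis.\<close>

inductive_set polyfuns :: "nat \<Rightarrow> ((nat \<Rightarrow> real) \<Rightarrow> real) set" for d where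
  monomial: "(\<lambda>x. c * (\<Prod>i<d. x i ^ \<alpha> i)) \<in> polyfuns d"
| add: "p \<in> polyfuns d \<Longrightarrow> q \<in> polyfuns d \<Longrightarrow> (\<lambda>x. p x + q x) \<in> polyfuns d"

lemma polyfuns_const: "(\<lambda>x. c) \<in> polyfuns d"
  using polyfuns.monomial[of c "\<lambda>_. 0" d] by simp

lemma polyfuns_coord: "i < d \<Longrightarrow> (\<lambda>x. x i) \<in> polyfuns d"
proof -
  assume "i < d"
  then have "(\<Prod>j<d. x j ^ (if j = i then 1 else 0)) = x i" for x :: "nat \<Rightarrow> real"
    by (subst prod.mono_neutral_right[of _ "{i}"]) auto
  then show ?thesis using polyfuns.monomial[of 1 "\<lambda>j. if j = i then 1 else 0" d] by simp
qed

lemma polyfuns_monomial_mult: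
  assumes "q \<in> polyfuns d"
  shows "(\<lambda>x. c * (\<Prod>i<d. x i ^ \<alpha> i) * q x) \<in> polyfuns d"
  using assms
proof (induction rule: polyfuns.induct)
  case (monomial e \<beta>)
  have "(\<lambda>x. c * (\<Prod>i<d. x i ^ \<alpha> i) * (e * (\<Prod>i<d. x i ^ \<beta> i)))
      = (\<lambda>x::nat \<Rightarrow> real. (c * e) * (\<Prod>i<d. x i ^ (\<alpha> i + \<beta> i)))"
    by (simp add: power_add prod.distrib fun_eq_iff)
  then show ?case
    using polyfuns.monomial[of "c * e" "\<lambda>i. \<alpha> i + \<beta> i" d] by (simp only:)
next
  case (add q1 q2)
  show ?case unfolding distrib_left by (rule polyfuns.add[OF add.IH])
qed

text \<open>Closure under products is derived instead of being a rule of \<open>polyfuns\<close>, so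
  that later inductions meet only sums and monomials, for which Gaussian integrals factor over the
  coordinates.\<close>

lemma polyfuns_mult:
  assumes "p \<in> polyfuns d" "q \<in> polyfuns d"
  shows "(\<lambda>x. p x * q x) \<in> polyfuns d"
  using assms(1)
proof (induction rule: polyfuns.induct)
  case (monomial c \<alpha>)
  show ?case by (rule polyfuns_monomial_mult[OF assms(2)])
next
  case (add p1 p2)
  show ?case unfolding distrib_right by (rule polyfuns.add[OF add.IH])
qed

lemma polyfuns_cmult: "p \<in> polyfuns d \<Longrightarrow> (\<lambda>x. c * p x) \<in> polyfuns d"
  by (rule polyfuns_mult[OF polyfuns_const])

lemma polyfuns_sum:
  assumes "\<And>i. i \<in> I \<Longrightarrow> p i \<in> polyfuns d"
  shows "(\<lambda>x. \<Sum>i\<in>I. p i x) \<in> polyfuns d"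
  using assms
proof (induction I rule: infinite_finite_induct)
  case (insert i I)
  then have "(\<lambda>x. p i x + (\<Sum>i\<in>I. p i x)) \<in> polyfuns d"
    by (intro polyfuns.add[of "p i"]) auto
  then show ?case using insert.hyps by simp
qed (simp_all add: polyfuns_const)

lemma polyfuns_measurable [measurable]:
  "p \<in> polyfuns d \<Longrightarrow> p \<in> borel_measurable (\<Pi>\<^sub>M i\<in>{..<d}. borel)"
  by (induction rule: polyfuns.induct) simp_all

text \<open>Points of the product space are \<open>undefined\<close> outside \<open>{..<d}\<close>,
  while expressions such as \<open>\<lambda>i. x i + s * z i\<close> are ordinary total functions;
  this passes between the two.\<close>

lemma polyfuns_cong: "p \<in> polyfuns d \<Longrightarrow> (\<And>i. i < d \<Longrightarrow> x i = y i) \<Longrightarrow> p x = p y"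
  by (induction rule: polyfuns.induct) auto

section \<open>Partial derivatives and affine substitutions of polynomial functions\<close>

definition partial_deriv :: "nat \<Rightarrow> ((nat \<Rightarrow> real) \<Rightarrow> real) \<Rightarrow> (nat \<Rightarrow> real) \<Rightarrow> real" where
  "partial_deriv i p x = deriv (\<lambda>s. p (x(i := s))) (x i)"

text \<open>For \<open>\<alpha> i = 0\<close> the truncated exponent \<open>\<alpha> i - 1\<close>
  is harmless, since the coefficient \<open>real (\<alpha> i)\<close> vanishes.\<close>

lemma monomial_has_partial_deriv:
  fixes x :: "nat \<Rightarrow> real"
  assumes "i < d"
  shows "((\<lambda>s. c * (\<Prod>j<d. (x(i := s)) j ^ \<alpha> j)) has_field_derivative
     (c * real (\<alpha> i)) * (\<Prod>j<d. (x(i := s)) j ^ (\<alpha>(i := \<alpha> i - 1)) j)) (at s)"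
proof -
  have split: "(\<Prod>j<d. (x(i := s)) j ^ \<beta> j) = s ^ \<beta> i * (\<Prod>j\<in>{..<d} - {i}. x j ^ \<beta> j)" for s \<beta>
    using assms by (subst prod.remove[of _ i]) auto
  have "((\<lambda>s. c * (s ^ \<alpha> i * (\<Prod>j\<in>{..<d} - {i}. x j ^ \<alpha> j))) has_field_derivative
     c * (real (\<alpha> i) * s ^ (\<alpha> i - 1) * (\<Prod>j\<in>{..<d} - {i}. x j ^ \<alpha> j))) (at s)"
    by (auto intro!: derivative_eq_intros)
  moreover have "(\<Prod>j\<in>{..<d} - {i}. x j ^ (\<alpha>(i := \<alpha> i - 1)) j) = (\<Prod>j\<in>{..<d} - {i}. x j ^ \<alpha> j)"
    by (intro prod.cong) auto
  ultimately show ?thesis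
    unfolding split by (simp add: mult_ac)
qed

lemma partial_deriv_monomial: "i < d \<Longrightarrow> partial_deriv i (\<lambda>x. c * (\<Prod>j<d. x j ^ \<alpha> j)) =
    (\<lambda>x. (c * real (\<alpha> i)) * (\<Prod>j<d. x j ^ (\<alpha>(i := \<alpha> i - 1)) j))"
proof
  fix x assume "i < d"
  from DERIV_imp_deriv[OF monomial_has_partial_deriv[OF this, of c x \<alpha> "x i"]]
  show "partial_deriv i (\<lambda>x. c * (\<Prod>j<d. x j ^ \<alpha> j)) x = (c * real (\<alpha> i)) * (\<Prod>j<d. x j ^ (\<alpha>(i := \<alpha> i - 1)) j)"
    unfolding partial_deriv_def fun_upd_triv .
qed

lemma partial_deriv_eqI:
  "(\<And>x. ((\<lambda>s. p (x(i := s))) has_field_derivative q x) (at (x i))) \<Longrightarrow> partial_deriv i p = q"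
  unfolding partial_deriv_def by (auto intro!: DERIV_imp_deriv)

text \<open>Since \<open>deriv\<close> is total, differentiability has to be established along with
  the value. The form at an arbitrary point of the coordinate line is the one that the chain rule in
  \<open>partial_deriv_affine\<close> consumes.\<close>

lemma polyfuns_has_partial_deriv:
  assumes "p \<in> polyfuns d" "i < d"
  shows "((\<lambda>s. p (x(i := s))) has_field_derivative partial_deriv i p (x(i := s))) (at s)"
  using assms(1)
proof (induction arbitrary: x s)
  case (monomial c \<alpha>)
  show ?case
    unfolding partial_deriv_monomial[OF assms(2)] by (rule monomial_has_partial_deriv[OF assms(2)])
next
  case (add p q)
  have *: "((\<lambda>s. p (x(i := s)) + q (x(i := s))) has_field_derivative partial_deriv i p (x(i := s)) + partial_deriv i q (x(i := s))) (at s)" for x s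
    by (intro DERIV_add add.IH)
  have "partial_deriv i (\<lambda>x. p x + q x) = (\<lambda>x. partial_deriv i p x + partial_deriv i q x)"
  proof (rule partial_deriv_eqI)
    fix x
    show "((\<lambda>s. p (x(i := s)) + q (x(i := s))) has_field_derivative partial_deriv i p x + partial_deriv i q x) (at (x i))"
      using *[of x "x i"] by (simp only: fun_upd_triv)
  qed
  with * show ?case by (simp only:)
qed

lemma polyfuns_has_partial_deriv':
  assumes "p \<in> polyfuns d" "i < d"
  shows "((\<lambda>s. p (x(i := s))) has_field_derivative partial_deriv i p x) (at (x i))"
  using polyfuns_has_partial_deriv[OF assms, of x "x i"] by simp

lemma partial_deriv_add: "p \<in> polyfuns d \<Longrightarrow> q \<in> polyfuns d \<Longrightarrow> i < d \<Longrightarrow>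
    partial_deriv i (\<lambda>x. p x + q x) = (\<lambda>x. partial_deriv i p x + partial_deriv i q x)"
  by (intro partial_deriv_eqI DERIV_add polyfuns_has_partial_deriv')

lemma partial_deriv_mult: "p \<in> polyfuns d \<Longrightarrow> q \<in> polyfuns d \<Longrightarrow> i < d \<Longrightarrow>
    partial_deriv i (\<lambda>x. p x * q x) = (\<lambda>x. partial_deriv i p x * q x + p x * partial_deriv i q x)"
  by (intro partial_deriv_eqI) (auto intro!: derivative_eq_intros polyfuns_has_partial_deriv')

lemma polyfuns_partial_deriv:
  assumes "p \<in> polyfuns d" "i < d"
  shows "partial_deriv i p \<in> polyfuns d"
  using assms(1)
proof induction
  case (monomial c \<alpha>)
  show ?case unfolding partial_deriv_monomial[OF assms(2)] by (rule polyfuns.monomial)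
next
  case (add p q)
  then show ?case
    unfolding partial_deriv_add[OF add.hyps assms(2)] by (intro polyfuns.add)
qed

text \<open>The derivative along a line. For the base point 0 it yields Euler's identity; averaged
  over a Gaussian z it yields the mean value property.\<close>

lemma polyfuns_chain:
  assumes "p \<in> polyfuns d"
  shows "((\<lambda>s. p (\<lambda>i. x i + s * z i)) has_field_derivative
     (\<Sum>i<d. z i * partial_deriv i p (\<lambda>i. x i + s * z i))) (at s)"
  using assms
proof induction
  case (monomial c \<alpha>)
  have "((\<lambda>s. c * (\<Prod>i<d. (x i + s * z i) ^ \<alpha> i)) has_field_derivative
     c * (\<Sum>i<d. (real (\<alpha> i) * (x i + s * z i) ^ (\<alpha> i - 1) * z i) * (\<Prod>j\<in>{..<d} - {i}. (x j + s * z j) ^ \<alpha> j))) (at s)"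
  proof (rule DERIV_cmult, rule has_field_derivative_prod)
    fix i
    show "((\<lambda>s. (x i + s * z i) ^ \<alpha> i) has_field_derivative real (\<alpha> i) * (x i + s * z i) ^ (\<alpha> i - 1) * z i) (at s)"
      by (auto intro!: derivative_eq_intros)
  qed
  moreover have "z i * partial_deriv i (\<lambda>x. c * (\<Prod>i<d. x i ^ \<alpha> i)) (\<lambda>i. x i + s * z i) =
     c * ((real (\<alpha> i) * (x i + s * z i) ^ (\<alpha> i - 1) * z i) * (\<Prod>j\<in>{..<d} - {i}. (x j + s * z j) ^ \<alpha> j))"
    if "i < d" for i
  proof -
    have "(\<Prod>j<d. (x j + s * z j) ^ (\<alpha>(i := \<alpha> i - 1)) j)
        = (x i + s * z i) ^ (\<alpha> i - 1) * (\<Prod>j\<in>{..<d} - {i}. (x j + s * z j) ^ (\<alpha>(i := \<alpha> i - 1)) j)"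
      using that by (subst prod.remove[of _ i]) auto
    also have "(\<Prod>j\<in>{..<d} - {i}. (x j + s * z j) ^ (\<alpha>(i := \<alpha> i - 1)) j)
        = (\<Prod>j\<in>{..<d} - {i}. (x j + s * z j) ^ \<alpha> j)"
      by (intro prod.cong) auto
    finally show ?thesis
      unfolding partial_deriv_monomial[OF that] by (simp only: mult_ac)
  qed
  then have "(\<Sum>i<d. z i * partial_deriv i (\<lambda>x. c * (\<Prod>i<d. x i ^ \<alpha> i)) (\<lambda>i. x i + s * z i)) =
     c * (\<Sum>i<d. (real (\<alpha> i) * (x i + s * z i) ^ (\<alpha> i - 1) * z i) * (\<Prod>j\<in>{..<d} - {i}. (x j + s * z j) ^ \<alpha> j))"
    unfolding sum_distrib_left by (intro sum.cong) auto
  ultimately show ?case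
    by (simp only:)
next
  case (add p q)
  have "(\<Sum>i<d. z i * partial_deriv i (\<lambda>x. p x + q x) y) = (\<Sum>i<d. z i * partial_deriv i p y) + (\<Sum>i<d. z i * partial_deriv i q y)" for y
    by (simp add: partial_deriv_add[OF add.hyps] distrib_left sum.distrib)
  then show ?case
    using DERIV_add[OF add.IH] by (simp only:)
qed

text \<open>For fixed x, the Gaussian mean over z of such an expansion is an ordinary polynomial in
  s, so it can be differentiated term by term and no differentiation under the integral sign is
  needed.\<close>

lemma polyfuns_expansion:
  assumes "p \<in> polyfuns d"
  shows "\<exists>n c. (\<forall>j. c j \<in> polyfuns d) \<and> (\<forall>s z. p (\<lambda>i. x i + s * z i) = (\<Sum>j\<le>n. s ^ j * c j z))"
proof -
  \<comment> \<open>\<open>X\<close> collects the functions of s and z that admit such an expansion.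
    It is closed under sums and products and contains the constants and each
    \<open>x i + s * z i\<close>, hence every polynomial in them.\<close>
  define X where "X = {h :: real \<Rightarrow> (nat \<Rightarrow> real) \<Rightarrow> real. \<exists>n c. (\<forall>j. c j \<in> polyfuns d) \<and> (\<forall>s z. h s z = (\<Sum>j\<le>n. s ^ j * c j z))}"
  have X_I: "h \<in> X" if "\<And>j. c j \<in> polyfuns d" "\<And>s z. h s z = (\<Sum>j\<le>n. s ^ j * c j z)" for h c n
    unfolding X_def mem_Collect_eq using that by (intro exI[of _ n] exI[of _ c]) simp
  have X_E: "\<exists>n c. (\<forall>j. c j \<in> polyfuns d) \<and> (\<forall>s z. h s z = (\<Sum>j\<le>n. s ^ j * c j z))" if "h \<in> X" for h
    using that unfolding X_def mem_Collect_eq .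
  have base: "(\<lambda>s z. s ^ j * q z) \<in> X" if "q \<in> polyfuns d" for q j
  proof -
    have "(\<Sum>i\<le>j. s ^ i * (if i = j then q else (\<lambda>_. 0)) z) = s ^ j * q z" for s z
    proof -
      have "(\<Sum>i\<le>j. s ^ i * (if i = j then q else (\<lambda>_. 0)) z) = (\<Sum>i\<le>j. if i = j then s ^ j * q z else 0)"
        by (rule sum.cong) auto
      then show ?thesis by simp
    qed
    then show ?thesis
      by (intro X_I[of "\<lambda>i. if i = j then q else (\<lambda>_. 0)" _ j]) (simp_all add: that polyfuns_const)
  qed
  have X_add: "(\<lambda>s z. h s z + k s z) \<in> X" if hk: "h \<in> X" "k \<in> X" for h k
  proof -
    obtain n c where c: "\<forall>j. c j \<in> polyfuns d" "\<forall>s z. h s z = (\<Sum>j\<le>n. s ^ j * c j z)"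
      using X_E[OF hk(1)] by (elim exE conjE)
    obtain m e where e: "\<forall>j. e j \<in> polyfuns d" "\<forall>s z. k s z = (\<Sum>j\<le>m. s ^ j * e j z)"
      using X_E[OF hk(2)] by (elim exE conjE)
    note c = c[rule_format] and e = e[rule_format]
    define f where "f j = (\<lambda>z. (if j \<le> n then c j z else 0) + (if j \<le> m then e j z else 0))" for j
    have "f j \<in> polyfuns d" for j
      unfolding f_def
      by (rule polyfuns.add; cases "j \<le> n"; cases "j \<le> m"; simp add: c(1) e(1) polyfuns_const)
    moreover have "h s z + k s z = (\<Sum>j\<le>max n m. s ^ j * f j z)" for s z
    proof -
      have "(\<Sum>j\<le>n. s ^ j * c j z) = (\<Sum>j\<le>max n m. s ^ j * (if j \<le> n then c j z else 0))"
        "(\<Sum>j\<le>m. s ^ j * e j z) = (\<Sum>j\<le>max n m. s ^ j * (if j \<le> m then e j z else 0))"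
        by (rule sum.mono_neutral_cong_left; auto)+
      then show ?thesis
        unfolding c e f_def by (simp add: distrib_left sum.distrib)
    qed
    ultimately show ?thesis by (intro X_I[of f]) simp_all
  qed
  have X_sum: "(\<lambda>s z. \<Sum>i\<in>I. h i s z) \<in> X" if "finite I" "\<And>i. i \<in> I \<Longrightarrow> h i \<in> X" for I :: "nat set" and h
    using that
  proof induction
    case empty
    show ?case using base[OF polyfuns_const, of 0 0] by simp
  next
    case (insert i I)
    then have "(\<lambda>s z. h i s z + (\<Sum>i\<in>I. h i s z)) \<in> X"
      by (intro X_add) auto
    then show ?case using insert.hyps by simp
  qed
  have X_mult: "(\<lambda>s z. h s z * k s z) \<in> X" if hk: "h \<in> X" "k \<in> X" for h k
  proof -
    obtain n c where c: "\<forall>j. c j \<in> polyfuns d" "\<forall>s z. h s z = (\<Sum>j\<le>n. s ^ j * c j z)"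
      using X_E[OF hk(1)] by (elim exE conjE)
    obtain m e where e: "\<forall>j. e j \<in> polyfuns d" "\<forall>s z. k s z = (\<Sum>j\<le>m. s ^ j * e j z)"
      using X_E[OF hk(2)] by (elim exE conjE)
    note c = c[rule_format] and e = e[rule_format]
    have "(\<lambda>s z. h s z * k s z) = (\<lambda>s z. \<Sum>i\<le>n. \<Sum>j\<le>m. s ^ (i + j) * (c i z * e j z))"
      by (simp add: fun_eq_iff c e sum_product power_add mult_ac)
    moreover have "(\<lambda>s z. \<Sum>i\<le>n. \<Sum>j\<le>m. s ^ (i + j) * (c i z * e j z)) \<in> X"
      by (rule X_sum, simp, rule X_sum, simp, rule base, rule polyfuns_mult[OF c(1) e(1)])
    ultimately show ?thesis by (simp only:)
  qed
  have X_power: "(\<lambda>s z. h s z ^ n) \<in> X" if "h \<in> X" for h n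
  proof (induction n)
    case 0
    show ?case using base[OF polyfuns_const, of 0 1] by simp
  next
    case (Suc n)
    then show ?case using X_mult[OF that Suc] by simp
  qed
  have X_prod: "(\<lambda>s z. \<Prod>i<n. h i s z) \<in> X" if "\<And>i. i < n \<Longrightarrow> h i \<in> X" for n :: nat and h
    using that
  proof (induction n)
    case 0
    show ?case using base[OF polyfuns_const, of 0 1] by simp
  next
    case (Suc n)
    then show ?case using X_mult[of "\<lambda>s z. \<Prod>i<n. h i s z" "h n"] by simp
  qed
  have "(\<lambda>s z. p (\<lambda>i. x i + s * z i)) \<in> X"
    using assms
  proof induction
    case (monomial c \<alpha>)
    have lin: "(\<lambda>s z. x i + s * z i) \<in> X" if "i < d" for i
      using X_add[OF base[OF polyfuns_const, of 0 "x i"] base[OF polyfuns_coord[OF that], of 1]] by simp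
    have "(\<lambda>s z. \<Prod>i<d. (x i + s * z i) ^ \<alpha> i) \<in> X"
      by (rule X_prod, rule X_power, rule lin)
    then show ?case
      using X_mult[OF base[OF polyfuns_const, of 0 c]] by simp
  next
    case (add p q)
    show ?case by (rule X_add[OF add.IH])
  qed
  then show ?thesis unfolding X_def mem_Collect_eq .
qed

lemma polyfuns_affine:
  assumes "p \<in> polyfuns d"
  shows "(\<lambda>z. p (\<lambda>i. x i + s * z i)) \<in> polyfuns d"
proof -
  obtain n c where "\<And>j. c j \<in> polyfuns d" "\<And>s z. p (\<lambda>i. x i + s * z i) = (\<Sum>j\<le>n. s ^ j * c j z)"
    using polyfuns_expansion[OF assms] by blast
  moreover have "(\<lambda>z. \<Sum>j\<le>n. s ^ j * c j z) \<in> polyfuns d"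
    by (intro polyfuns_sum polyfuns_cmult calculation(1))
  ultimately show ?thesis by (simp only:)
qed

lemma partial_deriv_affine:
  assumes "p \<in> polyfuns d" "i < d"
  shows "partial_deriv i (\<lambda>z. p (\<lambda>j. x j + s * z j)) = (\<lambda>z. s * partial_deriv i p (\<lambda>j. x j + s * z j))"
proof (rule partial_deriv_eqI)
  fix z :: "nat \<Rightarrow> real"
  let ?y = "\<lambda>j. x j + s * z j"
  have *: "(\<lambda>t. p (\<lambda>j. x j + s * (z(i := t)) j)) = (\<lambda>t. p (?y(i := x i + s * t)))"
    by (intro ext arg_cong[where f = p]) auto
  have "((\<lambda>t. p (?y(i := x i + s * t))) has_field_derivative partial_deriv i p (?y(i := x i + s * z i)) * s) (at (z i))"
    by (rule DERIV_chain2[where f = "\<lambda>u. p (?y(i := u))", OF polyfuns_has_partial_deriv[OF assms]]) (auto intro!: derivative_eq_intros)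
  moreover have "?y(i := x i + s * z i) = ?y" by auto
  ultimately show "((\<lambda>t. p (\<lambda>j. x j + s * (z(i := t)) j)) has_field_derivative s * partial_deriv i p ?y) (at (z i))"
    unfolding * by (simp add: mult.commute)
qed

lemma laplacian_eq_partial_deriv: "laplacian d p x = (\<Sum>i<d. partial_deriv i (partial_deriv i p) x)"
proof -
  have "(deriv ^^ 2) (\<lambda>s. p (x(i := s))) (x i) = partial_deriv i (partial_deriv i p) x" for i
    by (simp add: partial_deriv_def numeral_2_eq_2)
  then show ?thesis by (simp add: laplacian_def)
qed

section \<open>Gaussian means of harmonic polynomials\<close>

abbreviation lebesgue_Rd :: "nat \<Rightarrow> (nat \<Rightarrow> real) measure" where
  "lebesgue_Rd d \<equiv> \<Pi>\<^sub>M i\<in>{..<d}. lborel"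

interpretation lb: product_sigma_finite "\<lambda>_ :: nat. lborel :: real measure"
  by standard

lemma sets_lebesgue_Rd: "sets (lebesgue_Rd d) = sets (\<Pi>\<^sub>M i\<in>{..<d}. borel)"
  by (intro sets_PiM_cong) auto

lemma measurable_lebesgue_Rd: "borel_measurable (lebesgue_Rd d) = borel_measurable (\<Pi>\<^sub>M i\<in>{..<d}. borel)"
  by (rule measurable_cong_sets[OF sets_lebesgue_Rd refl])

definition gauss :: "nat \<Rightarrow> (nat \<Rightarrow> real) \<Rightarrow> real" where
  "gauss d x = (\<Prod>i<d. std_normal_density (x i))"

definition gauss_mean :: "nat \<Rightarrow> ((nat \<Rightarrow> real) \<Rightarrow> real) \<Rightarrow> real" where
  "gauss_mean d p = (\<integral>x. gauss d x * p x \<partial>lebesgue_Rd d)"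

lemma gauss_nonneg: "0 \<le> gauss d x"
  unfolding gauss_def by (intro prod_nonneg) (auto simp: normal_density_nonneg)

definition normal_moment :: "nat \<Rightarrow> real" where
  "normal_moment n = (\<integral>x. std_normal_density x * x ^ n \<partial>lborel)"

lemma normal_moment_0: "normal_moment 0 = 1"
  using integral_std_normal_moment_even[of 0] by (simp add: normal_moment_def)

text \<open>This is integration by parts of x^n against the normal density, read off from the closed
  form of the moments so that no boundary terms appear. For n = 0 the factor \<open>real n\<close>
  annihilates the truncated index.\<close>

lemma normal_moment_Suc: "normal_moment (Suc n) = real n * normal_moment (n - 1)"
proof (cases "even n")
  case True
  then obtain k where n: "n = 2 * k" by blast
  have "normal_moment (Suc n) = 0"
    using integral_std_normal_moment_odd[of k] by (simp add: normal_moment_def n)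
  moreover have "real n * normal_moment (n - 1) = 0"
  proof (cases k)
    case (Suc j)
    then have "n - 1 = 2 * j + 1" using n by simp
    then show ?thesis using integral_std_normal_moment_odd[of j] by (simp add: normal_moment_def)
  qed (simp add: n)
  ultimately show ?thesis by simp
next
  case False
  then obtain k where n: "n = 2 * k + 1" by (rule oddE)
  have "normal_moment (Suc n) = fact (2 * Suc k) / (2 ^ Suc k * fact (Suc k))"
    using integral_std_normal_moment_even[of "Suc k"] by (simp add: normal_moment_def n)
  also have "\<dots> = real n * (fact (2 * k) / (2 ^ k * fact k))"
    by (simp add: n divide_simps)
  also have "fact (2 * k) / (2 ^ k * fact k) = normal_moment (n - 1)"
    using integral_std_normal_moment_even[of k] by (simp add: normal_moment_def n)
  finally show ?thesis .
qed

lemma gauss_monomial: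
  "gauss d x * (c * (\<Prod>i<d. x i ^ \<alpha> i)) = c * (\<Prod>i<d. std_normal_density (x i) * x i ^ \<alpha> i)"
  by (simp add: gauss_def prod.distrib)

lemma gauss_integrable:
  assumes "p \<in> polyfuns d"
  shows "integrable (lebesgue_Rd d) (\<lambda>x. gauss d x * p x)"
  using assms
proof (induction rule: polyfuns.induct)
  case (monomial c \<alpha>)
  show ?case unfolding gauss_monomial
    by (intro integrable_mult_right lb.product_integrable_prod[where f = "\<lambda>i x. std_normal_density x * x ^ \<alpha> i"]
        integrable_std_normal_moment) auto
next
  case (add p q)
  then show ?case unfolding distrib_left by (intro Bochner_Integration.integrable_add)
qed

lemma gauss_mean_monomial: "gauss_mean d (\<lambda>x. c * (\<Prod>i<d. x i ^ \<alpha> i)) = c * (\<Prod>i<d. normal_moment (\<alpha> i))"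
  unfolding gauss_mean_def gauss_monomial normal_moment_def
  by (subst integral_mult_right_zero, subst lb.product_integral_prod[where f = "\<lambda>i x. std_normal_density x * x ^ \<alpha> i"])
     (auto intro: integrable_std_normal_moment)

lemma gauss_mean_const: "gauss_mean d (\<lambda>_. c) = c"
  using gauss_mean_monomial[of d c "\<lambda>_. 0"] by (simp add: normal_moment_0)

lemma gauss_mean_add: "p \<in> polyfuns d \<Longrightarrow> q \<in> polyfuns d \<Longrightarrow>
    gauss_mean d (\<lambda>x. p x + q x) = gauss_mean d p + gauss_mean d q"
  unfolding gauss_mean_def distrib_left by (intro Bochner_Integration.integral_add gauss_integrable)

lemma gauss_mean_cmult: "gauss_mean d (\<lambda>x. c * p x) = c * gauss_mean d p"
  unfolding gauss_mean_def by (simp add: mult.left_commute)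

lemma gauss_mean_sum:
  "(\<And>i. i \<in> I \<Longrightarrow> p i \<in> polyfuns d) \<Longrightarrow> gauss_mean d (\<lambda>x. \<Sum>i\<in>I. p i x) = (\<Sum>i\<in>I. gauss_mean d (p i))"
  unfolding gauss_mean_def sum_distrib_left
  by (intro Bochner_Integration.integral_sum gauss_integrable)

text \<open>On a monomial both sides are products of one-dimensional moments that differ only in the
  factor of coordinate i, where \<open>normal_moment_Suc\<close> applies.\<close>

lemma gauss_mean_by_parts:
  assumes "p \<in> polyfuns d" "i < d"
  shows "gauss_mean d (partial_deriv i p) = gauss_mean d (\<lambda>x. x i * p x)"
  using assms(1)
proof (induction rule: polyfuns.induct)
  case (monomial c \<alpha>)
  have rem: "(\<Prod>j<d. h j) = h i * (\<Prod>j\<in>{..<d} - {i}. h j)" for h :: "nat \<Rightarrow> real"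
    using assms(2) by (subst prod.remove[of _ i]) auto
  have "gauss_mean d (partial_deriv i (\<lambda>x. c * (\<Prod>i<d. x i ^ \<alpha> i)))
      = c * real (\<alpha> i) * (\<Prod>j<d. normal_moment ((\<alpha>(i := \<alpha> i - 1)) j))"
    unfolding partial_deriv_monomial[OF assms(2)] gauss_mean_monomial ..
  also have "(\<Prod>j<d. normal_moment ((\<alpha>(i := \<alpha> i - 1)) j))
      = normal_moment (\<alpha> i - 1) * (\<Prod>j\<in>{..<d} - {i}. normal_moment (\<alpha> j))"
    unfolding rem by (intro arg_cong2[where f = "(*)"] prod.cong) auto
  finally have 1: "gauss_mean d (partial_deriv i (\<lambda>x. c * (\<Prod>i<d. x i ^ \<alpha> i)))
      = c * (normal_moment (Suc (\<alpha> i)) * (\<Prod>j\<in>{..<d} - {i}. normal_moment (\<alpha> j)))"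
    unfolding normal_moment_Suc by (simp only: mult_ac)
  have "(\<lambda>x. x i * (c * (\<Prod>j<d. x j ^ \<alpha> j))) = (\<lambda>x::nat \<Rightarrow> real. c * (\<Prod>j<d. x j ^ (\<alpha>(i := Suc (\<alpha> i))) j))"
  proof
    fix x :: "nat \<Rightarrow> real"
    have "(\<Prod>j\<in>{..<d} - {i}. x j ^ (\<alpha>(i := Suc (\<alpha> i))) j) = (\<Prod>j\<in>{..<d} - {i}. x j ^ \<alpha> j)"
      by (intro prod.cong) auto
    then show "x i * (c * (\<Prod>j<d. x j ^ \<alpha> j)) = c * (\<Prod>j<d. x j ^ (\<alpha>(i := Suc (\<alpha> i))) j)"
      unfolding rem[of "\<lambda>j. x j ^ \<alpha> j"] rem[of "\<lambda>j. x j ^ (\<alpha>(i := Suc (\<alpha> i))) j"] by simp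
  qed
  then have "gauss_mean d (\<lambda>x. x i * (c * (\<Prod>j<d. x j ^ \<alpha> j)))
      = c * (\<Prod>j<d. normal_moment ((\<alpha>(i := Suc (\<alpha> i))) j))"
    by (simp only: gauss_mean_monomial)
  also have "(\<Prod>j<d. normal_moment ((\<alpha>(i := Suc (\<alpha> i))) j))
      = normal_moment (Suc (\<alpha> i)) * (\<Prod>j\<in>{..<d} - {i}. normal_moment (\<alpha> j))"
    unfolding rem by (intro arg_cong2[where f = "(*)"] prod.cong) auto
  finally show ?case using 1 by simp
next
  case (add p q)
  show ?case
    unfolding partial_deriv_add[OF add.hyps assms(2)] distrib_left
    by (subst (1 2) gauss_mean_add) (simp_all add: add assms(2) polyfuns_partial_deriv polyfuns_mult polyfuns_coord)
qed

text \<open>Nonnegativity of the variance: expand the mean of (p - m)^2, where m is the mean of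
  p.\<close>

lemma gauss_mean_power2:
  assumes "p \<in> polyfuns d"
  shows "(gauss_mean d p)\<^sup>2 \<le> gauss_mean d (\<lambda>x. (p x)\<^sup>2)"
proof -
  define m where "m = gauss_mean d p"
  have p2: "(\<lambda>x. (p x)\<^sup>2) \<in> polyfuns d" and lin: "(\<lambda>x. (- 2 * m) * p x) \<in> polyfuns d"
    using polyfuns_mult[OF assms assms] polyfuns_cmult[OF assms] by (simp_all only: power2_eq_square)
  have "0 \<le> gauss_mean d (\<lambda>x. (p x - m)\<^sup>2)"
    unfolding gauss_mean_def by (intro integral_nonneg_AE) (auto simp: gauss_nonneg)
  also have "(\<lambda>x. (p x - m)\<^sup>2) = (\<lambda>x. ((p x)\<^sup>2 + (- 2 * m) * p x) + m\<^sup>2)"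
    by (simp add: power2_eq_square algebra_simps fun_eq_iff)
  also have "gauss_mean d \<dots> = gauss_mean d (\<lambda>x. (p x)\<^sup>2) + (- 2 * m) * m + m\<^sup>2"
    unfolding gauss_mean_add[OF polyfuns.add[OF p2 lin] polyfuns_const] gauss_mean_add[OF p2 lin]
      gauss_mean_cmult gauss_mean_const by (simp add: m_def)
  finally show ?thesis by (simp add: m_def power2_eq_square)
qed

text \<open>The derivative in s of the left-hand side is the mean of the sum of z_i times the i-th
  partial derivative of p. Integration by parts turns it into s times the mean of the Laplacian, as
  for the heat flow, and this is 0. Hence the mean is constant in s and can be evaluated at s =
  0.\<close>

lemma gauss_mean_harmonic:
  assumes p: "p \<in> polyfuns d" and harm: "\<And>x. laplacian d p x = 0"
  shows "gauss_mean d (\<lambda>z. p (\<lambda>i. x i + s * z i)) = p x"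
proof -
  obtain n c where c: "\<forall>j. c j \<in> polyfuns d" and exp: "\<forall>s z. p (\<lambda>i. x i + s * z i) = (\<Sum>j\<le>n. s ^ j * c j z)"
    using polyfuns_expansion[OF p, of x] by (elim exE conjE)
  note c = c[rule_format] and exp = exp[rule_format]
  define \<phi> where "\<phi> s = gauss_mean d (\<lambda>z. p (\<lambda>i. x i + s * z i))" for s
  have \<phi>_eq: "\<phi> s = (\<Sum>j\<le>n. s ^ j * gauss_mean d (c j))" for s
    unfolding \<phi>_def exp by (subst gauss_mean_sum) (simp_all add: gauss_mean_cmult polyfuns_cmult c)
  have "(\<phi> has_field_derivative 0) (at s)" for s
  proof -
    define u where "u i z = partial_deriv i p (\<lambda>j. x j + s * z j)" for i z
    have u: "u i \<in> polyfuns d" if "i < d" for i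
      unfolding u_def using that by (intro polyfuns_affine polyfuns_partial_deriv p)
    \<comment> \<open>Both sides are the derivative in s of one function, computed once from the
      expansion in powers of s and once by the chain rule.\<close>
    have deriv_eq: "(\<Sum>j\<le>n. (real j * s ^ (j - 1)) * c j z) = (\<Sum>i<d. z i * u i z)" for z
    proof (rule DERIV_unique)
      show "((\<lambda>s. p (\<lambda>i. x i + s * z i)) has_field_derivative (\<Sum>i<d. z i * u i z)) (at s)"
        unfolding u_def by (rule polyfuns_chain[OF p])
      show "((\<lambda>s. p (\<lambda>i. x i + s * z i)) has_field_derivative (\<Sum>j\<le>n. (real j * s ^ (j - 1)) * c j z)) (at s)"
        unfolding exp by (auto intro!: derivative_eq_intros)
    qed
    have pdu: "partial_deriv i (u i) = (\<lambda>z. s * partial_deriv i (partial_deriv i p) (\<lambda>j. x j + s * z j))" if "i < d" for i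
      unfolding u_def[abs_def] by (rule partial_deriv_affine[OF polyfuns_partial_deriv[OF p that] that])
    have pdu_poly: "partial_deriv i (u i) \<in> polyfuns d" if "i < d" for i
      by (rule polyfuns_partial_deriv[OF u[OF that] that])
    have "(\<Sum>j\<le>n. (real j * s ^ (j - 1)) * gauss_mean d (c j))
        = gauss_mean d (\<lambda>z. \<Sum>j\<le>n. (real j * s ^ (j - 1)) * c j z)"
      by (subst gauss_mean_sum) (simp_all add: gauss_mean_cmult polyfuns_cmult c)
    also have "\<dots> = (\<Sum>i<d. gauss_mean d (\<lambda>z. z i * u i z))"
      unfolding deriv_eq by (subst gauss_mean_sum) (simp_all add: polyfuns_mult polyfuns_coord u)
    also have "\<dots> = (\<Sum>i<d. gauss_mean d (partial_deriv i (u i)))"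
      by (intro sum.cong refl gauss_mean_by_parts[symmetric] u) auto
    also have "\<dots> = gauss_mean d (\<lambda>z. \<Sum>i<d. partial_deriv i (u i) z)"
      by (rule gauss_mean_sum[symmetric]) (simp add: pdu_poly)
    also have "(\<lambda>z. \<Sum>i<d. partial_deriv i (u i) z) = (\<lambda>z. s * laplacian d p (\<lambda>j. x j + s * z j))"
      by (simp add: pdu laplacian_eq_partial_deriv sum_distrib_left)
    also have "gauss_mean d \<dots> = 0"
      by (simp add: harm gauss_mean_const)
    finally have "(\<Sum>j\<le>n. (real j * s ^ (j - 1)) * gauss_mean d (c j)) = 0" .
    moreover have "(\<phi> has_field_derivative (\<Sum>j\<le>n. (real j * s ^ (j - 1)) * gauss_mean d (c j))) (at s)"
      unfolding \<phi>_eq[abs_def] by (auto intro!: derivative_eq_intros)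
    ultimately show ?thesis by (simp only:)
  qed
  then have "\<phi> s = \<phi> 0"
    by (intro DERIV_isconst_all) auto
  also have "\<dots> = p x"
    by (simp add: \<phi>_def gauss_mean_const)
  finally show ?thesis by (simp add: \<phi>_def)
qed

section \<open>Homogeneous and harmonic polynomials under the Gaussian mean\<close>

lemma homogeneous_polys_polyfuns: "p \<in> homogeneous_polys d k \<Longrightarrow> p \<in> polyfuns d"
  unfolding homogeneous_polys_def mem_Collect_eq
proof (elim exE)
  fix c assume p: "p = (\<lambda>x. \<Sum>\<alpha>\<in>multi_indices d k. c \<alpha> * (\<Prod>i<d. x i ^ \<alpha> i))"
  show "p \<in> polyfuns d"
    unfolding p by (intro polyfuns_sum polyfuns.monomial)
qed

lemma homogeneous_polys_scale:
  assumes "p \<in> homogeneous_polys d k"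
  shows "p (\<lambda>i. s * x i) = s ^ k * p x"
proof -
  obtain c where p: "p = (\<lambda>x. \<Sum>\<alpha>\<in>multi_indices d k. c \<alpha> * (\<Prod>i<d. x i ^ \<alpha> i))"
    using assms unfolding homogeneous_polys_def by blast
  have "(\<Prod>i<d. (s * x i) ^ \<alpha> i) = s ^ k * (\<Prod>i<d. x i ^ \<alpha> i)" if "\<alpha> \<in> multi_indices d k" for \<alpha>
    using that by (auto simp: multi_indices_def power_mult_distrib prod.distrib power_sum[symmetric])
  then show ?thesis
    unfolding p sum_distrib_left by (intro sum.cong) auto
qed

text \<open>Differentiate \<open>p (\<lambda>i. s * x i) = s ^ k * p x\<close> at s = 1.\<close>

lemma euler_identity:
  assumes "p \<in> homogeneous_polys d k"
  shows "(\<Sum>i<d. x i * partial_deriv i p x) = real k * p x"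
proof (rule DERIV_unique)
  show "((\<lambda>s. p (\<lambda>i. 0 + s * x i)) has_field_derivative (\<Sum>i<d. x i * partial_deriv i p x)) (at 1)"
    using polyfuns_chain[OF homogeneous_polys_polyfuns[OF assms], of "\<lambda>_. 0" x 1] by simp
  have "(\<lambda>s. p (\<lambda>i. 0 + s * x i)) = (\<lambda>s. s ^ k * p x)"
    using homogeneous_polys_scale[OF assms] by simp
  moreover have "((\<lambda>s. s ^ k * p x) has_field_derivative real k * p x) (at 1)"
    by (auto intro!: derivative_eq_intros)
  ultimately show "((\<lambda>s. p (\<lambda>i. 0 + s * x i)) has_field_derivative real k * p x) (at 1)"
    by (simp only:)
qed

lemma harmonic_polysD:
  assumes "p \<in> harmonic_polys d k"
  shows "p \<in> homogeneous_polys d k" "p \<in> polyfuns d" "laplacian d p x = 0"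
  using assms by (auto simp: harmonic_polys_def intro: homogeneous_polys_polyfuns)

text \<open>Harmonic homogeneous polynomials are eigenfunctions of the Ornstein-Uhlenbeck operator,
  which is symmetric for the Gaussian mean.\<close>

lemma gauss_mean_gradient:
  assumes p: "p \<in> harmonic_polys d k" and q: "q \<in> polyfuns d"
  shows "gauss_mean d (\<lambda>x. \<Sum>i<d. partial_deriv i q x * partial_deriv i p x) = real k * gauss_mean d (\<lambda>x. q x * p x)"
proof -
  note P = harmonic_polysD[OF p]
  have pq: "(\<lambda>x. q x * partial_deriv i p x) \<in> polyfuns d" "(\<lambda>x. partial_deriv i q x * partial_deriv i p x) \<in> polyfuns d"
    "(\<lambda>x. q x * partial_deriv i (partial_deriv i p) x) \<in> polyfuns d" if "i < d" for i
    using that by (intro polyfuns_mult polyfuns_partial_deriv q P; simp)+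
  have "real k * gauss_mean d (\<lambda>x. q x * p x) = gauss_mean d (\<lambda>x. \<Sum>i<d. x i * (q x * partial_deriv i p x))"
  proof -
    have "(\<lambda>x. \<Sum>i<d. x i * (q x * partial_deriv i p x)) = (\<lambda>x. real k * (q x * p x))"
      unfolding mult.left_commute[of _ "q _"] sum_distrib_left[symmetric] euler_identity[OF P(1)]
      by (simp only: mult_ac)
    then show ?thesis by (simp only: gauss_mean_cmult)
  qed
  also have "\<dots> = (\<Sum>i<d. gauss_mean d (\<lambda>x. x i * (q x * partial_deriv i p x)))"
    by (rule gauss_mean_sum) (simp add: polyfuns_mult polyfuns_coord pq)
  also have "\<dots> = (\<Sum>i<d. gauss_mean d (partial_deriv i (\<lambda>x. q x * partial_deriv i p x)))"
    by (intro sum.cong refl gauss_mean_by_parts[symmetric] pq) auto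
  also have "\<dots> = gauss_mean d (\<lambda>x. \<Sum>i<d. partial_deriv i (\<lambda>x. q x * partial_deriv i p x) x)"
    by (rule gauss_mean_sum[symmetric]) (simp add: polyfuns_partial_deriv pq)
  also have "(\<lambda>x. \<Sum>i<d. partial_deriv i (\<lambda>x. q x * partial_deriv i p x) x) = (\<lambda>x. \<Sum>i<d. partial_deriv i q x * partial_deriv i p x)"
  proof
    fix x
    have "(\<Sum>i<d. partial_deriv i (\<lambda>x. q x * partial_deriv i p x) x) = (\<Sum>i<d. partial_deriv i q x * partial_deriv i p x + q x * partial_deriv i (partial_deriv i p) x)"
      by (intro sum.cong refl) (simp add: partial_deriv_mult[OF q polyfuns_partial_deriv[OF P(2)]])
    also have "\<dots> = (\<Sum>i<d. partial_deriv i q x * partial_deriv i p x) + q x * laplacian d p x"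
      by (simp add: sum.distrib laplacian_eq_partial_deriv sum_distrib_left)
    finally show "(\<Sum>i<d. partial_deriv i (\<lambda>x. q x * partial_deriv i p x) x) = (\<Sum>i<d. partial_deriv i q x * partial_deriv i p x)"
      using P(3) by simp
  qed
  finally show ?thesis by simp
qed

text \<open>The mean of the product of gradients is symmetric in p and q, so k and m times the mean
  of p q agree.\<close>

lemma gauss_mean_orthogonal:
  assumes p: "p \<in> harmonic_polys d k" and q: "q \<in> harmonic_polys d m" and "k \<noteq> m"
  shows "gauss_mean d (\<lambda>x. p x * q x) = 0"
proof -
  have "real k * gauss_mean d (\<lambda>x. q x * p x) = gauss_mean d (\<lambda>x. \<Sum>i<d. partial_deriv i q x * partial_deriv i p x)"
    by (rule gauss_mean_gradient[symmetric, OF p harmonic_polysD(2)[OF q]])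
  also have "\<dots> = gauss_mean d (\<lambda>x. \<Sum>i<d. partial_deriv i p x * partial_deriv i q x)"
    by (simp only: mult.commute)
  also have "\<dots> = real m * gauss_mean d (\<lambda>x. p x * q x)"
    by (rule gauss_mean_gradient[OF q harmonic_polysD(2)[OF p]])
  finally show ?thesis using \<open>k \<noteq> m\<close> by (simp add: mult.commute[of "q _"])
qed

section \<open>Polar coordinates\<close>

text \<open>A product measure is determined by its values on boxes, where the one-dimensional affine
  substitution is applied to each side. The restricted lambda keeps the argument inside the
  extensional space.\<close>

lemma nn_integral_affine_Rd:
  fixes f :: "(nat \<Rightarrow> real) \<Rightarrow> ennreal"
  assumes s: "0 < s" and f: "f \<in> borel_measurable (\<Pi>\<^sub>M i\<in>{..<d}. borel)"
  shows "ennreal (s ^ d) * (\<integral>\<^sup>+z. f (\<lambda>i\<in>{..<d}. a i + s * z i) \<partial>lebesgue_Rd d) = (\<integral>\<^sup>+z. f z \<partial>lebesgue_Rd d)"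
proof -
  define T where "T z = (\<lambda>i\<in>{..<d}. a i + s * z i)" for z :: "nat \<Rightarrow> real"
  have T: "T \<in> measurable (lebesgue_Rd d) (lebesgue_Rd d)"
    unfolding T_def by measurable
  have "scale_measure (ennreal (s ^ d)) (distr (lebesgue_Rd d) (lebesgue_Rd d) T) = lebesgue_Rd d"
  proof (rule lb.PiM_eqI)
    fix A :: "nat \<Rightarrow> real set" assume A: "\<And>i. i \<in> {..<d} \<Longrightarrow> A i \<in> sets lborel"
    have "T -` Pi\<^sub>E {..<d} A \<inter> space (lebesgue_Rd d) = Pi\<^sub>E {..<d} (\<lambda>i. (\<lambda>z. a i + s * z) -` A i)"
      by (auto simp: T_def space_PiM PiE_iff extensional_def)
    moreover have "(\<lambda>z. a i + s * z) -` A i \<in> sets lborel" if "i < d" for i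
      using measurable_sets_borel[of "\<lambda>z. a i + s * z" borel "A i"] A[of i] that by simp
    ultimately have "emeasure (distr (lebesgue_Rd d) (lebesgue_Rd d) T) (Pi\<^sub>E {..<d} A)
        = (\<Prod>i<d. emeasure lborel ((\<lambda>z. a i + s * z) -` A i))"
      using A by (subst emeasure_distr[OF T]) (auto intro!: sets_PiM_I_finite lb.emeasure_PiM)
    moreover have "emeasure lborel (A i) = ennreal s * emeasure lborel ((\<lambda>z. a i + s * z) -` A i)" if "i < d" for i
    proof -
      have "emeasure lborel (A i) = emeasure (density (distr lborel borel (\<lambda>x. a i + s * x)) (\<lambda>_. ennreal \<bar>s\<bar>)) (A i)"
        using lborel_real_affine[of s "a i"] s by simp
      also have "\<dots> = ennreal s * emeasure (distr lborel borel (\<lambda>x. a i + s * x)) (A i)"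
        using A[of i] that s by (subst emeasure_density) (auto simp: nn_integral_cmult)
      also have "emeasure (distr lborel borel (\<lambda>x. a i + s * x)) (A i) = emeasure lborel ((\<lambda>z. a i + s * z) -` A i)"
        using A[of i] that by (subst emeasure_distr) auto
      finally show ?thesis .
    qed
    ultimately show "emeasure (scale_measure (ennreal (s ^ d)) (distr (lebesgue_Rd d) (lebesgue_Rd d) T)) (Pi\<^sub>E {..<d} A)
        = (\<Prod>i<d. emeasure lborel (A i))"
      using s by (simp add: prod.distrib ennreal_power)
  qed auto
  then have "(\<integral>\<^sup>+z. f z \<partial>lebesgue_Rd d)
      = (\<integral>\<^sup>+z. f z \<partial>scale_measure (ennreal (s ^ d)) (distr (lebesgue_Rd d) (lebesgue_Rd d) T))"
    by simp
  also have "\<dots> = ennreal (s ^ d) * (\<integral>\<^sup>+z. f (T z) \<partial>lebesgue_Rd d)"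
    using f T by (subst nn_integral_scale_measure) (auto simp: measurable_lebesgue_Rd nn_integral_distr)
  finally show ?thesis by (simp add: T_def)
qed

lemma nrm_measurable [measurable]: "nrm d \<in> borel_measurable (\<Pi>\<^sub>M i\<in>{..<d}. borel)"
  unfolding nrm_def[abs_def] L2_set_def by measurable

lemma direction_measurable [measurable]:
  "direction d \<in> measurable (\<Pi>\<^sub>M i\<in>{..<d}. borel) (\<Pi>\<^sub>M i\<in>{..<d}. borel)"
  unfolding direction_def[abs_def] by measurable

lemma nrm_nonneg: "0 \<le> nrm d x"
  by (simp add: nrm_def)

lemma nrm_power2: "(nrm d x)\<^sup>2 = (\<Sum>i<d. (x i)\<^sup>2)"
  by (simp add: nrm_def L2_set_def sum_nonneg)

lemma nrm_cong: "(\<And>i. i < d \<Longrightarrow> x i = y i) \<Longrightarrow> nrm d x = nrm d y"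
  unfolding nrm_def by (intro L2_set_cong) auto

lemma nrm_scale: "0 \<le> s \<Longrightarrow> nrm d (\<lambda>i. s * x i) = s * nrm d x"
  unfolding nrm_def by (rule L2_set_right_distrib[symmetric])

lemma coord_le_nrm: "i < d \<Longrightarrow> \<bar>x i\<bar> \<le> nrm d x"
  using member_le_L2_set[of "{..<d}" i "\<lambda>i. \<bar>x i\<bar>"] by (simp add: nrm_def L2_set_def)

lemma nrm_direction: "0 < nrm d x \<Longrightarrow> nrm d (direction d x) = 1"
proof -
  assume pos: "0 < nrm d x"
  have "nrm d (direction d x) = nrm d (\<lambda>i. (1 / nrm d x) * x i)"
    by (rule nrm_cong) (simp add: direction_def)
  also have "\<dots> = (1 / nrm d x) * nrm d x"
    using pos by (intro nrm_scale) simp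
  finally show ?thesis using pos by simp
qed

lemma direction_scale:
  assumes "0 < s"
  shows "direction d (\<lambda>i\<in>{..<d}. s * x i) = direction d x"
proof -
  have "nrm d (\<lambda>i\<in>{..<d}. s * x i) = s * nrm d x"
    using assms by (subst nrm_scale[symmetric]) (auto intro: nrm_cong)
  then show ?thesis using assms by (auto simp: direction_def fun_eq_iff)
qed

lemma space_borel_Rd: "space (borel_Rd d) = ({..<d} \<rightarrow>\<^sub>E UNIV)"
  by (simp add: borel_Rd_def space_PiM)

lemma direction_in_usphere: "0 < nrm d x \<Longrightarrow> direction d x \<in> usphere d"
  unfolding usphere_def mem_Collect_eq
  by (intro conjI nrm_direction) (simp_all add: space_borel_Rd direction_def)

lemma homogeneous_polys_polar:
  assumes "p \<in> homogeneous_polys d k" "0 < nrm d x"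
  shows "p x = nrm d x ^ k * p (direction d x)"
proof -
  have "p x = p (\<lambda>i. nrm d x * direction d x i)"
    using assms by (intro polyfuns_cong[OF homogeneous_polys_polyfuns[OF assms(1)]]) (simp add: direction_def)
  then show ?thesis by (simp add: homogeneous_polys_scale[OF assms(1)])
qed

lemma polyfuns_bounded:
  assumes "p \<in> polyfuns d"
  shows "\<exists>K. \<forall>x. nrm d x \<le> 1 \<longrightarrow> \<bar>p x\<bar> \<le> K"
  using assms
proof (induction rule: polyfuns.induct)
  case (monomial c \<alpha>)
  have "\<bar>c * (\<Prod>i<d. x i ^ \<alpha> i)\<bar> \<le> \<bar>c\<bar>" if "nrm d x \<le> 1" for x
  proof -
    have "\<bar>x i\<bar> ^ \<alpha> i \<le> 1" if "i < d" for i
      using coord_le_nrm[OF that, of x] \<open>nrm d x \<le> 1\<close> by (intro power_le_one) auto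
    then have "(\<Prod>i<d. \<bar>x i\<bar> ^ \<alpha> i) \<le> 1"
      by (intro prod_le_1) auto
    then show ?thesis
      by (simp add: abs_mult abs_prod power_abs mult_left_le)
  qed
  then show ?case by (intro exI[of _ "\<bar>c\<bar>"]) simp
next
  case (add p q)
  then obtain K L where KL: "\<forall>x. nrm d x \<le> 1 \<longrightarrow> \<bar>p x\<bar> \<le> K" "\<forall>x. nrm d x \<le> 1 \<longrightarrow> \<bar>q x\<bar> \<le> L"
    by (elim exE)
  have "\<bar>p x + q x\<bar> \<le> K + L" if "nrm d x \<le> 1" for x
    using KL[rule_format, OF that] by linarith
  then show ?case by (intro exI[of _ "K + L"]) simp
qed

section \<open>Radius and direction under Lebesgue measure\<close>

definition ball_volume :: "nat \<Rightarrow> ennreal" where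
  "ball_volume d = emeasure (lebesgue_Rd d) {x \<in> space (lebesgue_Rd d). 0 < nrm d x \<and> nrm d x \<le> 1}"

lemma punctured_ball_sets: "{x \<in> space (lebesgue_Rd d). 0 < nrm d x \<and> nrm d x \<le> 1} \<in> sets (lebesgue_Rd d)"
proof -
  have [measurable]: "nrm d \<in> borel_measurable (lebesgue_Rd d)"
    unfolding measurable_lebesgue_Rd by (rule nrm_measurable)
  show ?thesis by measurable
qed

lemma ball_volume_finite: "ball_volume d < \<infinity>"
proof -
  have "{x \<in> space (lebesgue_Rd d). 0 < nrm d x \<and> nrm d x \<le> 1} \<subseteq> ({..<d} \<rightarrow>\<^sub>E {-1..1})"
  proof
    fix x assume "x \<in> {x \<in> space (lebesgue_Rd d). 0 < nrm d x \<and> nrm d x \<le> 1}"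
    then have x: "x \<in> ({..<d} \<rightarrow>\<^sub>E UNIV)" "nrm d x \<le> 1" by (auto simp: space_PiM)
    then have "x i \<in> {-1..1}" if "i < d" for i
      using coord_le_nrm[OF that, of x] by (simp add: abs_le_iff)
    with x show "x \<in> ({..<d} \<rightarrow>\<^sub>E {-1..1})"
      unfolding PiE_iff by simp
  qed
  then have "ball_volume d \<le> emeasure (lebesgue_Rd d) ({..<d} \<rightarrow>\<^sub>E {-1..1})"
    unfolding ball_volume_def by (intro emeasure_mono sets_PiM_I_finite) auto
  also have "\<dots> < \<infinity>"
    by (simp add: lb.emeasure_PiM ennreal_power[symmetric] power_less_top_ennreal)
  finally show ?thesis .
qed

text \<open>The open cube with sides from 0 to 1/d fits into the punctured ball, because the
  Euclidean norm is at most the sum of the moduli of the coordinates.\<close>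

lemma ball_volume_pos:
  assumes "0 < d"
  shows "0 < ball_volume d"
proof -
  have "({..<d} \<rightarrow>\<^sub>E {0<..<1 / real d}) \<subseteq> {x \<in> space (lebesgue_Rd d). 0 < nrm d x \<and> nrm d x \<le> 1}"
  proof
    fix x :: "nat \<Rightarrow> real" assume x: "x \<in> ({..<d} \<rightarrow>\<^sub>E {0<..<1 / real d})"
    have "nrm d x \<le> (\<Sum>i<d. \<bar>x i\<bar>)"
      unfolding nrm_def by (rule L2_set_le_sum_abs)
    also have "\<dots> \<le> (\<Sum>i<d. 1 / real d)"
    proof (intro sum_mono)
      fix i assume "i \<in> {..<d}"
      then have "0 < x i \<and> x i < 1 / real d" using x by (auto simp: PiE_iff)
      then show "\<bar>x i\<bar> \<le> 1 / real d" by simp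
    qed
    finally have "nrm d x \<le> 1" using assms by simp
    moreover have "0 < nrm d x"
      using x assms coord_le_nrm[OF assms, of x] by (auto simp: PiE_iff dest!: bspec[where x = 0])
    ultimately show "x \<in> {x \<in> space (lebesgue_Rd d). 0 < nrm d x \<and> nrm d x \<le> 1}"
      using x by (auto simp: space_PiM)
  qed
  then have "emeasure (lebesgue_Rd d) ({..<d} \<rightarrow>\<^sub>E {0<..<1 / real d}) \<le> ball_volume d"
    unfolding ball_volume_def by (intro emeasure_mono punctured_ball_sets)
  moreover have "emeasure (lebesgue_Rd d) ({..<d} \<rightarrow>\<^sub>E {0<..<1 / real d}) = ennreal ((1 / real d) ^ d)"
    by (simp add: lb.emeasure_PiM ennreal_power)
  moreover have "0 < ennreal ((1 / real d) ^ d)"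
    using assms by simp
  ultimately show ?thesis by (metis order.strict_trans2)
qed

lemma nrm_pos_AE:
  assumes "0 < d"
  shows "AE x in lebesgue_Rd d. 0 < nrm d x"
proof (rule AE_I)
  show "{x \<in> space (lebesgue_Rd d). \<not> 0 < nrm d x} \<subseteq> ({..<d} \<rightarrow>\<^sub>E {0})"
  proof
    fix x assume "x \<in> {x \<in> space (lebesgue_Rd d). \<not> 0 < nrm d x}"
    then have x: "x \<in> ({..<d} \<rightarrow>\<^sub>E UNIV)" "nrm d x \<le> 0" by (auto simp: space_PiM)
    then have "x i = 0" if "i < d" for i
      using coord_le_nrm[OF that, of x] by simp
    with x show "x \<in> ({..<d} \<rightarrow>\<^sub>E {0})"
      unfolding PiE_iff by simp
  qed
  show "emeasure (lebesgue_Rd d) ({..<d} \<rightarrow>\<^sub>E {0}) = 0"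
    using assms by (subst lb.emeasure_PiM) auto
qed (intro sets_PiM_I_finite, auto)

text \<open>\<open>direction\<close> is invariant under dilation, so substituting R x affects only
  the volume element and the bound on the radius.\<close>

lemma polar_scaling:
  assumes q: "q \<in> borel_measurable (\<Pi>\<^sub>M i\<in>{..<d}. borel)" and R: "0 < R"
  shows "(\<integral>\<^sup>+x. q (direction d x) * indicator {x. 0 < nrm d x \<and> nrm d x \<le> R} x \<partial>lebesgue_Rd d)
    = ennreal (R ^ d) * (\<integral>\<^sup>+x. q (direction d x) * indicator {x. 0 < nrm d x \<and> nrm d x \<le> 1} x \<partial>lebesgue_Rd d)"
proof -
  note [measurable] = q
  have nrm: "nrm d (\<lambda>i\<in>{..<d}. R * x i) = R * nrm d x" for x
    using R by (subst nrm_scale[symmetric]) (auto intro: nrm_cong)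
  define f where "f x = q (direction d x) * indicator {x. 0 < nrm d x \<and> nrm d x \<le> R} x" for x
  have "f \<in> borel_measurable (\<Pi>\<^sub>M i\<in>{..<d}. borel)"
    unfolding f_def[abs_def] by measurable
  then have "(\<integral>\<^sup>+x. f x \<partial>lebesgue_Rd d)
      = ennreal (R ^ d) * (\<integral>\<^sup>+z. f (\<lambda>i\<in>{..<d}. 0 + R * z i) \<partial>lebesgue_Rd d)"
    by (rule nn_integral_affine_Rd[symmetric, OF R])
  also have "(\<lambda>z. f (\<lambda>i\<in>{..<d}. 0 + R * z i)) = (\<lambda>z. q (direction d z) * indicator {x. 0 < nrm d x \<and> nrm d x \<le> 1} z)"
  proof
    fix z
    have "indicator {x. 0 < nrm d x \<and> nrm d x \<le> R} (\<lambda>i\<in>{..<d}. R * z i)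
        = (indicator {x. 0 < nrm d x \<and> nrm d x \<le> 1} z :: ennreal)"
      using R mult_le_cancel_left_pos[of R "nrm d z" 1] unfolding indicator_def mem_Collect_eq nrm
      by (simp add: zero_less_mult_iff)
    then show "f (\<lambda>i\<in>{..<d}. 0 + R * z i) = q (direction d z) * indicator {x. 0 < nrm d x \<and> nrm d x \<le> 1} z"
      unfolding f_def add_0 direction_scale[OF R] by (simp only:)
  qed
  finally show ?thesis unfolding f_def .
qed

text \<open>Both sides define the same measure on the radius, up to a factor, as each gives
  \<open>{0<..R}\<close> the mass \<open>R\<^sup>d\<close> times the mass of \<open>{0<..1}\<close>.\<close>

lemma polar_nn_integral:
  fixes \<psi> :: "real \<Rightarrow> ennreal"
  assumes q: "q \<in> borel_measurable (\<Pi>\<^sub>M i\<in>{..<d}. borel)" and d: "0 < d"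
    and fin: "(\<integral>\<^sup>+x. q (direction d x) * indicator {x. 0 < nrm d x \<and> nrm d x \<le> 1} x \<partial>lebesgue_Rd d) < \<infinity>"
    and \<psi>: "\<psi> \<in> borel_measurable borel"
  shows "ball_volume d * (\<integral>\<^sup>+x. q (direction d x) * \<psi> (nrm d x) \<partial>lebesgue_Rd d)
    = (\<integral>\<^sup>+x. q (direction d x) * indicator {x. 0 < nrm d x \<and> nrm d x \<le> 1} x \<partial>lebesgue_Rd d)
      * (\<integral>\<^sup>+x. \<psi> (nrm d x) \<partial>lebesgue_Rd d)"
proof -
  note [measurable] = \<psi>
  define J where "J h = (\<integral>\<^sup>+x. h (direction d x) * indicator {x. 0 < nrm d x \<and> nrm d x \<le> 1} x \<partial>lebesgue_Rd d)" for h :: "_ \<Rightarrow> ennreal"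
  \<comment> \<open>\<open>M h\<close> is the distribution of the radius under the density given by
    \<open>h\<close> of the direction; the claim becomes the proportionality of \<open>M q\<close>
    and \<open>M (\<lambda>_. 1)\<close>.\<close>
  define M where "M h = distr (density (lebesgue_Rd d) (\<lambda>x. h (direction d x) * indicator {x. 0 < nrm d x} x)) borel (nrm d)"
    for h :: "_ \<Rightarrow> ennreal"
  have meas: "nrm d \<in> borel_measurable (lebesgue_Rd d)" "(\<lambda>x. h (direction d x)) \<in> borel_measurable (lebesgue_Rd d)"
    if "h \<in> borel_measurable (\<Pi>\<^sub>M i\<in>{..<d}. borel)" for h :: "_ \<Rightarrow> ennreal"
    using that unfolding measurable_lebesgue_Rd by measurable
  have ind: "(\<lambda>x. indicator {x. 0 < nrm d x} x :: ennreal) \<in> borel_measurable (lebesgue_Rd d)"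
    unfolding measurable_lebesgue_Rd by measurable
  have M_int: "(\<integral>\<^sup>+r. g r \<partial>M h) = (\<integral>\<^sup>+x. h (direction d x) * g (nrm d x) \<partial>lebesgue_Rd d)"
    if h: "h \<in> borel_measurable (\<Pi>\<^sub>M i\<in>{..<d}. borel)" and g: "g \<in> borel_measurable borel" for h g
  proof -
    have "(\<integral>\<^sup>+r. g r \<partial>M h) = (\<integral>\<^sup>+x. h (direction d x) * indicator {x. 0 < nrm d x} x * g (nrm d x) \<partial>lebesgue_Rd d)"
      unfolding M_def using meas[OF h] ind g
      by (simp add: nn_integral_distr nn_integral_density mult_ac)
    also have "\<dots> = (\<integral>\<^sup>+x. h (direction d x) * g (nrm d x) \<partial>lebesgue_Rd d)"
      using nrm_pos_AE[OF d] by (intro nn_integral_cong_AE) auto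
    finally show ?thesis .
  qed
  have M_atMost: "emeasure (M h) {..R} = ennreal (max 0 R ^ d) * J h"
    if h: "h \<in> borel_measurable (\<Pi>\<^sub>M i\<in>{..<d}. borel)" for h R
  proof -
    have "emeasure (M h) {..R} = (\<integral>\<^sup>+r. indicator {..R} r \<partial>M h)"
      by (simp add: M_def)
    also have "\<dots> = (\<integral>\<^sup>+x. h (direction d x) * indicator {..R} (nrm d x) \<partial>lebesgue_Rd d)"
      by (rule M_int[OF h]) simp
    also have "\<dots> = (\<integral>\<^sup>+x. h (direction d x) * indicator {x. 0 < nrm d x \<and> nrm d x \<le> R} x \<partial>lebesgue_Rd d)"
      using nrm_pos_AE[OF d] by (intro nn_integral_cong_AE) (auto simp: indicator_def)
    also have "\<dots> = ennreal (max 0 R ^ d) * J h"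
    proof (cases "0 < R")
      case True
      then show ?thesis using polar_scaling[OF h True] by (simp add: J_def max_def)
    next
      case False
      then have "{x. 0 < nrm d x \<and> nrm d x \<le> R} = {}" by auto
      then show ?thesis using False d by (simp add: max_def)
    qed
    finally show ?thesis .
  qed
  have one: "(\<lambda>_. 1) \<in> borel_measurable (\<Pi>\<^sub>M i\<in>{..<d}. borel)" by simp
  have J1: "J (\<lambda>_. 1) = ball_volume d"
  proof -
    have "ball_volume d = (\<integral>\<^sup>+x. indicator {x \<in> space (lebesgue_Rd d). 0 < nrm d x \<and> nrm d x \<le> 1} x \<partial>lebesgue_Rd d)"
      unfolding ball_volume_def by (rule nn_integral_indicator[symmetric], rule punctured_ball_sets)
    also have "\<dots> = J (\<lambda>_. 1)"
      unfolding J_def by (intro nn_integral_cong) (simp add: indicator_def)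
    finally show ?thesis ..
  qed
  have Jq: "J q < \<infinity>" using fin by (simp add: J_def)
  have "scale_measure (ball_volume d) (M q) = scale_measure (J q) (M (\<lambda>_. 1))"
  proof (rule measure_eqI_generator_eq[where E = "range atMost" and \<Omega> = UNIV and A = "\<lambda>n. {..real n}"])
    show "Int_stable (range (atMost :: real \<Rightarrow> _))"
      by (auto simp: Int_stable_def)
    show "sets (scale_measure (ball_volume d) (M q)) = sigma_sets UNIV (range atMost)"
      "sets (scale_measure (J q) (M (\<lambda>_. 1))) = sigma_sets UNIV (range atMost)"
      by (simp_all add: M_def borel_eq_atMost)
    fix X :: "real set" assume "X \<in> range atMost"
    then show "emeasure (scale_measure (ball_volume d) (M q)) X = emeasure (scale_measure (J q) (M (\<lambda>_. 1))) X"
      by (auto simp: M_atMost[OF q] M_atMost[OF one] J1 mult_ac)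
  next
    show "(\<Union>n. {..real n}) = UNIV"
      by (auto intro: real_arch_simple)
    \<comment> \<open>Uniqueness from the half-lines requires finite mass on an exhausting sequence
      of them; here the finiteness of the angular integral enters.\<close>
    show "emeasure (scale_measure (ball_volume d) (M q)) {..real n} \<noteq> \<infinity>" for n
      using Jq ball_volume_finite[of d] by (simp add: M_atMost[OF q] ennreal_mult_eq_top_iff less_top)
  qed auto
  then have "(\<integral>\<^sup>+r. \<psi> r \<partial>scale_measure (ball_volume d) (M q)) = (\<integral>\<^sup>+r. \<psi> r \<partial>scale_measure (J q) (M (\<lambda>_. 1)))"
    by simp
  then have "ball_volume d * (\<integral>\<^sup>+r. \<psi> r \<partial>M q) = J q * (\<integral>\<^sup>+r. \<psi> r \<partial>M (\<lambda>_. 1))"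
    using \<psi> by (subst (asm) (1 2) nn_integral_scale_measure) (auto simp: M_def)
  then show ?thesis
    by (simp add: M_int[OF q \<psi>] M_int[OF one \<psi>] J_def)
qed

section \<open>The surface measure of the sphere\<close>

lemma direction_measurable_sphere:
  "direction d \<in> measurable (restrict_space (lebesgue_Rd d) {x. 0 < nrm d x \<and> nrm d x \<le> 1}) (restrict_space (borel_Rd d) (usphere d))"
proof (rule measurable_restrict_space2)
  show "direction d \<in> space (restrict_space (lebesgue_Rd d) {x. 0 < nrm d x \<and> nrm d x \<le> 1}) \<rightarrow> usphere d"
    by (auto simp: space_restrict_space intro: direction_in_usphere)
  have "direction d \<in> measurable (lebesgue_Rd d) (borel_Rd d)"
    using direction_measurable unfolding borel_Rd_def measurable_cong_sets[OF sets_lebesgue_Rd refl] .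
  then show "direction d \<in> measurable (restrict_space (lebesgue_Rd d) {x. 0 < nrm d x \<and> nrm d x \<le> 1}) (borel_Rd d)"
    by (rule measurable_restrict_space1)
qed

lemma space_sphere_measure: "space (sphere_measure d) = usphere d"
  by (auto simp: sphere_measure_def space_restrict_space usphere_def)

lemma measurable_sphere_measure:
  assumes "q \<in> borel_measurable (\<Pi>\<^sub>M i\<in>{..<d}. borel)"
  shows "q \<in> borel_measurable (sphere_measure d)"
proof -
  have "q \<in> borel_measurable (restrict_space (borel_Rd d) (usphere d))"
    using assms unfolding borel_Rd_def by (rule measurable_restrict_space1)
  then show ?thesis by (simp add: sphere_measure_def)
qed

text \<open>The surface measure is an image of Lebesgue measure under \<open>direction\<close>, so a
  sphere integral is an integral over the unit ball, in exactly the shape of the angular factor in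
  \<open>polar_nn_integral\<close>.\<close>

lemma nn_integral_sphere:
  assumes q: "q \<in> borel_measurable (\<Pi>\<^sub>M i\<in>{..<d}. borel)"
  shows "(\<integral>\<^sup>+\<theta>. q \<theta> \<partial>sphere_measure d)
    = of_nat d * (\<integral>\<^sup>+x. q (direction d x) * indicator {x. 0 < nrm d x \<and> nrm d x \<le> 1} x \<partial>lebesgue_Rd d)"
proof -
  let ?B = "{x. 0 < nrm d x \<and> nrm d x \<le> 1}"
  have q': "q \<in> borel_measurable (restrict_space (borel_Rd d) (usphere d))"
    using q unfolding borel_Rd_def by (rule measurable_restrict_space1)
  have qd: "(\<lambda>x. q (direction d x)) \<in> borel_measurable (restrict_space (lebesgue_Rd d) ?B)"
    by (rule measurable_compose[OF direction_measurable_sphere q'])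
  have dir: "direction d \<in> measurable (scale_measure (of_nat d) (restrict_space (lebesgue_Rd d) ?B)) (restrict_space (borel_Rd d) (usphere d))"
    unfolding measurable_cong_sets[OF sets_scale_measure refl] by (rule direction_measurable_sphere)
  have "(\<integral>\<^sup>+\<theta>. q \<theta> \<partial>sphere_measure d)
      = (\<integral>\<^sup>+x. q (direction d x) \<partial>scale_measure (of_nat d) (restrict_space (lebesgue_Rd d) ?B))"
    unfolding sphere_measure_def by (rule nn_integral_distr[OF dir]) (use q' in simp)
  also have "\<dots> = of_nat d * (\<integral>\<^sup>+x. q (direction d x) \<partial>restrict_space (lebesgue_Rd d) ?B)"
    by (rule nn_integral_scale_measure[OF qd])
  also have "(\<integral>\<^sup>+x. q (direction d x) \<partial>restrict_space (lebesgue_Rd d) ?B)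
      = (\<integral>\<^sup>+x. q (direction d x) * indicator ?B x \<partial>lebesgue_Rd d)"
  proof (rule nn_integral_restrict_space)
    have "?B \<inter> space (lebesgue_Rd d) = {x \<in> space (lebesgue_Rd d). 0 < nrm d x \<and> nrm d x \<le> 1}"
      by auto
    then show "?B \<inter> space (lebesgue_Rd d) \<in> sets (lebesgue_Rd d)"
      using punctured_ball_sets[of d] by (simp only:)
  qed
  finally show ?thesis .
qed

definition sphere_area :: "nat \<Rightarrow> ennreal" where
  "sphere_area d = of_nat d * ball_volume d"

lemma sphere_area_pos: "0 < d \<Longrightarrow> 0 < sphere_area d"
  using ball_volume_pos[of d] by (simp add: sphere_area_def ennreal_zero_less_mult_iff)

lemma sphere_area_finite: "sphere_area d < \<infinity>"
  using ball_volume_finite[of d] by (simp add: sphere_area_def ennreal_mult_less_top of_nat_less_top)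

lemma emeasure_sphere_measure: "emeasure (sphere_measure d) (space (sphere_measure d)) = sphere_area d"
proof -
  have "emeasure (sphere_measure d) (space (sphere_measure d)) = (\<integral>\<^sup>+\<theta>. 1 \<partial>sphere_measure d)"
    by simp
  also have "\<dots> = of_nat d * (\<integral>\<^sup>+x. indicator {x. 0 < nrm d x \<and> nrm d x \<le> 1} x \<partial>lebesgue_Rd d)"
    by (subst nn_integral_sphere) simp_all
  also have "(\<integral>\<^sup>+x. indicator {x. 0 < nrm d x \<and> nrm d x \<le> 1} x \<partial>lebesgue_Rd d)
      = (\<integral>\<^sup>+x. indicator {x \<in> space (lebesgue_Rd d). 0 < nrm d x \<and> nrm d x \<le> 1} x \<partial>lebesgue_Rd d)"
    by (intro nn_integral_cong) (simp add: indicator_def)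
  also have "\<dots> = ball_volume d"
    unfolding ball_volume_def by (rule nn_integral_indicator, rule punctured_ball_sets)
  finally show ?thesis by (simp add: sphere_area_def)
qed

lemma finite_measure_sphere: "finite_measure (sphere_measure d)"
  using sphere_area_finite by (intro finite_measureI) (simp add: emeasure_sphere_measure less_top)

lemma integrable_sphere:
  assumes "p \<in> polyfuns d"
  shows "integrable (sphere_measure d) p"
proof -
  interpret finite_measure "sphere_measure d" by (rule finite_measure_sphere)
  obtain K where "\<forall>x. nrm d x \<le> 1 \<longrightarrow> \<bar>p x\<bar> \<le> K"
    using polyfuns_bounded[OF assms] by (elim exE)
  then show ?thesis
    by (intro integrable_const_bound[where B = K] AE_I2 measurable_sphere_measure polyfuns_measurable assms)
       (simp add: space_sphere_measure usphere_def)
qed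

text \<open>Separates angular and radial factors with the true surface measure. The area multiplies
  the left-hand side so that no division of extended reals occurs.\<close>

lemma polar_sphere:
  fixes \<psi> :: "real \<Rightarrow> ennreal"
  assumes q: "q \<in> borel_measurable (\<Pi>\<^sub>M i\<in>{..<d}. borel)" and d: "0 < d"
    and fin: "(\<integral>\<^sup>+\<theta>. q \<theta> \<partial>sphere_measure d) < \<infinity>" and \<psi>: "\<psi> \<in> borel_measurable borel"
  shows "sphere_area d * (\<integral>\<^sup>+x. q (direction d x) * \<psi> (nrm d x) \<partial>lebesgue_Rd d)
    = (\<integral>\<^sup>+\<theta>. q \<theta> \<partial>sphere_measure d) * (\<integral>\<^sup>+x. \<psi> (nrm d x) \<partial>lebesgue_Rd d)"
proof -
  have "(\<integral>\<^sup>+x. q (direction d x) * indicator {x. 0 < nrm d x \<and> nrm d x \<le> 1} x \<partial>lebesgue_Rd d) < \<infinity>"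
    (is "?J < _")
  proof (rule ccontr)
    assume "\<not> ?J < \<infinity>"
    then have "?J = top" by (simp add: less_top[symmetric])
    then show False
      using fin d unfolding nn_integral_sphere[OF q] by (simp add: ennreal_mult_top)
  qed
  from polar_nn_integral[OF q d this \<psi>] show ?thesis
    unfolding nn_integral_sphere[OF q] sphere_area_def by (simp add: mult.assoc)
qed

section \<open>Gaussian and radial weights, and the pointwise bound for harmonic polynomials\<close>

lemma gauss_eq_nrm: "gauss d x = (1 / sqrt (2 * pi)) ^ d * exp (- (nrm d x)\<^sup>2 / 2)"
proof -
  have "gauss d x = (\<Prod>i<d. 1 / sqrt (2 * pi) * exp (- (x i)\<^sup>2 / 2))"
    unfolding gauss_def std_normal_density_def ..
  also have "\<dots> = (1 / sqrt (2 * pi)) ^ d * exp (\<Sum>i<d. - (x i)\<^sup>2 / 2)"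
    by (simp only: prod.distrib exp_sum[OF finite_lessThan] prod_constant card_lessThan)
  also have "(\<Sum>i<d. - (x i)\<^sup>2 / 2) = - (nrm d x)\<^sup>2 / 2"
    by (simp add: nrm_power2 sum_negf sum_divide_distrib)
  finally show ?thesis .
qed

lemma gauss_measurable: "gauss d \<in> borel_measurable (\<Pi>\<^sub>M i\<in>{..<d}. borel)"
  unfolding gauss_eq_nrm[abs_def] by measurable

lemma gauss_cong: "(\<And>i. i < d \<Longrightarrow> x i = y i) \<Longrightarrow> gauss d x = gauss d y"
  unfolding gauss_def by (intro prod.cong) auto

lemma nn_integral_gauss:
  assumes "p \<in> polyfuns d" "\<And>x. 0 \<le> p x"
  shows "(\<integral>\<^sup>+x. ennreal (gauss d x * p x) \<partial>lebesgue_Rd d) = ennreal (gauss_mean d p)"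
  unfolding gauss_mean_def
  by (intro nn_integral_eq_integral gauss_integrable assms AE_I2) (simp add: gauss_nonneg assms)

text \<open>A majorant, up to the factor e^4, of r^(2k) exp(-((k + 1)(r - 1))^2 / 2) for all k at
  once. Its independence of k keeps the constant of the pointwise bound uniform in the
  degree.\<close>

definition radial_weight :: "real \<Rightarrow> real" where
  "radial_weight r = exp (- (r - 1)\<^sup>2 / 4)"

text \<open>The weight is compared with a Gaussian dilated by 2, whose total mass the affine
  substitution gives. Doubling the width is what absorbs the shift of the centre from 0 to radius
  1.\<close>

lemma radial_weight_mass_finite: "(\<integral>\<^sup>+x. ennreal (radial_weight (nrm d x)) \<partial>lebesgue_Rd d) < \<infinity>"
proof -
  define c where "c = exp (1 / 4) * sqrt (2 * pi) ^ d"
  define f where "f x = ennreal (gauss d (\<lambda>i. 1 / 2 * x i))" for x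
  have le: "radial_weight (nrm d x) \<le> c * gauss d (\<lambda>i. 1 / 2 * x i)" for x
  proof -
    define r where "r = nrm d x"
    have half: "nrm d (\<lambda>i. 1 / 2 * x i) = 1 / 2 * r"
      unfolding r_def by (rule nrm_scale) simp
    have "c * gauss d (\<lambda>i. 1 / 2 * x i) = exp (1 / 4) * exp (- (1 / 2 * r)\<^sup>2 / 2)"
      unfolding gauss_eq_nrm half c_def by (simp add: power_one_over)
    also have "\<dots> = exp (1 / 4 + - (1 / 2 * r)\<^sup>2 / 2)"
      by (rule exp_add[symmetric])
    finally have eq: "c * gauss d (\<lambda>i. 1 / 2 * x i) = exp (1 / 4 + - (1 / 2 * r)\<^sup>2 / 2)" .
    \<comment> \<open>The two exponents differ by exactly this square; that is where the
      \<open>exp (1 / 4)\<close> in \<open>c\<close> comes from.\<close>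
    have "0 \<le> (r - 2)\<^sup>2 / 8" by simp
    then have "- (r - 1)\<^sup>2 / 4 \<le> 1 / 4 + - (1 / 2 * r)\<^sup>2 / 2"
      by (simp add: power2_eq_square field_simps)
    then show ?thesis unfolding eq radial_weight_def r_def by simp
  qed
  have f: "f \<in> borel_measurable (\<Pi>\<^sub>M i\<in>{..<d}. borel)"
  proof -
    have "(\<lambda>x. gauss d (\<lambda>i. 1 / 2 * x i)) = (\<lambda>x. gauss d (\<lambda>i\<in>{..<d}. 1 / 2 * x i))"
      by (intro ext gauss_cong) simp
    moreover have "(\<lambda>x. \<lambda>i\<in>{..<d}. 1 / 2 * x i) \<in> measurable (\<Pi>\<^sub>M i\<in>{..<d}. borel) (\<Pi>\<^sub>M i\<in>{..<d}. borel :: real measure)"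
      by measurable
    ultimately have "(\<lambda>x. gauss d (\<lambda>i. 1 / 2 * x i)) \<in> borel_measurable (\<Pi>\<^sub>M i\<in>{..<d}. borel)"
      using measurable_compose[OF _ gauss_measurable] by (simp only:)
    then show ?thesis unfolding f_def[abs_def] by measurable
  qed
  have "(\<integral>\<^sup>+x. f x \<partial>lebesgue_Rd d) = ennreal (2 ^ d) * (\<integral>\<^sup>+z. f (\<lambda>i\<in>{..<d}. 0 + 2 * z i) \<partial>lebesgue_Rd d)"
    by (rule nn_integral_affine_Rd[symmetric, OF _ f]) simp
  also have "(\<lambda>z. f (\<lambda>i\<in>{..<d}. 0 + 2 * z i)) = (\<lambda>z. ennreal (gauss d z * 1))"
    unfolding f_def by (intro ext arg_cong[where f = ennreal]) (simp, intro gauss_cong, simp)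
  also have "(\<integral>\<^sup>+z. ennreal (gauss d z * 1) \<partial>lebesgue_Rd d) = ennreal 1"
    using nn_integral_gauss[OF polyfuns_const[of 1 d]] by (simp add: gauss_mean_const)
  finally have fin: "(\<integral>\<^sup>+x. f x \<partial>lebesgue_Rd d) < \<infinity>"
    by (simp add: ennreal_mult_less_top)
  have c: "0 \<le> c" by (simp add: c_def)
  have "(\<integral>\<^sup>+x. ennreal (radial_weight (nrm d x)) \<partial>lebesgue_Rd d) \<le> (\<integral>\<^sup>+x. ennreal c * f x \<partial>lebesgue_Rd d)"
    unfolding f_def ennreal_mult'[OF c, symmetric] by (intro nn_integral_mono ennreal_leI le)
  also have "\<dots> = ennreal c * (\<integral>\<^sup>+x. f x \<partial>lebesgue_Rd d)"
    using f by (intro nn_integral_cmult) (simp add: measurable_lebesgue_Rd)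
  also have "\<dots> < \<infinity>" using fin by (simp add: ennreal_mult_less_top)
  finally show ?thesis .
qed

text \<open>From r \<le> exp(r - 1) the power is at most exp(2a) with a = |r - 1| (k + 1). Half of
  the Gaussian exponent a^2 / 2 absorbs 2a up to the constant 4, and the other half dominates (r -
  1)^2 / 4.\<close>

lemma power_radial_weight:
  assumes "0 < r"
  shows "(r ^ k)\<^sup>2 * exp (- ((r - 1) * real (Suc k))\<^sup>2 / 2) \<le> exp 4 * radial_weight r"
proof -
  define a where "a = \<bar>r - 1\<bar> * real (Suc k)"
  have "r \<le> exp (r - 1)" using exp_ge_add_one_self[of "r - 1"] by simp
  then have "r ^ (2 * k) \<le> exp (r - 1) ^ (2 * k)"
    using assms by (intro power_mono) auto
  also have "\<dots> = exp (real (2 * k) * (r - 1))"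
    by (rule exp_of_nat_mult[symmetric])
  finally have "(r ^ k)\<^sup>2 * exp (- ((r - 1) * real (Suc k))\<^sup>2 / 2)
      \<le> exp (real (2 * k) * (r - 1)) * exp (- ((r - 1) * real (Suc k))\<^sup>2 / 2)"
    by (intro mult_right_mono) (simp_all add: power_mult[symmetric] mult.commute)
  also have "\<dots> = exp (real (2 * k) * (r - 1) + - ((r - 1) * real (Suc k))\<^sup>2 / 2)"
    by (rule exp_add[symmetric])
  also have "\<dots> \<le> exp (4 + - (r - 1)\<^sup>2 / 4)"
  proof -
    have "real (2 * k) * (r - 1) \<le> real (2 * k) * \<bar>r - 1\<bar>"
      by (intro mult_left_mono) auto
    also have "\<dots> \<le> 2 * real (Suc k) * \<bar>r - 1\<bar>"
      by (intro mult_right_mono) auto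
    finally have 1: "real (2 * k) * (r - 1) \<le> 2 * a" by (simp only: a_def mult_ac)
    have 2: "((r - 1) * real (Suc k))\<^sup>2 = a\<^sup>2" by (simp add: a_def power_mult_distrib)
    have "\<bar>r - 1\<bar> * 1 \<le> a" unfolding a_def by (intro mult_left_mono) auto
    then have 3: "(r - 1)\<^sup>2 \<le> a\<^sup>2" by (simp add: abs_le_square_iff[symmetric] a_def)
    have "0 \<le> (a / 2 - 2)\<^sup>2" by simp
    then have "2 * a \<le> a\<^sup>2 / 4 + 4" by (simp add: power2_eq_square field_simps)
    then have "real (2 * k) * (r - 1) + - ((r - 1) * real (Suc k))\<^sup>2 / 2 \<le> 4 + - (r - 1)\<^sup>2 / 4"
      using 1 3 unfolding 2 by linarith
    then show ?thesis by simp
  qed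
  also have "\<dots> = exp 4 * radial_weight r"
    unfolding radial_weight_def by (rule exp_add)
  finally show ?thesis .
qed

text \<open>Mean value property for a Gaussian of width \<open>1 / (k + 1)\<close>, for which the mass at radius \<open>r\<close>
  compensates the growth \<open>r\<^sup>2\<^sup>k\<close> of the squared polynomial.\<close>

lemma harmonic_pointwise_bound:
  assumes d: "0 < d"
  obtains K where "0 \<le> K"
    and "\<And>k p \<theta>. p \<in> harmonic_polys d k \<Longrightarrow> \<theta> \<in> usphere d \<Longrightarrow>
      (p \<theta>)\<^sup>2 \<le> K * real (Suc k) ^ d * (\<integral>\<theta>. (p \<theta>)\<^sup>2 \<partial>sphere_measure d)"
proof
  define c where "c = (1 / sqrt (2 * pi)) ^ d"
  define \<Psi> where "\<Psi> = (\<integral>\<^sup>+x. ennreal (radial_weight (nrm d x)) \<partial>lebesgue_Rd d)"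
  \<comment> \<open>Every factor depends on d alone, hence \<open>K\<close> is uniform in the degree
    and in the polynomial.\<close>
  define K where "K = c * exp 4 * enn2real \<Psi> / enn2real (sphere_area d)"
  have c: "0 \<le> c" by (simp add: c_def)
  have A: "ennreal (enn2real (sphere_area d)) = sphere_area d"
    using sphere_area_finite[of d] by simp
  have A_pos: "0 < enn2real (sphere_area d)"
    using sphere_area_pos[OF d] sphere_area_finite[of d] by (simp add: enn2real_positive_iff)
  have \<Psi>: "ennreal (enn2real \<Psi>) = \<Psi>"
    using radial_weight_mass_finite[of d] by (simp add: \<Psi>_def)
  show "0 \<le> K" using c by (simp add: K_def)
  fix k p \<theta>
  assume p: "p \<in> harmonic_polys d k" and \<theta>: "\<theta> \<in> usphere d"
  note P = harmonic_polysD[OF p]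
  have nrm_\<theta>: "nrm d \<theta> = 1" using \<theta> by (simp add: usphere_def)
  define s where "s = 1 / real (Suc k)"
  have s: "0 < s" by (simp add: s_def)
  define u where "u z = p (\<lambda>i. \<theta> i + s * z i)" for z
  have u: "u \<in> polyfuns d" unfolding u_def[abs_def] by (rule polyfuns_affine[OF P(2)])
  have u2: "(\<lambda>z. (u z)\<^sup>2) \<in> polyfuns d"
    using polyfuns_mult[OF u u] by (simp only: power2_eq_square)
  have p2: "(\<lambda>z. (p z)\<^sup>2) \<in> polyfuns d"
    using polyfuns_mult[OF P(2) P(2)] by (simp only: power2_eq_square)
  define S where "S = (\<integral>\<theta>. (p \<theta>)\<^sup>2 \<partial>sphere_measure d)"
  have S: "(\<integral>\<^sup>+\<theta>. ennreal ((p \<theta>)\<^sup>2) \<partial>sphere_measure d) = ennreal S"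
    unfolding S_def by (intro nn_integral_eq_integral integrable_sphere p2 AE_I2) simp
  have S_nonneg: "0 \<le> S" unfolding S_def by (intro integral_nonneg_AE) simp
  define f where "f y = ennreal (gauss d (\<lambda>i. 1 / s * (y i - \<theta> i)) * (p y)\<^sup>2)" for y
  have f: "f \<in> borel_measurable (\<Pi>\<^sub>M i\<in>{..<d}. borel)"
  proof -
    have "(\<lambda>y. gauss d (\<lambda>i. 1 / s * (y i - \<theta> i))) = (\<lambda>y. gauss d (\<lambda>i\<in>{..<d}. 1 / s * (y i - \<theta> i)))"
      by (intro ext gauss_cong) simp
    moreover have "(\<lambda>y. \<lambda>i\<in>{..<d}. 1 / s * (y i - \<theta> i)) \<in> measurable (\<Pi>\<^sub>M i\<in>{..<d}. borel) (\<Pi>\<^sub>M i\<in>{..<d}. borel :: real measure)"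
      by measurable
    ultimately have "(\<lambda>y. gauss d (\<lambda>i. 1 / s * (y i - \<theta> i))) \<in> borel_measurable (\<Pi>\<^sub>M i\<in>{..<d}. borel)"
      using measurable_compose[OF _ gauss_measurable] by (simp only:)
    then show ?thesis unfolding f_def[abs_def] using polyfuns_measurable[OF p2] by measurable
  qed
  \<comment> \<open>The mean value property followed by Jensen's inequality bounds the squared value
    by a mean of squares.\<close>
  have "(p \<theta>)\<^sup>2 = (gauss_mean d u)\<^sup>2"
    unfolding u_def by (simp only: gauss_mean_harmonic[OF P(2) P(3)])
  also have "\<dots> \<le> gauss_mean d (\<lambda>z. (u z)\<^sup>2)"
    by (rule gauss_mean_power2[OF u])
  finally have "ennreal ((p \<theta>)\<^sup>2) \<le> ennreal (gauss_mean d (\<lambda>z. (u z)\<^sup>2))"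
    by (rule ennreal_leI)
  also have "\<dots> = (\<integral>\<^sup>+z. ennreal (gauss d z * (u z)\<^sup>2) \<partial>lebesgue_Rd d)"
    by (rule nn_integral_gauss[symmetric, OF u2]) simp
  also have "\<dots> = (\<integral>\<^sup>+z. f (\<lambda>i\<in>{..<d}. \<theta> i + s * z i) \<partial>lebesgue_Rd d)"
  proof (intro nn_integral_cong)
    fix z
    have "gauss d (\<lambda>i. 1 / s * ((\<lambda>i\<in>{..<d}. \<theta> i + s * z i) i - \<theta> i)) = gauss d z"
      using s by (intro gauss_cong) simp
    moreover have "p (\<lambda>i\<in>{..<d}. \<theta> i + s * z i) = u z"
      unfolding u_def by (intro polyfuns_cong[OF P(2)]) simp
    ultimately show "ennreal (gauss d z * (u z)\<^sup>2) = f (\<lambda>i\<in>{..<d}. \<theta> i + s * z i)"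
      unfolding f_def by (simp only:)
  qed
  \<comment> \<open>The growth (k + 1)^d of the bound is the Jacobian of shrinking the Gaussian to
    width 1 / (k + 1).\<close>
  also have "\<dots> = ennreal (real (Suc k) ^ d) * (\<integral>\<^sup>+y. f y \<partial>lebesgue_Rd d)"
  proof -
    have "real (Suc k) ^ d * s ^ d = 1"
      by (simp add: s_def power_one_over)
    then have "ennreal (real (Suc k) ^ d) * ennreal (s ^ d) = 1"
      by (simp add: ennreal_mult'[symmetric])
    then show ?thesis
      unfolding nn_integral_affine_Rd[OF s f, of \<theta>, symmetric] mult.assoc[symmetric] by simp
  qed
  finally have 1: "ennreal ((p \<theta>)\<^sup>2) \<le> ennreal (real (Suc k) ^ d) * (\<integral>\<^sup>+y. f y \<partial>lebesgue_Rd d)" .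
  have "(\<integral>\<^sup>+y. f y \<partial>lebesgue_Rd d)
      \<le> (\<integral>\<^sup>+y. ennreal (c * exp 4) * (ennreal ((p (direction d y))\<^sup>2) * ennreal (radial_weight (nrm d y))) \<partial>lebesgue_Rd d)"
  proof (intro nn_integral_mono_AE, use nrm_pos_AE[OF d] in eventually_elim)
    fix y assume r: "0 < nrm d y"
    let ?r = "nrm d y"
    \<comment> \<open>The triangle inequality in both directions replaces the distance from \<theta>
      by the difference of the radii. The weight becomes radial, so that \<open>polar_sphere\<close>
      can separate it from the angular part of p.\<close>
    have "?r \<le> nrm d (\<lambda>i. y i - \<theta> i) + nrm d \<theta>" "nrm d \<theta> \<le> nrm d (\<lambda>i. \<theta> i - y i) + ?r"
      using L2_set_triangle_ineq[of "\<lambda>i. y i - \<theta> i" \<theta> "{..<d}"] L2_set_triangle_ineq[of "\<lambda>i. \<theta> i - y i" y "{..<d}"]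
      by (simp_all add: nrm_def)
    moreover have "nrm d (\<lambda>i. \<theta> i - y i) = nrm d (\<lambda>i. y i - \<theta> i)"
      unfolding nrm_def L2_set_def by (simp add: power2_commute)
    ultimately have "\<bar>?r - 1\<bar> \<le> nrm d (\<lambda>i. y i - \<theta> i)" using nrm_\<theta> by simp
    then have "\<bar>?r - 1\<bar> * real (Suc k) \<le> nrm d (\<lambda>i. y i - \<theta> i) * real (Suc k)"
      by (intro mult_right_mono) auto
    also have "\<dots> = nrm d (\<lambda>i. 1 / s * (y i - \<theta> i))"
      by (subst nrm_scale) (simp_all add: s_def)
    finally have "(\<bar>?r - 1\<bar> * real (Suc k))\<^sup>2 \<le> (nrm d (\<lambda>i. 1 / s * (y i - \<theta> i)))\<^sup>2"
      by (intro power_mono) auto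
    then have "gauss d (\<lambda>i. 1 / s * (y i - \<theta> i)) \<le> c * exp (- ((?r - 1) * real (Suc k))\<^sup>2 / 2)"
      unfolding gauss_eq_nrm c_def[symmetric] using c by (intro mult_left_mono) (simp_all add: power_mult_distrib)
    then have "gauss d (\<lambda>i. 1 / s * (y i - \<theta> i)) * (p y)\<^sup>2
        \<le> c * exp (- ((?r - 1) * real (Suc k))\<^sup>2 / 2) * (?r ^ k * p (direction d y))\<^sup>2"
      unfolding homogeneous_polys_polar[OF P(1) r] by (intro mult_right_mono) auto
    also have "\<dots> = c * (p (direction d y))\<^sup>2 * ((?r ^ k)\<^sup>2 * exp (- ((?r - 1) * real (Suc k))\<^sup>2 / 2))"
      by (simp add: power_mult_distrib)
    also have "\<dots> \<le> c * (p (direction d y))\<^sup>2 * (exp 4 * radial_weight ?r)"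
      using c by (intro mult_left_mono power_radial_weight r) auto
    finally have "gauss d (\<lambda>i. 1 / s * (y i - \<theta> i)) * (p y)\<^sup>2 \<le> (c * exp 4) * ((p (direction d y))\<^sup>2 * radial_weight ?r)"
      by (simp only: mult_ac)
    then have "f y \<le> ennreal ((c * exp 4) * ((p (direction d y))\<^sup>2 * radial_weight ?r))"
      unfolding f_def by (rule ennreal_leI)
    also have "\<dots> = ennreal (c * exp 4) * (ennreal ((p (direction d y))\<^sup>2) * ennreal (radial_weight ?r))"
      using c by (simp add: ennreal_mult radial_weight_def)
    finally show "f y \<le> ennreal (c * exp 4) * (ennreal ((p (direction d y))\<^sup>2) * ennreal (radial_weight ?r))" .
  qed
  also have "\<dots> = ennreal (c * exp 4) * (\<integral>\<^sup>+y. ennreal ((p (direction d y))\<^sup>2) * ennreal (radial_weight (nrm d y)) \<partial>lebesgue_Rd d)"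
  proof (intro nn_integral_cmult)
    have "(\<lambda>y. ennreal ((p (direction d y))\<^sup>2) * ennreal (radial_weight (nrm d y))) \<in> borel_measurable (\<Pi>\<^sub>M i\<in>{..<d}. borel)"
      using measurable_compose[OF direction_measurable polyfuns_measurable[OF p2]]
      unfolding radial_weight_def by measurable
    then show "(\<lambda>y. ennreal ((p (direction d y))\<^sup>2) * ennreal (radial_weight (nrm d y))) \<in> borel_measurable (lebesgue_Rd d)"
      unfolding measurable_lebesgue_Rd .
  qed
  finally have 2: "(\<integral>\<^sup>+y. f y \<partial>lebesgue_Rd d) \<le> \<dots>" .
  have 3: "sphere_area d * (\<integral>\<^sup>+y. ennreal ((p (direction d y))\<^sup>2) * ennreal (radial_weight (nrm d y)) \<partial>lebesgue_Rd d) = ennreal S * \<Psi>"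
    unfolding \<Psi>_def S[symmetric]
    by (rule polar_sphere[OF _ d]) (use polyfuns_measurable[OF p2] S in \<open>auto simp: radial_weight_def\<close>)
  have "sphere_area d * ennreal ((p \<theta>)\<^sup>2)
      \<le> sphere_area d * (ennreal (real (Suc k) ^ d) * (ennreal (c * exp 4) *
        (\<integral>\<^sup>+y. ennreal ((p (direction d y))\<^sup>2) * ennreal (radial_weight (nrm d y)) \<partial>lebesgue_Rd d)))"
    by (intro mult_left_mono order.trans[OF 1] 2) auto
  also have "\<dots> = ennreal (real (Suc k) ^ d) * (ennreal (c * exp 4) * (ennreal S * \<Psi>))"
    unfolding 3[symmetric] by (simp only: mult_ac)
  also have "\<dots> = ennreal (real (Suc k) ^ d * (c * exp 4 * (S * enn2real \<Psi>)))"
    using c S_nonneg \<Psi> by (simp add: ennreal_mult)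
  finally have "ennreal (enn2real (sphere_area d) * (p \<theta>)\<^sup>2) \<le> ennreal (real (Suc k) ^ d * (c * exp 4 * (S * enn2real \<Psi>)))"
    using A by (simp add: ennreal_mult)
  then have "enn2real (sphere_area d) * (p \<theta>)\<^sup>2 \<le> real (Suc k) ^ d * (c * exp 4 * (S * enn2real \<Psi>))"
    using c S_nonneg by (subst (asm) ennreal_le_iff) auto
  then show "(p \<theta>)\<^sup>2 \<le> K * real (Suc k) ^ d * (\<integral>\<theta>. (p \<theta>)\<^sup>2 \<partial>sphere_measure d)"
    using A_pos unfolding S_def[symmetric] K_def by (simp add: field_simps)
qed

section \<open>Orthogonality on the sphere\<close>

lemma gauss_radial_mass_finite:
  "(\<integral>\<^sup>+x. ennreal ((1 / sqrt (2 * pi)) ^ d * (nrm d x ^ n * exp (- (nrm d x)\<^sup>2 / 2))) \<partial>lebesgue_Rd d) < \<infinity>"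
proof -
  \<comment> \<open>Odd powers of the norm are not polynomials; the power n is therefore dominated
    by (1 + |x|^2)^n, which has a Gaussian mean.\<close>
  define p where "p x = (1 + (\<Sum>i<d. x i * x i)) ^ n" for x :: "nat \<Rightarrow> real"
  have base: "(\<lambda>x. 1 + (\<Sum>i<d. x i * x i)) \<in> polyfuns d"
    by (rule polyfuns.add[OF polyfuns_const], rule polyfuns_sum, rule polyfuns_mult) (simp_all add: polyfuns_coord)
  have p: "p \<in> polyfuns d"
    unfolding p_def
  proof (induction n)
    case 0
    then show ?case by (simp add: polyfuns_const)
  next
    case (Suc n)
    show ?case unfolding power_Suc by (rule polyfuns_mult[OF base Suc])
  qed
  have p_eq: "p x = (1 + (nrm d x)\<^sup>2) ^ n" for x
    unfolding p_def nrm_power2 by (simp only: power2_eq_square)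
  have "(1 / sqrt (2 * pi)) ^ d * (nrm d x ^ n * exp (- (nrm d x)\<^sup>2 / 2)) \<le> gauss d x * p x" for x
  proof -
    have "nrm d x \<le> 1 + (nrm d x)\<^sup>2"
      using zero_le_power2[of "nrm d x - 1 / 2"] by (simp add: power2_eq_square field_simps)
    then have "nrm d x ^ n \<le> p x"
      unfolding p_eq by (intro power_mono nrm_nonneg)
    then have "gauss d x * nrm d x ^ n \<le> gauss d x * p x"
      by (intro mult_left_mono gauss_nonneg)
    then show ?thesis unfolding gauss_eq_nrm by (simp only: mult_ac)
  qed
  then have "(\<integral>\<^sup>+x. ennreal ((1 / sqrt (2 * pi)) ^ d * (nrm d x ^ n * exp (- (nrm d x)\<^sup>2 / 2))) \<partial>lebesgue_Rd d)
      \<le> (\<integral>\<^sup>+x. ennreal (gauss d x * p x) \<partial>lebesgue_Rd d)"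
    by (intro nn_integral_mono ennreal_leI)
  also have "\<dots> = ennreal (gauss_mean d p)"
    by (rule nn_integral_gauss[OF p]) (simp add: p_eq)
  also have "\<dots> < \<infinity>" by simp
  finally show ?thesis .
qed

text \<open>By homogeneity the Gaussian integral of p q is, up to the sphere area, its sphere
  integral times a radial mass. The Gaussian side vanishes, and the radial mass is finite and
  nonzero, so it can be cancelled.\<close>

lemma sphere_orthogonal:
  assumes d: "0 < d" and p: "p \<in> harmonic_polys d k" and q: "q \<in> harmonic_polys d m" and "k \<noteq> m"
  shows "(\<integral>\<theta>. p \<theta> * q \<theta> \<partial>sphere_measure d) = 0"
proof -
  note P = harmonic_polysD[OF p] and Q = harmonic_polysD[OF q]
  define \<psi> where "\<psi> r = (1 / sqrt (2 * pi)) ^ d * (r ^ (k + m) * exp (- r\<^sup>2 / 2))" for r :: real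
  define h where "h = (\<lambda>x. p x * q x)"
  define \<Psi> where "\<Psi> = (\<integral>\<^sup>+x. ennreal (\<psi> (nrm d x)) \<partial>lebesgue_Rd d)"
  have h: "h \<in> polyfuns d" unfolding h_def by (rule polyfuns_mult[OF P(2) Q(2)])
  have mh: "(\<lambda>x. ennreal (s * h x)) \<in> borel_measurable (\<Pi>\<^sub>M i\<in>{..<d}. borel)" for s
    using polyfuns_measurable[OF polyfuns_cmult[OF h, of s]] by measurable
  have m\<psi>: "(\<lambda>r. ennreal (\<psi> r)) \<in> borel_measurable borel"
    unfolding \<psi>_def by measurable
  have int_S: "integrable (sphere_measure d) h" by (rule integrable_sphere[OF h])
  have int_G: "integrable (lebesgue_Rd d) (\<lambda>x. gauss d x * h x)" by (rule gauss_integrable[OF h])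
  have polar: "gauss d x * h x = \<psi> (nrm d x) * h (direction d x)" if "0 < nrm d x" for x
    unfolding h_def \<psi>_def gauss_eq_nrm homogeneous_polys_polar[OF P(1) that] homogeneous_polys_polar[OF Q(1) that] power_add
    by (simp only: mult_ac)
  have fin: "(\<integral>\<^sup>+\<theta>. ennreal (s * h \<theta>) \<partial>sphere_measure d) < \<infinity>" for s
    using integrable_mult_right[OF int_S, of s] unfolding real_integrable_def less_top infinity_ennreal_def by simp
  \<comment> \<open>Polar coordinates are available for nonnegative integrands only. Since
    \<open>ennreal\<close> cuts off negative values, s = 1 and s = -1 select the positive and the
    negative part.\<close>
  have eq: "sphere_area d * (\<integral>\<^sup>+x. ennreal (s * (gauss d x * h x)) \<partial>lebesgue_Rd d)
      = (\<integral>\<^sup>+\<theta>. ennreal (s * h \<theta>) \<partial>sphere_measure d) * \<Psi>" for s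
  proof -
    have "(\<integral>\<^sup>+x. ennreal (s * (gauss d x * h x)) \<partial>lebesgue_Rd d)
        = (\<integral>\<^sup>+x. ennreal (s * h (direction d x)) * ennreal (\<psi> (nrm d x)) \<partial>lebesgue_Rd d)"
    proof (intro nn_integral_cong_AE, use nrm_pos_AE[OF d] in eventually_elim)
      fix x assume r: "0 < nrm d x"
      have "0 \<le> \<psi> (nrm d x)" by (simp add: \<psi>_def nrm_nonneg)
      then have "ennreal (\<psi> (nrm d x) * (s * h (direction d x))) = ennreal (\<psi> (nrm d x)) * ennreal (s * h (direction d x))"
        by (rule ennreal_mult')
      then show "ennreal (s * (gauss d x * h x)) = ennreal (s * h (direction d x)) * ennreal (\<psi> (nrm d x))"
        unfolding polar[OF r] by (simp only: mult_ac)
    qed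
    then show ?thesis
      unfolding \<Psi>_def using polar_sphere[OF mh d fin m\<psi>, of s] by (simp only:)
  qed
  have "gauss_mean d h = 0"
    unfolding h_def by (rule gauss_mean_orthogonal[OF p q \<open>k \<noteq> m\<close>])
  then have en: "enn2real (\<integral>\<^sup>+x. ennreal (gauss d x * h x) \<partial>lebesgue_Rd d)
      = enn2real (\<integral>\<^sup>+x. ennreal (- (gauss d x * h x)) \<partial>lebesgue_Rd d)"
    unfolding gauss_mean_def using real_lebesgue_integral_def[OF int_G] by simp
  have fins: "(\<integral>\<^sup>+x. ennreal (gauss d x * h x) \<partial>lebesgue_Rd d) < top" "(\<integral>\<^sup>+x. ennreal (- (gauss d x * h x)) \<partial>lebesgue_Rd d) < top"
    using int_G unfolding real_integrable_def less_top infinity_ennreal_def by simp_all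
  have "(\<integral>\<^sup>+x. ennreal (1 * (gauss d x * h x)) \<partial>lebesgue_Rd d) = (\<integral>\<^sup>+x. ennreal (- 1 * (gauss d x * h x)) \<partial>lebesgue_Rd d)"
    unfolding mult_1 mult_minus1
    using arg_cong[OF en, of ennreal] unfolding ennreal_enn2real[OF fins(1)] ennreal_enn2real[OF fins(2)] .
  then have "(\<integral>\<^sup>+\<theta>. ennreal (1 * h \<theta>) \<partial>sphere_measure d) * \<Psi> = (\<integral>\<^sup>+\<theta>. ennreal (- 1 * h \<theta>) \<partial>sphere_measure d) * \<Psi>"
    unfolding eq[symmetric] by (simp only:)
  moreover have "\<Psi> \<noteq> top"
    using gauss_radial_mass_finite[of d "k + m"] by (simp add: \<Psi>_def \<psi>_def less_top)
  \<comment> \<open>The radial density is positive away from the origin, so a zero integral would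
    make the punctured unit ball a null set.\<close>
  moreover have "\<Psi> \<noteq> 0"
  proof
    assume "\<Psi> = 0"
    moreover have "(\<lambda>x. ennreal (\<psi> (nrm d x))) \<in> borel_measurable (lebesgue_Rd d)"
      using measurable_compose[OF nrm_measurable m\<psi>] by (simp only: measurable_lebesgue_Rd)
    ultimately have "AE x in lebesgue_Rd d. ennreal (\<psi> (nrm d x)) = 0"
      unfolding \<Psi>_def by (simp only: nn_integral_0_iff_AE)
    with nrm_pos_AE[OF d] have "AE x in lebesgue_Rd d. \<not> (0 < nrm d x \<and> nrm d x \<le> 1)"
    proof eventually_elim
      fix x assume "0 < nrm d x" "ennreal (\<psi> (nrm d x)) = 0"
      moreover from this have "0 < \<psi> (nrm d x)" by (simp add: \<psi>_def)
      ultimately show "\<not> (0 < nrm d x \<and> nrm d x \<le> 1)" by simp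
    qed
    then have "ball_volume d = 0"
      unfolding ball_volume_def by (subst (asm) AE_iff_measurable[OF punctured_ball_sets]) auto
    then show False using ball_volume_pos[OF d] by simp
  qed
  ultimately have "(\<integral>\<^sup>+\<theta>. ennreal (1 * h \<theta>) \<partial>sphere_measure d) = (\<integral>\<^sup>+\<theta>. ennreal (- 1 * h \<theta>) \<partial>sphere_measure d)"
    using ennreal_mult_cancel_left[of \<Psi>] by (auto simp: mult.commute[of _ \<Psi>])
  then have "(\<integral>\<theta>. h \<theta> \<partial>sphere_measure d) = 0"
    by (subst real_lebesgue_integral_def[OF int_S]) simp
  then show ?thesis by (simp only: h_def)
qed

section \<open>Sums of squares of an orthonormal basis\<close>

lemma sum_apply: "(\<Sum>i\<in>I. f i) x = (\<Sum>i\<in>I. f i x :: real)"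
  by (induction I rule: infinite_finite_induct) simp_all

lemma harmonic_basisD:
  assumes "harmonic_basis d Y" "l \<in> {1..harm_dim d k}"
  shows "Y k l \<in> harmonic_polys d k"
    "j \<in> {1..harm_dim d k} \<Longrightarrow> (\<integral>\<theta>. Y k l \<theta> * Y k j \<theta> \<partial>sphere_measure d) = (if l = j then 1 else 0)"
  using assms by (simp_all add: harmonic_basis_def)

lemma harmonic_basis_polyfuns:
  "harmonic_basis d Y \<Longrightarrow> l \<in> {1..harm_dim d k} \<Longrightarrow> Y k l \<in> polyfuns d"
  by (rule harmonic_polysD(2)[OF harmonic_basisD(1)])

text \<open>The pointwise bound is applied to the reproducing kernel at \<theta>, the combination of
  the basis with coefficients \<open>Y k l \<theta>\<close>. Both its value at \<theta> and its
  squared norm equal the sum S of squares, so S^2 is at most K (k + 1)^d S, without reference to the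
  number of basis elements.\<close>

lemma harmonic_basis_bound:
  assumes d: "0 < d" and Y: "harmonic_basis d Y"
  obtains K where "0 \<le> K"
    and "\<And>k \<theta>. \<theta> \<in> usphere d \<Longrightarrow> (\<Sum>l=1..harm_dim d k. (Y k l \<theta>)\<^sup>2) \<le> K * real (Suc k) ^ d"
proof -
  obtain K where K: "0 \<le> K" "\<And>k p \<theta>. p \<in> harmonic_polys d k \<Longrightarrow> \<theta> \<in> usphere d \<Longrightarrow>
      (p \<theta>)\<^sup>2 \<le> K * real (Suc k) ^ d * (\<integral>\<theta>. (p \<theta>)\<^sup>2 \<partial>sphere_measure d)"
    by (rule harmonic_pointwise_bound[OF d], rule that)
  have "(\<Sum>l=1..harm_dim d k. (Y k l \<theta>)\<^sup>2) \<le> K * real (Suc k) ^ d" if \<theta>: "\<theta> \<in> usphere d" for k \<theta>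
  proof -
    let ?L = "{1..harm_dim d k}"
    define S where "S = (\<Sum>l\<in>?L. (Y k l \<theta>)\<^sup>2)"
    define p where "p = (\<Sum>l\<in>?L. (\<lambda>x. Y k l \<theta> * Y k l x))"
    have p_eq: "p x = (\<Sum>l\<in>?L. Y k l \<theta> * Y k l x)" for x
      unfolding p_def by (rule sum_apply)
    have "p \<in> fun_span (Y k ` ?L)"
      unfolding p_def
      by (intro fun_space.span_sum fun_space.span_scale[where x = "Y k _"] fun_space.span_base) auto
    then have "p \<in> harmonic_polys d k"
      using Y by (simp add: harmonic_basis_def)
    then have "(p \<theta>)\<^sup>2 \<le> K * real (Suc k) ^ d * (\<integral>\<theta>. (p \<theta>)\<^sup>2 \<partial>sphere_measure d)"
      by (rule K(2)[OF _ \<theta>])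
    moreover have "p \<theta> = S"
      by (simp add: p_eq S_def power2_eq_square)
    moreover have "(\<integral>x. (p x)\<^sup>2 \<partial>sphere_measure d) = S"
    proof -
      have int: "integrable (sphere_measure d) (\<lambda>x. Y k l \<theta> * Y k j \<theta> * (Y k l x * Y k j x))"
        if "l \<in> ?L" "j \<in> ?L" for l j
        by (intro integrable_mult_right integrable_sphere polyfuns_mult harmonic_basis_polyfuns[OF Y] that)
      have "(\<integral>x. (p x)\<^sup>2 \<partial>sphere_measure d)
          = (\<integral>x. (\<Sum>l\<in>?L. \<Sum>j\<in>?L. Y k l \<theta> * Y k j \<theta> * (Y k l x * Y k j x)) \<partial>sphere_measure d)"
        unfolding p_eq power2_eq_square sum_product by (simp only: mult_ac)
      also have "\<dots> = (\<Sum>l\<in>?L. \<Sum>j\<in>?L. Y k l \<theta> * Y k j \<theta> * (\<integral>x. Y k l x * Y k j x \<partial>sphere_measure d))"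
      proof -
        have "(\<integral>x. (\<Sum>j\<in>?L. Y k l \<theta> * Y k j \<theta> * (Y k l x * Y k j x)) \<partial>sphere_measure d)
            = (\<Sum>j\<in>?L. Y k l \<theta> * Y k j \<theta> * (\<integral>x. Y k l x * Y k j x \<partial>sphere_measure d))" if "l \<in> ?L" for l
          by (subst Bochner_Integration.integral_sum[OF int[OF that]]) simp_all
        then show ?thesis
          by (subst Bochner_Integration.integral_sum) (auto intro!: Bochner_Integration.integrable_sum int simp del: integrable_mult_right_iff)
      qed
      also have "\<dots> = (\<Sum>l\<in>?L. \<Sum>j\<in>?L. if l = j then (Y k l \<theta>)\<^sup>2 else 0)"
        by (intro sum.cong refl) (simp add: harmonic_basisD(2)[OF Y] power2_eq_square)
      also have "\<dots> = S"
        unfolding S_def by (intro sum.cong refl) simp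
      finally show ?thesis .
    qed
    ultimately have "S * S \<le> K * real (Suc k) ^ d * S"
      by (simp add: power2_eq_square)
    moreover have "0 \<le> S" unfolding S_def by (intro sum_nonneg) simp
    moreover have "0 \<le> K * real (Suc k) ^ d" using K(1) by simp
    ultimately show ?thesis
      unfolding S_def[symmetric] using mult_le_cancel_right[of S S] by (cases "S = 0") auto
  qed
  with K(1) show thesis by (rule that)
qed

section \<open>Coefficients of Hardy space functions\<close>

lemma continuous_on_rcis:
  assumes "g holomorphic_on ball 0 1" "0 \<le> r" "r < 1"
  shows "continuous_on {a..b} (\<lambda>\<phi>. g (rcis r \<phi>))"
proof -
  have "continuous_on (ball 0 1) g"
    using assms holomorphic_on_imp_continuous_on by blast
  moreover have "continuous_on {a..b} (\<lambda>\<phi>. rcis r \<phi>)"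
    unfolding rcis_def by (intro continuous_intros)
  ultimately show ?thesis
    using assms by (elim continuous_on_compose2) (auto simp: dist_norm)
qed

text \<open>For a non-integrable function \<open>integral\<close> returns 0, so the claim holds for
  arbitrary \<open>g\<close>.\<close>

lemma hardy_mean_nonneg: "0 \<le> hardy_mean g r"
  unfolding hardy_mean_def
  by (cases "(\<lambda>\<phi>. (cmod (g (rcis r \<phi>)))\<^sup>2) integrable_on {0..2 * pi}")
     (auto intro!: divide_nonneg_nonneg Henstock_Kurzweil_Integration.integral_nonneg simp: not_integrable_integral)

lemma hardy_mean_cong: "(\<And>z. cmod z < 1 \<Longrightarrow> f z = g z) \<Longrightarrow> 0 \<le> r \<Longrightarrow> r < 1 \<Longrightarrow> hardy_mean f r = hardy_mean g r"
  unfolding hardy_mean_def by (auto intro!: integral_cong)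

text \<open>The norm sees only the values inside the disc, and \<open>F k l\<close> and the
  Laplace-Fourier coefficient are compared only there.\<close>

lemma hardy_norm_cong: "(\<And>z. cmod z < 1 \<Longrightarrow> f z = g z) \<Longrightarrow> hardy_norm f = hardy_norm g"
  unfolding hardy_norm_def
  by (intro arg_cong[where f = sqrt] SUP_cong) (auto intro!: hardy_mean_cong)

text \<open>The substitution yields half of the integral over [0, 4 pi], which consists of two equal
  periods.\<close>

lemma integral_double_angle:
  fixes h :: "real \<Rightarrow> real"
  assumes h: "continuous_on UNIV h" and per: "\<And>x. h (x + 2 * pi) = h x"
  shows "integral {0..2 * pi} (\<lambda>x. h (2 * x)) = integral {0..2 * pi} h"
proof -
  have int: "h integrable_on {a..b}" for a b
    using h by (intro integrable_continuous_real continuous_on_subset[OF h]) auto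
  have aff: "((\<lambda>x. h (m *\<^sub>R x + c)) has_integral (1 / \<bar>m\<bar> ^ DIM(real)) *\<^sub>R integral (cbox a b) h)
      ((\<lambda>x. (1 / m) *\<^sub>R x + - ((1 / m) *\<^sub>R c)) ` cbox a b)" if "m \<noteq> 0" for m c a b :: real
    using int that by (intro has_integral_affinity integrable_integral) (auto simp: cbox_interval)
  have "(\<lambda>x::real. (1 / 2) *\<^sub>R x + - ((1 / 2) *\<^sub>R 0)) ` cbox 0 (4 * pi) = {0..2 * pi}"
    by (auto simp: image_def intro!: bexI[of _ "2 * _"])
  then have 1: "integral {0..2 * pi} (\<lambda>x. h (2 * x)) = integral {0..4 * pi} h / 2"
    using aff[of 2 0 0 "4 * pi"] by (auto simp: integral_unique)
  have "(\<lambda>x::real. (1 / 1) *\<^sub>R x + - ((1 / 1) *\<^sub>R (2 * pi))) ` cbox (2 * pi) (4 * pi) = {0..2 * pi}"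
    by (auto simp: image_def intro!: bexI[of _ "2 * pi + _"])
  then have 2: "integral {0..2 * pi} h = integral {2 * pi..4 * pi} h"
    using aff[of 1 "2 * pi" "2 * pi" "4 * pi"] by (auto simp: integral_unique per)
  have "integral {0..2 * pi} h + integral {2 * pi..4 * pi} h = integral {0..4 * pi} h"
    by (intro Henstock_Kurzweil_Integration.integral_combine int) auto
  with 1 2 show ?thesis by simp
qed

text \<open>On the circle of radius r, z^2 runs twice through the circle of radius r^2, and z^k has
  the constant modulus r^k.\<close>

lemma hardy_mean_double:
  assumes "g holomorphic_on ball 0 1" "0 \<le> r" "r < 1"
    and F: "\<And>z. cmod z < 1 \<Longrightarrow> F z = g (z\<^sup>2) * z ^ k"
  shows "hardy_mean F r = r ^ (2 * k) * hardy_mean g (r\<^sup>2)"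
proof -
  have r2: "0 \<le> r\<^sup>2" "r\<^sup>2 < 1" using assms by (auto simp: power_less_one_iff)
  define h where "h \<phi> = (cmod (g (rcis (r\<^sup>2) \<phi>)))\<^sup>2" for \<phi>
  have "continuous_on {a..b} (\<lambda>\<phi>. g (rcis (r\<^sup>2) \<phi>))" for a b
    using r2 assms by (intro continuous_on_rcis) auto
  then have "continuous_on UNIV (\<lambda>\<phi>. g (rcis (r\<^sup>2) \<phi>))"
    by (metis continuous_on_interior interior_atLeastAtMost_real continuous_at_imp_continuous_on
        greaterThanLessThan_iff less_add_one minus_add_cancel diff_add_cancel)
  then have h: "continuous_on UNIV h"
    unfolding h_def by (intro continuous_intros)
  have "(cmod (F (rcis r \<phi>)))\<^sup>2 = r ^ (2 * k) * h (2 * \<phi>)" for \<phi>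
  proof -
    have "(rcis r \<phi>)\<^sup>2 = rcis (r\<^sup>2) (2 * \<phi>)"
      by (simp add: DeMoivre2)
    then show ?thesis
      using assms by (simp add: F h_def norm_mult norm_power power_mult_distrib power_mult[symmetric] mult_ac)
  qed
  then have "hardy_mean F r = 1 / (2 * pi) * (r ^ (2 * k) * integral {0..2 * pi} (\<lambda>\<phi>. h (2 * \<phi>)))"
    by (simp add: hardy_mean_def)
  also have "integral {0..2 * pi} (\<lambda>\<phi>. h (2 * \<phi>)) = integral {0..2 * pi} h"
    by (rule integral_double_angle[OF h]) (simp add: h_def rcis_def cis.ctr)
  finally show ?thesis by (simp add: hardy_mean_def h_def[abs_def])
qed

text \<open>Bessel's inequality for a single Fourier coefficient. By Cauchy's formula
  \<open>A\<close> is the n-th Fourier coefficient of g on the circle of radius r. Pairing with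
  \<open>cnj A\<close> and using xy \<le> (x^2 + y^2) / 2 gives |A|^2 \<le> (|A|^2 + mean) /
  2.\<close>

lemma hardy_mean_coeff:
  assumes g: "g holomorphic_on ball 0 1" and r: "0 < r" "r < 1"
  shows "(cmod ((deriv ^^ n) g 0 / fact n))\<^sup>2 * r ^ (2 * n) \<le> hardy_mean g r"
proof -
  define G where "G \<phi> = g (rcis r \<phi>)" for \<phi>
  define A where "A = (deriv ^^ n) g 0 / fact n * of_real r ^ n"
  have G: "continuous_on {a..b} G" for a b
    unfolding G_def using assms by (intro continuous_on_rcis) auto
  have "((\<lambda>u. g u / (u - 0) ^ Suc n) has_contour_integral 2 * pi * \<i> / fact n * (deriv ^^ n) g 0) (circlepath 0 r)"
  proof (rule Cauchy_has_contour_integral_higher_derivative_circlepath)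
    show "continuous_on (cball 0 r) g"
      using r by (intro holomorphic_on_imp_continuous_on holomorphic_on_subset[OF g]) auto
    show "g holomorphic_on ball 0 r"
      using r by (intro holomorphic_on_subset[OF g]) auto
  qed (use r in auto)
  then have "2 * pi * \<i> / fact n * (deriv ^^ n) g 0
      = integral {0..2 * pi} (\<lambda>\<phi>. g (0 + r * cis \<phi>) / (0 + r * cis \<phi> - 0) ^ Suc n * r * \<i> * cis \<phi>)"
    unfolding circlepath_def by (subst contour_integral_part_circlepath_eq[symmetric]) (auto simp: contour_integral_unique)
  also have "\<dots> = integral {0..2 * pi} (\<lambda>\<phi>. (\<i> / of_real r ^ n) * (G \<phi> * cis (- real n * \<phi>)))"
  proof (rule integral_cong)
    fix \<phi>
    have "cis (- real n * \<phi>) = 1 / cis \<phi> ^ n"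
      using Complex.DeMoivre[of \<phi> n] by (simp add: divide_inverse flip: cis_inverse)
    then show "g (0 + r * cis \<phi>) / (0 + r * cis \<phi> - 0) ^ Suc n * r * \<i> * cis \<phi>
        = (\<i> / of_real r ^ n) * (G \<phi> * cis (- real n * \<phi>))"
      using r by (simp add: G_def rcis_def power_mult_distrib field_simps)
  qed
  also have "\<dots> = (\<i> / of_real r ^ n) * integral {0..2 * pi} (\<lambda>\<phi>. G \<phi> * cis (- real n * \<phi>))"
    by simp
  finally have "integral {0..2 * pi} (\<lambda>\<phi>. G \<phi> * cis (- real n * \<phi>)) = 2 * pi * A"
    using r by (simp add: A_def field_simps)
  moreover have contG: "continuous_on {0..2 * pi} (\<lambda>\<phi>. G \<phi> * cis (- real n * \<phi>))"
    by (intro continuous_intros G)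
  ultimately have hi: "((\<lambda>\<phi>. G \<phi> * cis (- real n * \<phi>)) has_integral 2 * pi * A) {0..2 * pi}"
    using integrable_integral[OF integrable_continuous_real[OF contG]] by metis
  have "((\<lambda>\<phi>. cnj A * (G \<phi> * cis (- real n * \<phi>))) has_integral cnj A * (2 * pi * A)) {0..2 * pi}"
    by (intro has_integral_mult_right hi)
  then have "((\<lambda>\<phi>. Re (cnj A * (G \<phi> * cis (- real n * \<phi>)))) has_integral Re (cnj A * (2 * pi * A))) {0..2 * pi}"
    by (rule has_integral_Re)
  moreover have "Re (cnj A * (2 * pi * A)) = 2 * pi * (cmod A)\<^sup>2"
    unfolding cmod_power2 by (simp add: algebra_simps power2_eq_square)
  ultimately have 1: "((\<lambda>\<phi>. Re (cnj A * (G \<phi> * cis (- real n * \<phi>)))) has_integral 2 * pi * (cmod A)\<^sup>2) {0..2 * pi}"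
    by simp
  have "((\<lambda>\<phi>. (cmod (G \<phi>))\<^sup>2) has_integral 2 * pi * hardy_mean g r) {0..2 * pi}"
  proof -
    have "(\<lambda>\<phi>. (cmod (G \<phi>))\<^sup>2) integrable_on {0..2 * pi}"
      by (intro integrable_continuous_real continuous_intros G)
    then show ?thesis using integrable_integral by (fastforce simp: hardy_mean_def G_def)
  qed
  moreover have "((\<lambda>\<phi>. (cmod A)\<^sup>2) has_integral 2 * pi * (cmod A)\<^sup>2) {0..2 * pi}"
    using has_integral_const_real[of "(cmod A)\<^sup>2" 0 "2 * pi"] by simp
  ultimately have 2: "((\<lambda>\<phi>. ((cmod A)\<^sup>2 + (cmod (G \<phi>))\<^sup>2) / 2) has_integral
      (2 * pi * (cmod A)\<^sup>2 + 2 * pi * hardy_mean g r) / 2) {0..2 * pi}"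
    by (intro has_integral_divide has_integral_add)
  have "2 * pi * (cmod A)\<^sup>2 \<le> (2 * pi * (cmod A)\<^sup>2 + 2 * pi * hardy_mean g r) / 2"
  proof (rule has_integral_le[OF 1 2])
    fix \<phi>
    have "Re (cnj A * (G \<phi> * cis (- real n * \<phi>))) \<le> cmod A * cmod (G \<phi>)"
      using complex_Re_le_cmod[of "cnj A * (G \<phi> * cis (- real n * \<phi>))"] by (simp add: norm_mult)
    then show "Re (cnj A * (G \<phi> * cis (- real n * \<phi>))) \<le> ((cmod A)\<^sup>2 + (cmod (G \<phi>))\<^sup>2) / 2"
      using sum_squares_bound[of "cmod A" "cmod (G \<phi>)"] by simp
  qed
  then have "(cmod A)\<^sup>2 \<le> hardy_mean g r" by (simp add: field_simps)
  then show ?thesis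
  proof -
    have "(cmod A)\<^sup>2 = (cmod ((deriv ^^ n) g 0 / fact n))\<^sup>2 * r ^ (2 * n)"
      unfolding A_def norm_mult power_mult_distrib norm_power
      using r by (simp add: mult.commute flip: power_mult)
    then show ?thesis using \<open>(cmod A)\<^sup>2 \<le> hardy_mean g r\<close> by simp
  qed
qed

text \<open>The coefficients are the Taylor coefficients of g, yet they are bounded by the norm of
  F, which is the one occurring in the final estimate. \<open>hardy_mean_double\<close> transfers
  the bound from g at radius r^2 to F at radius r.\<close>

lemma hardy_coefficients:
  assumes g: "g \<in> hardy_space" and F: "\<And>z. z \<in> ball 0 1 \<Longrightarrow> F z = g (z\<^sup>2) * z ^ k"
  obtains c where "\<And>m. cmod (c m) \<le> hardy_norm F"
    and "\<And>z. z \<in> ball 0 1 \<Longrightarrow> (\<lambda>m. c m * z ^ (k + 2 * m)) sums F z"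
proof
  define c where "c m = (deriv ^^ m) g 0 / fact m" for m
  have hol: "g holomorphic_on ball 0 1" and bdd: "bdd_above (hardy_mean g ` {0..<1})"
    using g by (auto simp: hardy_space_def)
  show "(\<lambda>m. c m * z ^ (k + 2 * m)) sums F z" if z: "z \<in> ball 0 1" for z
  proof -
    have "z\<^sup>2 \<in> ball 0 1" using z by (simp add: norm_power power_less_one_iff)
    then have "(\<lambda>m. c m * (z\<^sup>2 - 0) ^ m) sums g (z\<^sup>2)"
      unfolding c_def by (rule holomorphic_power_series[OF hol])
    then have "(\<lambda>m. c m * (z\<^sup>2 - 0) ^ m * z ^ k) sums (g (z\<^sup>2) * z ^ k)"
      by (rule sums_mult2)
    then show ?thesis using F[OF z] by (simp add: power_add power_mult power2_eq_square power_mult_distrib mult_ac)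
  qed
  fix m
  have mean: "hardy_mean F r = r ^ (2 * k) * hardy_mean g (r\<^sup>2)" if "0 \<le> r" "r < 1" for r
    using that F by (intro hardy_mean_double hol) auto
  obtain K where K: "\<And>r. 0 \<le> r \<Longrightarrow> r < 1 \<Longrightarrow> hardy_mean g r \<le> K"
    using bdd by (force simp: bdd_above_def)
  have "hardy_mean F r \<le> K" if "0 \<le> r" "r < 1" for r
  proof -
    have "r ^ (2 * k) * hardy_mean g (r\<^sup>2) \<le> 1 * K"
      using that K[of "r\<^sup>2"] by (intro mult_mono) (auto simp: power_le_one power_less_one_iff hardy_mean_nonneg)
    then show ?thesis using mean that by simp
  qed
  \<comment> \<open>The real supremum in \<open>hardy_norm\<close> is an upper bound only once the
    means of F are known to be bounded above.\<close>
  then have bddF: "bdd_above (hardy_mean F ` {0..<1})"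
    by (auto simp: bdd_above_def intro!: exI[of _ K])
  define H where "H = (SUP r\<in>{0..<1}. hardy_mean F r)"
  have H_ge: "hardy_mean F r \<le> H" if "0 \<le> r" "r < 1" for r
    unfolding H_def using that by (intro cSUP_upper bddF) auto
  have le: "(cmod (c m))\<^sup>2 * (r ^ (2 * k) * (r\<^sup>2) ^ (2 * m)) \<le> H" if "0 < r" "r < 1" for r
  proof -
    have "(cmod (c m))\<^sup>2 * (r\<^sup>2) ^ (2 * m) \<le> hardy_mean g (r\<^sup>2)"
      unfolding c_def using that by (intro hardy_mean_coeff hol) (auto simp: power_less_one_iff)
    then have "r ^ (2 * k) * ((cmod (c m))\<^sup>2 * (r\<^sup>2) ^ (2 * m)) \<le> r ^ (2 * k) * hardy_mean g (r\<^sup>2)"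
      by (intro mult_left_mono) auto
    then show ?thesis
      using mean[of r] H_ge[of r] that by (subst mult.left_commute) linarith
  qed
  \<comment> \<open>Letting r tend to 1 removes all powers of r from the estimate.\<close>
  have "((\<lambda>r. (cmod (c m))\<^sup>2 * (r ^ (2 * k) * (r\<^sup>2) ^ (2 * m))) \<longlongrightarrow> (cmod (c m))\<^sup>2 * (1 ^ (2 * k) * (1\<^sup>2) ^ (2 * m))) (at_left (1::real))"
    by (intro tendsto_intros)
  moreover have "\<forall>\<^sub>F r in at_left (1::real). (cmod (c m))\<^sup>2 * (r ^ (2 * k) * (r\<^sup>2) ^ (2 * m)) \<le> H"
    by (rule eventually_mono[OF eventually_at_left_real[of 0 1]]) (auto intro: le)
  ultimately have "(cmod (c m))\<^sup>2 \<le> H"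
    using tendsto_upperbound trivial_limit_at_left_real by fastforce
  then show "cmod (c m) \<le> hardy_norm F"
    unfolding hardy_norm_def H_def[symmetric] by (rule real_le_rsqrt)
qed

section \<open>Interpolatory quadrature of powers\<close>

text \<open>The sum of all monomials of total degree j in the entries of the list. Splitting off the
  power of the first variable makes the generating function a Cauchy product.\<close>

fun complete_hom :: "real list \<Rightarrow> nat \<Rightarrow> real" where
  "complete_hom [] j = (if j = 0 then 1 else 0)"
| "complete_hom (a # us) j = (\<Sum>i\<le>j. a ^ i * complete_hom us (j - i))"

lemma complete_hom_0 [simp]: "complete_hom us 0 = 1"
  by (induction us) auto

lemma complete_hom_singleton: "complete_hom [u] m = u ^ m"
proof -
  have "complete_hom [u] m = (\<Sum>i\<le>m. if i = m then u ^ i else 0)"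
    unfolding complete_hom.simps by (rule sum.cong) auto
  then show ?thesis by simp
qed

lemma complete_hom_Cons_Suc: "complete_hom (a # us) (Suc j) = complete_hom us (Suc j) + a * complete_hom (a # us) j"
  by (simp add: sum.atMost_Suc_shift sum_distrib_left mult_ac del: sum.atMost_Suc)

text \<open>The divided difference of a complete homogeneous sum in one variable is again such a sum
  with one more variable; this is the inductive step of Newton interpolation.\<close>

lemma complete_hom_diff: "complete_hom (a # us) (Suc j) - complete_hom (c # us) (Suc j) = (a - c) * complete_hom (a # c # us) j"
proof (induction j)
  case 0
  then show ?case by (simp add: complete_hom_Cons_Suc del: complete_hom.simps)
next
  case (Suc j)
  have "complete_hom (a # us) (Suc (Suc j)) - complete_hom (c # us) (Suc (Suc j))
      = a * (complete_hom (a # us) (Suc j) - complete_hom (c # us) (Suc j)) + (a - c) * complete_hom (c # us) (Suc j)"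
    by (simp add: complete_hom_Cons_Suc[of _ us "Suc j"] algebra_simps del: complete_hom.simps)
  also have "\<dots> = (a - c) * complete_hom (a # c # us) (Suc j)"
    unfolding Suc.IH complete_hom_Cons_Suc[of a "c # us" j] by (simp add: algebra_simps del: complete_hom.simps)
  finally show ?case .
qed

lemma complete_hom_nonneg: "(\<And>a. a \<in> set us \<Longrightarrow> 0 \<le> a) \<Longrightarrow> 0 \<le> complete_hom us j"
  by (induction us arbitrary: j) (auto intro!: sum_nonneg mult_nonneg_nonneg)

lemma complete_hom_le_replicate:
  "(\<And>a. a \<in> set us \<Longrightarrow> 0 \<le> a \<and> a \<le> B) \<Longrightarrow> complete_hom us j \<le> complete_hom (replicate (length us) B) j"
proof (induction us arbitrary: j)
  case Nil
  then show ?case by simp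
next
  case (Cons a us)
  then have "0 \<le> a" "a \<le> B" by auto
  moreover from this have "0 \<le> B" by simp
  moreover have "0 \<le> complete_hom us i" for i
    using Cons.prems by (intro complete_hom_nonneg) auto
  ultimately show ?case
    using Cons by (auto intro!: sum_mono mult_mono power_mono)
qed

text \<open>The generating function evaluated at 1: each variable contributes a geometric series,
  and the recursion multiplies them.\<close>

lemma complete_hom_sums:
  "(\<And>a. a \<in> set us \<Longrightarrow> 0 \<le> a \<and> a < 1) \<Longrightarrow> (\<lambda>j. complete_hom us j) sums (\<Prod>a\<leftarrow>us. 1 / (1 - a))"
proof (induction us)
  case Nil
  have "(\<lambda>j::nat. if j = 0 then 1 else 0 :: real) sums 1"
    using sums_single[of 0 "\<lambda>_. 1 :: real"] by simp
  then show ?case by simp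
next
  case (Cons a us)
  have a: "0 \<le> a" "a < 1" using Cons.prems by auto
  have IH: "(\<lambda>j. complete_hom us j) sums (\<Prod>a\<leftarrow>us. 1 / (1 - a))"
    using Cons by auto
  have "(\<lambda>j. \<Sum>i\<le>j. a ^ i * complete_hom us (j - i)) sums ((\<Sum>i. a ^ i) * (\<Sum>i. complete_hom us i))"
  proof (rule Cauchy_product_sums)
    show "summable (\<lambda>i. norm (a ^ i))" using a by (simp add: power_abs summable_geometric)
    have "norm (complete_hom us i) = complete_hom us i" for i
      using Cons.prems by (auto intro!: abs_of_nonneg complete_hom_nonneg)
    then show "summable (\<lambda>i. norm (complete_hom us i))" using IH by (auto simp: sums_iff)
  qed
  then show ?case
    using IH a by (simp add: sums_iff suminf_geometric)
qed

text \<open>Newton interpolation: the divided differences of a power are complete homogeneous symmetric sums.\<close>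

lemma power_interpolation:
  "\<exists>Q::real poly. (\<forall>i\<ge>length us. coeff Q i = 0) \<and>
     (\<forall>u. u ^ m - poly Q u =
        (\<Prod>a\<leftarrow>us. u - a) * (if length us \<le> m then complete_hom (u # us) (m - length us) else 0))"
proof (induction us)
  case Nil
  then show ?case by (intro exI[of _ 0]) (simp add: complete_hom_singleton del: complete_hom.simps)
next
  case (Cons a us)
  let ?n = "length us"
  obtain Q where Q: "\<And>i. ?n \<le> i \<Longrightarrow> coeff Q i = 0"
    "\<And>u. u ^ m - poly Q u = (\<Prod>a\<leftarrow>us. u - a) * (if ?n \<le> m then complete_hom (u # us) (m - ?n) else 0)"
    using Cons.IH by blast
  define \<omega> :: "real poly" where "\<omega> = (\<Prod>a\<leftarrow>us. [:- a, 1:])"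
  have poly_\<omega>: "poly \<omega> u = (\<Prod>a\<leftarrow>us. u - a)" for u
    unfolding \<omega>_def by (induction us) (auto simp: algebra_simps)
  have deg: "degree \<omega> \<le> ?n"
    unfolding \<omega>_def
  proof (induction us)
    case (Cons b bs)
    then show ?case
      using degree_mult_le[of "[:- b, 1:]" "\<Prod>a\<leftarrow>bs. [:- a, 1:]"] by simp
  qed simp
  show ?case
  proof (cases "?n \<le> m")
    \<comment> \<open>For m below the number of nodes the remainder is already 0, and a further node
      changes nothing.\<close>
    case False
    then show ?thesis using Q by (intro exI[of _ Q]) auto
  next
    case True
    \<comment> \<open>The coefficient is the value of the remaining factor at \<open>a\<close>, so
      that subtracting the new Newton term makes the remainder vanish at \<open>a\<close>
      too.\<close>
    define Q' where "Q' = Q + smult (complete_hom (a # us) (m - ?n)) \<omega>"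
    have "coeff Q' i = 0" if "length (a # us) \<le> i" for i
      using Q(1) deg that by (auto simp: Q'_def coeff_eq_0)
    moreover have "u ^ m - poly Q' u = (\<Prod>a\<leftarrow>a # us. u - a) *
        (if length (a # us) \<le> m then complete_hom (u # a # us) (m - length (a # us)) else 0)" for u
    proof -
      have *: "u ^ m - poly Q' u = poly \<omega> u * (complete_hom (u # us) (m - ?n) - complete_hom (a # us) (m - ?n))"
        using Q(2)[of u] True by (simp add: Q'_def poly_\<omega> algebra_simps del: complete_hom.simps)
      show ?thesis
      proof (cases "m - ?n")
        case 0
        then show ?thesis using * True by (simp add: poly_\<omega> del: complete_hom.simps)
      next
        case (Suc j)
        then show ?thesis
          using * True complete_hom_diff[of u us j a]
          by (simp add: poly_\<omega> Suc_diff_Suc algebra_simps del: complete_hom.simps)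
             (metis Suc_diff_Suc Suc_inject complete_hom_diff Suc_leI diff_is_0_eq' nat.distinct(1) not_le zero_less_Suc)
      qed
    qed
    ultimately show ?thesis by blast
  qed
qed

text \<open>The interpolant in r^2 times r^k lies in the span on which the formula is exact and
  agrees with the monomial at the nodes. The error is thus a pure integral of the interpolation
  remainder, and weights of any sign drop out. For m \<le> N the bound is 0, as exactness
  demands.\<close>

lemma quadrature_monomial_error:
  assumes fin: "finite_measure \<nu>" and sets: "sets \<nu> = sets borel"
    and b: "0 < b" "b < 1" and quad: "interpolatory_quadrature N k b \<nu> t w"
  shows "\<bar>(LINT r:{0..b}|\<nu>. r ^ (k + 2 * m)) - (\<Sum>j\<le>N. w j * t j ^ (k + 2 * m))\<bar>
     \<le> (if Suc N \<le> m then complete_hom (replicate (N + 2) (b\<^sup>2)) (m - Suc N) else 0) * (LINT r:{0..b}|\<nu>. r ^ k)"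
proof -
  interpret finite_measure \<nu> by fact
  have t: "t j \<in> {0..b}" if "j \<le> N" for j
    using quad that by (auto simp: interpolatory_quadrature_def)
  define us where "us = map (\<lambda>j. (t j)\<^sup>2) [0..<Suc N]"
  have len: "length us = Suc N" by (simp add: us_def)
  define e where "e = (if Suc N \<le> m then complete_hom (replicate (N + 2) (b\<^sup>2)) (m - Suc N) else 0)"
  obtain Q where Q: "\<And>i. Suc N \<le> i \<Longrightarrow> coeff Q i = 0"
    "\<And>u. u ^ m - poly Q u = (\<Prod>a\<leftarrow>us. u - a) * (if Suc N \<le> m then complete_hom (u # us) (m - Suc N) else 0)"
    using power_interpolation[of us m] unfolding len by blast
  define q where "q r = r ^ k * poly Q (r\<^sup>2)" for r :: real
  have poly_Q: "poly Q x = (\<Sum>j\<le>N. coeff Q j * x ^ j)" for x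
  proof -
    have "degree Q \<le> N" using Q(1) by (intro degree_le) auto
    then show ?thesis
      unfolding poly_altdef by (intro sum.mono_neutral_left) (auto simp: coeff_eq_0)
  qed
  have q_eq: "q = (\<lambda>r. \<Sum>j\<le>N. coeff Q j * r ^ (k + 2 * j))"
    by (auto simp: q_def poly_Q sum_distrib_left power_add power_mult power2_eq_square power_mult_distrib fun_eq_iff mult_ac)
  have q_eq': "q = (\<Sum>j\<le>N. (\<lambda>x. coeff Q j * x ^ (k + 2 * j)))"
    unfolding q_eq by (rule ext) (induction N; simp)
  have "q \<in> fun_span ((\<lambda>j r. r ^ (k + 2 * j)) ` {..N})"
    unfolding q_eq'
    by (intro fun_space.span_sum fun_space.span_scale[where x = "\<lambda>x. x ^ _"] fun_space.span_base) auto
  then have int_q: "(LINT r:{0..b}|\<nu>. q r) = (\<Sum>j\<le>N. w j * q (t j))"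
    using quad unfolding interpolatory_quadrature_def by blast
  have "poly Q ((t j)\<^sup>2) = ((t j)\<^sup>2) ^ m" if "j \<le> N" for j
  proof -
    have "(t j)\<^sup>2 \<in> set us"
      using that unfolding us_def set_map by (intro imageI) auto
    then have "(\<Prod>a\<leftarrow>us. (t j)\<^sup>2 - a) = 0"
      by (force simp: prod_list_zero_iff)
    then show ?thesis using Q(2)[of "(t j)\<^sup>2"] by simp
  qed
  then have nodes: "(\<Sum>j\<le>N. w j * q (t j)) = (\<Sum>j\<le>N. w j * t j ^ (k + 2 * m))"
    by (intro sum.cong) (auto simp: q_def power_add power_mult)
  have bound: "\<bar>r ^ (k + 2 * m) - q r\<bar> \<le> e * r ^ k" if r: "r \<in> {0..b}" for r
  proof -
    have "r\<^sup>2 \<le> b\<^sup>2" "b\<^sup>2 \<le> 1"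
      using r b by (auto intro!: power_mono power_le_one)
    have us: "a \<in> set us \<Longrightarrow> 0 \<le> a \<and> a \<le> b\<^sup>2" for a
      using t by (auto simp: us_def less_Suc_eq_le intro!: power_mono)
    \<comment> \<open>Both r^2 and the squared nodes lie in [0, b^2], inside [0, 1], so every factor
      has modulus at most 1.\<close>
    have prod: "\<bar>\<Prod>a\<leftarrow>us. r\<^sup>2 - a\<bar> \<le> 1"
    proof -
      have "\<bar>r\<^sup>2 - a\<bar> \<le> 1" if "a \<in> set us" for a
        using us[OF that] \<open>r\<^sup>2 \<le> b\<^sup>2\<close> \<open>b\<^sup>2 \<le> 1\<close> zero_le_power2[of r] by linarith
      then show ?thesis
      proof (induction us)
        case (Cons a us)
        then have "\<bar>r\<^sup>2 - a\<bar> * \<bar>\<Prod>a\<leftarrow>us. r\<^sup>2 - a\<bar> \<le> 1 * 1"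
          by (intro mult_mono) auto
        then show ?case by (simp add: abs_mult)
      qed simp
    qed
    have "complete_hom (r\<^sup>2 # us) (m - Suc N) \<le> complete_hom (replicate (length (r\<^sup>2 # us)) (b\<^sup>2)) (m - Suc N)"
      using us \<open>r\<^sup>2 \<le> b\<^sup>2\<close> by (intro complete_hom_le_replicate) auto
    then have le: "complete_hom (r\<^sup>2 # us) (m - Suc N) \<le> complete_hom (replicate (N + 2) (b\<^sup>2)) (m - Suc N)"
      unfolding length_Cons len by simp
    have nn: "0 \<le> complete_hom (r\<^sup>2 # us) (m - Suc N)"
      using us by (intro complete_hom_nonneg) auto
    have "\<bar>r ^ (k + 2 * m) - q r\<bar> = r ^ k * \<bar>(r\<^sup>2) ^ m - poly Q (r\<^sup>2)\<bar>"
    proof -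
      have "r ^ (k + 2 * m) - q r = r ^ k * ((r\<^sup>2) ^ m - poly Q (r\<^sup>2))"
        by (simp add: q_def power_add power_even_eq algebra_simps flip: power_mult)
      then show ?thesis using r by (simp add: abs_mult)
    qed
    moreover have "\<bar>(r\<^sup>2) ^ m - poly Q (r\<^sup>2)\<bar> \<le> 1 * e"
      unfolding Q(2) abs_mult using le nn prod
      by (intro mult_mono) (auto simp: e_def simp del: complete_hom.simps)
    ultimately show ?thesis
      using r mult_left_mono[of "\<bar>(r\<^sup>2) ^ m - poly Q (r\<^sup>2)\<bar>" e "r ^ k"] by (simp add: mult.commute)
  qed
  have int: "set_integrable \<nu> {0..b} h" if "continuous_on {0..b} h" for h :: "real \<Rightarrow> real"
  proof -
    have c: "compact (h ` {0..b})" by (intro compact_continuous_image that) auto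
    then obtain K where K: "\<And>x. x \<in> {0..b} \<Longrightarrow> \<bar>h x\<bar> \<le> K"
      using compact_imp_bounded[OF c] unfolding bounded_iff ball_simps real_norm_def by blast
    have "(\<lambda>x. indicator {0..b} x *\<^sub>R h x) \<in> borel_measurable borel"
      by (intro borel_measurable_continuous_on_indicator that) auto
    then have "(\<lambda>x. indicator {0..b} x *\<^sub>R h x) \<in> borel_measurable \<nu>"
      using sets measurable_cong_sets by blast
    then show ?thesis
      unfolding set_integrable_def
      by (intro integrable_const_bound[where B = "max K 0"])
         (auto simp: indicator_def intro!: AE_I2 max.coboundedI1 K)
  qed
  have cq: "continuous_on {0..b} q" unfolding q_eq by (intro continuous_intros)
  have "(LINT r:{0..b}|\<nu>. r ^ (k + 2 * m)) - (\<Sum>j\<le>N. w j * t j ^ (k + 2 * m))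
      = (LINT r:{0..b}|\<nu>. r ^ (k + 2 * m) - q r)"
    unfolding nodes[symmetric] int_q[symmetric]
    by (intro set_integral_diff(2)[symmetric] int cq continuous_intros)
  also have "\<bar>\<dots>\<bar> \<le> (LINT r:{0..b}|\<nu>. \<bar>r ^ (k + 2 * m) - q r\<bar>)"
  proof -
    have "continuous_on {0..b} (\<lambda>r. r ^ (k + 2 * m) - q r)"
      by (intro continuous_intros cq)
    from set_integral_norm_bound[OF int[OF this]] show ?thesis by simp
  qed
  also have "\<dots> \<le> (LINT r:{0..b}|\<nu>. e * r ^ k)"
    using cq bound by (intro set_integral_mono int continuous_intros) auto
  also have "\<dots> = e * (LINT r:{0..b}|\<nu>. r ^ k)"
    by simp
  finally show ?thesis unfolding e_def .
qed


text \<open>The errors of the monomials are summed against the coefficients. The exponent N + 2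
  counts the N + 1 nodes and the point of evaluation.\<close>

lemma quadrature_series_error:
  fixes c :: "nat \<Rightarrow> complex" and F :: "real \<Rightarrow> complex"
  assumes fin: "finite_measure \<nu>" and sets: "sets \<nu> = sets borel"
    and b: "0 < b" "b < 1" and quad: "interpolatory_quadrature N k b \<nu> t w"
    and c: "\<And>m. cmod (c m) \<le> H"
    and F: "\<And>r. r \<in> {0..b} \<Longrightarrow> (\<lambda>m. c m * of_real (r ^ (k + 2 * m))) sums F r"
  shows "cmod ((LINT r:{0..b}|\<nu>. F r) - (\<Sum>j\<le>N. of_real (w j) * F (t j)))
     \<le> 1 / (1 - b\<^sup>2) ^ (N + 2) * H * (LINT r:{0..b}|\<nu>. r ^ k)"
proof -
  interpret finite_measure \<nu> by fact
  have t: "t j \<in> {0..b}" if "j \<le> N" for j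
    using quad that by (auto simp: interpolatory_quadrature_def)
  have H: "0 \<le> H" using c[of 0] norm_ge_zero order_trans by blast
  have b2: "0 \<le> b\<^sup>2" "b\<^sup>2 < 1" using b by (auto simp: power_less_one_iff)
  have int: "set_integrable \<nu> {0..b} (\<lambda>r. r ^ m)" for m :: nat
  proof -
    have "(\<lambda>x. indicator {0..b} x *\<^sub>R x ^ m) \<in> borel_measurable borel"
      by (intro borel_measurable_continuous_on_indicator continuous_intros) auto
    then have "(\<lambda>x. indicator {0..b} x *\<^sub>R x ^ m) \<in> borel_measurable \<nu>"
      using sets measurable_cong_sets by blast
    then show ?thesis
      unfolding set_integrable_def using b
      by (intro integrable_const_bound[where B = 1])
         (auto simp: indicator_def power_le_one intro!: AE_I2)
  qed
  define I where "I m = (LINT r:{0..b}|\<nu>. r ^ m)" for m :: nat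
  have I_nonneg: "0 \<le> I m" for m
    unfolding I_def set_lebesgue_integral_def by (intro integral_nonneg_AE) (auto simp: indicator_def)
  have geo: "summable (\<lambda>m. (b\<^sup>2) ^ m)" using b2 by (intro summable_geometric) auto
  have I_le: "I (k + 2 * m) \<le> (b\<^sup>2) ^ m * I k" for m
  proof -
    have "I (k + 2 * m) \<le> (LINT r:{0..b}|\<nu>. (b\<^sup>2) ^ m * r ^ k)"
      unfolding I_def
    proof (intro set_integral_mono int)
      show "set_integrable \<nu> {0..b} (\<lambda>r. (b\<^sup>2) ^ m * r ^ k)"
        using int by simp
      fix r assume r: "r \<in> {0..b}"
      then have "(r\<^sup>2) ^ m \<le> (b\<^sup>2) ^ m" by (intro power_mono) auto
      then show "r ^ (k + 2 * m) \<le> (b\<^sup>2) ^ m * r ^ k"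
        using r by (simp only: power_add power_mult mult.commute[of "r ^ k"]) (intro mult_right_mono, auto)
    qed
    then show ?thesis by (simp add: I_def)
  qed
  have "(\<lambda>m. \<integral>r. indicator {0..b} r *\<^sub>R (c m * of_real (r ^ (k + 2 * m))) \<partial>\<nu>) sums
      (\<integral>r. (\<Sum>m. indicator {0..b} r *\<^sub>R (c m * of_real (r ^ (k + 2 * m)))) \<partial>\<nu>)"
  proof (rule sums_integral)
    show *: "integrable \<nu> (\<lambda>r. indicator {0..b} r *\<^sub>R (c m * of_real (r ^ (k + 2 * m))))" for m
    proof -
      have "integrable \<nu> (\<lambda>r. c m * of_real (indicator {0..b} r *\<^sub>R r ^ (k + 2 * m)))"
        using int[of "k + 2 * m"] unfolding set_integrable_def
        by (intro integrable_mult_right integrable_of_real) auto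
      then show ?thesis by (simp add: scaleR_conv_of_real mult_ac)
    qed
    \<comment> \<open>On [0, b] the terms are dominated by a geometric series independent of r; with
      finite \<nu> this permits integration term by term.\<close>
    have bd: "norm (indicator {0..b} r *\<^sub>R (c m * of_real (r ^ (k + 2 * m)))) \<le> H * (b\<^sup>2) ^ m" for r m
    proof (cases "r \<in> {0..b}")
      case True
      then have "r ^ k * (r\<^sup>2) ^ m \<le> 1 * (b\<^sup>2) ^ m"
        using b by (intro mult_mono power_mono power_le_one) auto
      then have "cmod (c m) * (r ^ k * (r\<^sup>2) ^ m) \<le> H * (b\<^sup>2) ^ m"
        using c[of m] H True by (intro mult_mono) auto
      then show ?thesis using True
        by (simp add: norm_mult norm_power power_add power_mult)
    qed (use H in auto)
    show "AE r in \<nu>. summable (\<lambda>m. norm (indicator {0..b} r *\<^sub>R (c m * of_real (r ^ (k + 2 * m)))))"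
      using bd by (intro AE_I2 summable_comparison_test'[OF summable_mult[OF geo, of H], of 0]) auto
    show "summable (\<lambda>m. \<integral>r. norm (indicator {0..b} r *\<^sub>R (c m * of_real (r ^ (k + 2 * m)))) \<partial>\<nu>)"
    proof (rule summable_comparison_test'[OF summable_mult2[OF summable_mult[OF geo, of H], of "measure \<nu> (space \<nu>)"], of 0])
      fix m :: nat
      have "(\<integral>r. norm (indicator {0..b} r *\<^sub>R (c m * of_real (r ^ (k + 2 * m)))) \<partial>\<nu>)
          \<le> (\<integral>r. H * (b\<^sup>2) ^ m \<partial>\<nu>)"
        using bd by (intro integral_mono integrable_norm *) auto
      then show "norm (\<integral>r. norm (indicator {0..b} r *\<^sub>R (c m * of_real (r ^ (k + 2 * m)))) \<partial>\<nu>)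
          \<le> H * (b\<^sup>2) ^ m * measure \<nu> (space \<nu>)"
        by (simp add: integral_nonneg_AE mult_ac)
    qed
  qed
  also have "(\<lambda>m. \<integral>r. indicator {0..b} r *\<^sub>R (c m * of_real (r ^ (k + 2 * m))) \<partial>\<nu>)
      = (\<lambda>m. c m * of_real (I (k + 2 * m)))"
  proof
    fix m
    have "(\<integral>r. indicator {0..b} r *\<^sub>R (c m * of_real (r ^ (k + 2 * m))) \<partial>\<nu>)
        = (\<integral>r. c m * of_real (indicator {0..b} r *\<^sub>R r ^ (k + 2 * m)) \<partial>\<nu>)"
      by (intro Bochner_Integration.integral_cong) (auto simp: scaleR_conv_of_real mult_ac)
    then show "(\<integral>r. indicator {0..b} r *\<^sub>R (c m * of_real (r ^ (k + 2 * m))) \<partial>\<nu>)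
        = c m * of_real (I (k + 2 * m))"
      by (simp add: I_def set_lebesgue_integral_def flip: integral_complex_of_real)
  qed
  also have "(\<integral>r. (\<Sum>m. indicator {0..b} r *\<^sub>R (c m * of_real (r ^ (k + 2 * m)))) \<partial>\<nu>)
      = (LINT r:{0..b}|\<nu>. F r)"
    unfolding set_lebesgue_integral_def
    using F by (intro Bochner_Integration.integral_cong) (auto simp: sums_iff indicator_def)
  finally have s1: "(\<lambda>m. c m * of_real (I (k + 2 * m))) sums (LINT r:{0..b}|\<nu>. F r)" .
  have "(\<lambda>m. \<Sum>j\<le>N. of_real (w j) * (c m * of_real (t j ^ (k + 2 * m)))) sums (\<Sum>j\<le>N. of_real (w j) * F (t j))"
    using F t by (intro sums_sum sums_mult) auto
  from sums_diff[OF s1 this]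
  have s: "(\<lambda>m. c m * of_real (I (k + 2 * m) - (\<Sum>j\<le>N. w j * t j ^ (k + 2 * m)))) sums
      ((LINT r:{0..b}|\<nu>. F r) - (\<Sum>j\<le>N. of_real (w j) * F (t j)))"
    by (simp add: algebra_simps sum_distrib_left)
  define e where "e m = (if Suc N \<le> m then complete_hom (replicate (N + 2) (b\<^sup>2)) (m - Suc N) else 0)" for m
  have "complete_hom (replicate (N + 2) (b\<^sup>2)) sums (\<Prod>a\<leftarrow>replicate (N + 2) (b\<^sup>2). 1 / (1 - a))"
    using b2 by (intro complete_hom_sums) auto
  then have "complete_hom (replicate (N + 2) (b\<^sup>2)) sums (1 / (1 - b\<^sup>2) ^ (N + 2))"
    by (simp only: map_replicate prod_list_replicate power_one_over)
  \<comment> \<open>The first N + 1 errors are 0, so shifting the index leaves the sum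
    unchanged.\<close>
  then have "(\<lambda>m. e (m + Suc N)) sums (1 / (1 - b\<^sup>2) ^ (N + 2))"
    by (simp add: e_def del: replicate.simps add_2_eq_Suc' complete_hom.simps)
  then have e_sums: "e sums (1 / (1 - b\<^sup>2) ^ (N + 2))"
    by (subst (asm) sums_iff_shift) (simp add: e_def)
  have term_le: "norm (c m * of_real (I (k + 2 * m) - (\<Sum>j\<le>N. w j * t j ^ (k + 2 * m)))) \<le> e m * (H * I k)" for m
  proof -
    have "\<bar>I (k + 2 * m) - (\<Sum>j\<le>N. w j * t j ^ (k + 2 * m))\<bar> \<le> e m * I k"
      using quadrature_monomial_error[OF fin sets b quad] unfolding I_def e_def .
    then have "cmod (c m) * \<bar>I (k + 2 * m) - (\<Sum>j\<le>N. w j * t j ^ (k + 2 * m))\<bar> \<le> H * (e m * I k)"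
      using c H by (intro mult_mono) auto
    then show ?thesis by (simp add: norm_mult mult_ac del: of_real_diff of_real_sum)
  qed
  have "(\<lambda>m. e m * (H * I k)) sums (1 / (1 - b\<^sup>2) ^ (N + 2) * (H * I k))"
    by (intro sums_mult2 e_sums)
  then have "norm (\<Sum>m. c m * of_real (I (k + 2 * m) - (\<Sum>j\<le>N. w j * t j ^ (k + 2 * m))))
      \<le> 1 / (1 - b\<^sup>2) ^ (N + 2) * (H * I k)"
    using norm_suminf_le[of _ "\<lambda>m. e m * (H * I k)", OF term_le] by (auto simp: sums_iff)
  then show ?thesis
    using s by (simp add: sums_iff I_def mult_ac)
qed

section \<open>Signed measures\<close>

lemma signed_measure_uminus: "signed_measure M \<mu> \<Longrightarrow> signed_measure M (\<lambda>A. - \<mu> A)"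
  by (auto simp: signed_measure_def intro: sums_minus)

text \<open>A set of infinite variation has a part whose measure is so large that the complementary
  part also has measure of modulus at least 1. One of the two keeps infinite variation; the other is
  removed.\<close>

lemma upper_variation_infinite_split:
  assumes \<mu>: "signed_measure M \<mu>" and E: "E \<in> sets M" "emeasure (upper_variation M \<mu>) E = \<infinity>"
  shows "\<exists>E'\<in>sets M. E' \<subseteq> E \<and> emeasure (upper_variation M \<mu>) E' = \<infinity> \<and> 1 \<le> \<bar>\<mu> (E - E')\<bar>"
proof -
  \<comment> \<open>The threshold makes both differences large: \<mu> of A exceeds 1, and \<mu> of E
    - A is then less than -1.\<close>
  have "ennreal (1 + \<bar>\<mu> E\<bar>) < (SUP A\<in>{A \<in> sets M. A \<subseteq> E}. ennreal (\<mu> A))"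
    using E emeasure_upper_variation[OF \<mu> E(1)] by (metis ennreal_less_top infinity_ennreal_def)
  then obtain A where A: "A \<in> sets M" "A \<subseteq> E" "ennreal (1 + \<bar>\<mu> E\<bar>) < ennreal (\<mu> A)"
    unfolding less_SUP_iff by blast
  have \<mu>A: "1 + \<bar>\<mu> E\<bar> < \<mu> A"
    using A(3) by (subst (asm) ennreal_less_iff) auto
  have "\<mu> (A \<union> (E - A)) = \<mu> A + \<mu> (E - A)"
    using A E by (intro signed_measure_Un[OF \<mu>]) auto
  moreover have "A \<union> (E - A) = E" using A by auto
  ultimately have \<mu>EA: "\<mu> E = \<mu> A + \<mu> (E - A)" by simp
  have "emeasure (upper_variation M \<mu>) A + emeasure (upper_variation M \<mu>) (E - A) = \<infinity>"
    using A E plus_emeasure[of A "upper_variation M \<mu>" "E - A"] \<open>A \<union> (E - A) = E\<close> by simp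
  then consider "emeasure (upper_variation M \<mu>) A = \<infinity>" | "emeasure (upper_variation M \<mu>) (E - A) = \<infinity>"
    by (auto simp: ennreal_add_eq_top)
  then show ?thesis
  proof cases
    case 1
    then show ?thesis using A \<mu>A \<mu>EA by (intro bexI[of _ A]) auto
  next
    case 2
    have "E - (E - A) = A" using A by auto
    then show ?thesis using 2 A E \<mu>A by (intro bexI[of _ "E - A"]) auto
  qed
qed

text \<open>Otherwise repeated splitting produces disjoint differences of a decreasing sequence,
  each with measure of modulus at least 1. Countable additivity with real values would make the
  series of these measures converge.\<close>

lemma finite_measure_upper_variation:
  assumes \<mu>: "signed_measure M \<mu>"
  shows "finite_measure (upper_variation M \<mu>)"
proof (rule finite_measureI, rule notI)
  assume "emeasure (upper_variation M \<mu>) (space (upper_variation M \<mu>)) = \<infinity>"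
  then have top: "emeasure (upper_variation M \<mu>) (space M) = \<infinity>" by simp
  define P where "P E \<longleftrightarrow> E \<in> sets M \<and> emeasure (upper_variation M \<mu>) E = \<infinity>" for E
  have "P E \<Longrightarrow> \<exists>E'. P E' \<and> E' \<subseteq> E \<and> 1 \<le> \<bar>\<mu> (E - E')\<bar>" for E
    using upper_variation_infinite_split[OF \<mu>] unfolding P_def by blast
  then obtain s where s: "\<And>E. P E \<Longrightarrow> P (s E) \<and> s E \<subseteq> E \<and> 1 \<le> \<bar>\<mu> (E - s E)\<bar>"
    by metis
  define S where "S n = (s ^^ n) (space M)" for n
  have PS: "P (S n)" for n
    by (induction n) (use top s in \<open>auto simp: S_def P_def\<close>)
  have S_Suc: "S (Suc n) \<subseteq> S n" "1 \<le> \<bar>\<mu> (S n - S (Suc n))\<bar>" for n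
    using s[OF PS[of n]] by (auto simp: S_def)
  have anti: "n \<le> m \<Longrightarrow> S m \<subseteq> S n" for n m
    using S_Suc(1) by (rule lift_Suc_antimono_le)
  have "disjoint_family (\<lambda>n. S n - S (Suc n))"
    unfolding disjoint_family_on_def
  proof (intro ballI impI)
    fix m n :: nat assume "m \<noteq> n"
    then show "(S m - S (Suc m)) \<inter> (S n - S (Suc n)) = {}"
      using anti[of "Suc m" n] anti[of "Suc n" m] by (cases "m < n") auto
  qed
  moreover have "range (\<lambda>n. S n - S (Suc n)) \<subseteq> sets M"
    using PS by (auto simp: P_def)
  ultimately have "(\<lambda>n. \<mu> (S n - S (Suc n))) sums \<mu> (\<Union>n. S n - S (Suc n))"
    using \<mu> unfolding signed_measure_def by blast
  then have "(\<lambda>n. \<mu> (S n - S (Suc n))) \<longlonglongrightarrow> 0"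
    by (intro summable_LIMSEQ_zero) (auto simp: sums_iff)
  then have "\<forall>\<^sub>F n in sequentially. \<bar>\<mu> (S n - S (Suc n))\<bar> < 1"
    by (auto dest!: tendstoD[where e = 1])
  then show False using S_Suc(2) by (auto simp: eventually_sequentially not_less[symmetric])
qed

text \<open>Every measurable subset of the outside of the ball has measure 0, so the supremum
  defining the variation is 0 there; no cancellation can hide mass.\<close>

lemma AE_upper_variation_supported:
  assumes \<mu>: "signed_measure (borel_Rd d) \<mu>" and supp: "supported_in_cball d b \<mu>"
    and nrm: "nrm d \<in> borel_measurable (borel_Rd d)"
  shows "AE x in upper_variation (borel_Rd d) \<mu>. nrm d x \<le> b"
proof (rule AE_I)
  let ?A = "{x \<in> space (borel_Rd d). \<not> nrm d x \<le> b}"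
  show A: "?A \<in> sets (upper_variation (borel_Rd d) \<mu>)"
    using nrm by simp
  have "\<mu> E = 0" if "E \<in> sets (borel_Rd d)" "E \<subseteq> ?A" for E
    using that supp unfolding supported_in_cball_def by (metis (no_types, lifting) mem_Collect_eq not_le subsetD)
  then show "emeasure (upper_variation (borel_Rd d) \<mu>) ?A = 0"
    using A by (subst emeasure_upper_variation[OF \<mu>]) (auto intro!: antisym SUP_least)
qed auto

section \<open>Expansions in spherical harmonics\<close>

lemma summable_power_times_poly:
  fixes r :: real
  assumes r: "0 \<le> r" "r < 1"
  shows "summable (\<lambda>k. r ^ k * real (Suc k) ^ d)"
proof -
  have "(\<lambda>k. r * (1 + inverse (real (Suc k))) ^ d) \<longlonglongrightarrow> r * (1 + 0) ^ d"
    by (intro tendsto_intros LIMSEQ_inverse_real_of_nat)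
  then have "\<forall>\<^sub>F k in sequentially. r * (1 + inverse (real (Suc k))) ^ d < (1 + r) / 2"
    using r by (intro order_tendstoD(2)) auto
  then obtain N where N: "\<And>k. k \<ge> N \<Longrightarrow> r * (1 + inverse (real (Suc k))) ^ d < (1 + r) / 2"
    by (auto simp: eventually_sequentially)
  show ?thesis
  proof (rule summable_ratio_test)
    show "(1 + r) / 2 < 1" using r by simp
    fix k assume k: "N \<le> k"
    have "1 + inverse (real (Suc k)) = real (Suc (Suc k)) / real (Suc k)"
      by (simp add: field_simps)
    then have "real (Suc (Suc k)) ^ d = (1 + inverse (real (Suc k))) ^ d * real (Suc k) ^ d"
      by (simp add: power_divide)
    then have "r ^ Suc k * real (Suc (Suc k)) ^ d = (r * (1 + inverse (real (Suc k))) ^ d) * (r ^ k * real (Suc k) ^ d)"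
      by (simp only: power_Suc mult_ac)
    also have "\<dots> \<le> (1 + r) / 2 * (r ^ k * real (Suc k) ^ d)"
      using N[OF k] r by (intro mult_right_mono) auto
    finally show "norm (r ^ Suc k * real (Suc (Suc k)) ^ d) \<le> (1 + r) / 2 * norm (r ^ k * real (Suc k) ^ d)"
      using r by simp
  qed
qed

lemma usphere_nonempty:
  assumes "0 < d"
  shows "usphere d \<noteq> {}"
proof -
  define x where "x = (\<lambda>i\<in>{..<d}. 1 :: real)"
  have "0 < nrm d x" using coord_le_nrm[OF assms, of x] assms by (simp add: x_def)
  from direction_in_usphere[OF this] show ?thesis by blast
qed

lemma direction_usphere:
  assumes "\<theta> \<in> usphere d"
  shows "direction d \<theta> = \<theta>"
  using assms by (auto simp: usphere_def direction_def space_borel_Rd PiE_iff extensional_def fun_eq_iff)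

text \<open>The direction of the origin is the zero vector. Since \<open>0 ^ 0 = 1\<close>, this
  covers both the vanishing for k \<ge> 1 and the constant for k = 0.\<close>

lemma homogeneous_direction_origin:
  assumes p: "p \<in> homogeneous_polys d k" and "nrm d x = 0"
  shows "p (direction d x) = 0 ^ k * p \<theta>"
proof -
  have "p (direction d x) = p (\<lambda>i. 0 * \<theta> i)"
    using assms by (intro polyfuns_cong[OF homogeneous_polys_polyfuns[OF p]]) (simp add: direction_def)
  then show ?thesis by (simp only: homogeneous_polys_scale[OF p])
qed

text \<open>\<open>F\<close> is the coefficient family whose existence membership in the Hardy space
  asserts; \<open>laplace_fourier_eq\<close> later identifies it on the disc with the
  Laplace-Fourier coefficients.\<close>

locale harmonic_expansion =
  fixes d :: nat and Y :: "nat \<Rightarrow> nat \<Rightarrow> (nat \<Rightarrow> real) \<Rightarrow> real"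
    and f :: "complex \<Rightarrow> (nat \<Rightarrow> real) \<Rightarrow> complex" and F :: "nat \<Rightarrow> nat \<Rightarrow> complex \<Rightarrow> complex"
  assumes d: "0 < d" and Y: "harmonic_basis d Y"
    and F: "\<And>k l. l \<in> {1..harm_dim d k} \<Longrightarrow> \<exists>g\<in>hardy_space. \<forall>z\<in>ball 0 1. F k l z = g (z\<^sup>2) * z ^ k"
    and F_summable: "summable (\<lambda>k. \<Sum>l=1..harm_dim d k. (hardy_norm (F k l))\<^sup>2)"
    and f_sums: "\<And>z \<theta>. z \<in> ball 0 1 \<Longrightarrow> \<theta> \<in> usphere d \<Longrightarrow>
      (\<lambda>k. \<Sum>l=1..harm_dim d k. F k l z * complex_of_real (Y k l \<theta>)) sums f z \<theta>"
begin

abbreviation L :: "nat \<Rightarrow> nat set" where "L k \<equiv> {1..harm_dim d k}"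

lemma coefficient_series:
  assumes "l \<in> L k"
  obtains c where "\<And>m. cmod (c m) \<le> hardy_norm (F k l)"
    and "\<And>z. z \<in> ball 0 1 \<Longrightarrow> (\<lambda>m. c m * z ^ (k + 2 * m)) sums F k l z"
proof -
  obtain g where g: "g \<in> hardy_space" "\<forall>z\<in>ball 0 1. F k l z = g (z\<^sup>2) * z ^ k"
    using F[OF assms] by (elim bexE)
  show thesis
    by (rule hardy_coefficients[OF g(1), of "F k l" k], rule bspec[OF g(2)], assumption, rule that)
qed

lemma hardy_norm_nonneg: "l \<in> L k \<Longrightarrow> 0 \<le> hardy_norm (F k l)"
  by (rule coefficient_series[of l k], assumption) (metis norm_ge_zero order_trans)

text \<open>The coefficient series starts at z^k and is dominated by a geometric series in r^2. The
  factor r^k is what defeats the polynomial growth of the harmonics.\<close>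

lemma coefficient_bound:
  assumes l: "l \<in> L k" and z: "cmod z \<le> r" "r < 1"
  shows "cmod (F k l z) \<le> hardy_norm (F k l) * (r ^ k / (1 - r\<^sup>2))"
proof -
  have r: "0 \<le> r" using z norm_ge_zero order_trans by blast
  obtain c where c: "\<And>m. cmod (c m) \<le> hardy_norm (F k l)"
    "\<And>z. z \<in> ball 0 1 \<Longrightarrow> (\<lambda>m. c m * z ^ (k + 2 * m)) sums F k l z"
    by (rule coefficient_series[OF l], rule that)
  have r2: "norm (r\<^sup>2) < 1" using r z by (simp add: power_less_one_iff)
  have "(\<lambda>m. (r\<^sup>2) ^ m) sums (1 / (1 - r\<^sup>2))"
    by (rule geometric_sums[OF r2])
  then have s: "(\<lambda>m. hardy_norm (F k l) * r ^ k * (r\<^sup>2) ^ m) sums (hardy_norm (F k l) * r ^ k * (1 / (1 - r\<^sup>2)))"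
    by (rule sums_mult)
  have "norm (c m * z ^ (k + 2 * m)) \<le> hardy_norm (F k l) * r ^ k * (r\<^sup>2) ^ m" for m
  proof -
    have "cmod (c m) * cmod z ^ (k + 2 * m) \<le> hardy_norm (F k l) * r ^ (k + 2 * m)"
      using z by (intro mult_mono c(1) power_mono hardy_norm_nonneg[OF l]) auto
    then show ?thesis by (simp add: norm_mult norm_power power_add power_mult mult.assoc)
  qed
  then have "norm (\<Sum>m. c m * z ^ (k + 2 * m)) \<le> (\<Sum>m. hardy_norm (F k l) * r ^ k * (r\<^sup>2) ^ m)"
    by (rule norm_suminf_le) (rule sums_summable[OF s])
  moreover have "z \<in> ball 0 1" using z by simp
  ultimately show ?thesis
    using sums_unique[OF s] sums_unique[OF c(2)[of z]] by simp
qed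

text \<open>Products are bounded by sums of squares. The squared norms of a layer are at most their
  total sum \<open>T\<close>, and the squared harmonics are controlled by
  \<open>harmonic_basis_bound\<close>. At the origin the layer is compared with an arbitrary point
  of the sphere.\<close>

lemma angular_bound:
  obtains C where "0 \<le> C"
    and "\<And>k x. (\<Sum>l\<in>L k. hardy_norm (F k l) * \<bar>Y k l (direction d x)\<bar>) \<le> C * real (Suc k) ^ d"
proof -
  obtain K where K: "0 \<le> K" "\<And>k \<theta>. \<theta> \<in> usphere d \<Longrightarrow> (\<Sum>l\<in>L k. (Y k l \<theta>)\<^sup>2) \<le> K * real (Suc k) ^ d"
    by (rule harmonic_basis_bound[OF d Y], rule that)
  define T where "T = (\<Sum>k. \<Sum>l\<in>L k. (hardy_norm (F k l))\<^sup>2)"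
  have T: "(\<Sum>l\<in>L k. (hardy_norm (F k l))\<^sup>2) \<le> T" for k
  proof -
    have "(\<Sum>k\<in>{k}. \<Sum>l\<in>L k. (hardy_norm (F k l))\<^sup>2) \<le> T"
      unfolding T_def by (rule sum_le_suminf[OF F_summable]) (auto intro: sum_nonneg)
    then show ?thesis by simp
  qed
  have T_nonneg: "0 \<le> T" using T[of 0] by (rule order_trans[rotated]) (intro sum_nonneg, simp)
  have sphere: "(\<Sum>l\<in>L k. hardy_norm (F k l) * \<bar>Y k l \<theta>\<bar>) \<le> (T + K) * real (Suc k) ^ d" if \<theta>: "\<theta> \<in> usphere d" for k \<theta>
  proof -
    have one: "1 \<le> real (Suc k) ^ d" by (intro one_le_power) simp
    have "hardy_norm (F k l) * \<bar>Y k l \<theta>\<bar> \<le> (hardy_norm (F k l))\<^sup>2 + (Y k l \<theta>)\<^sup>2" if "l \<in> L k" for l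
    proof -
      have "2 * hardy_norm (F k l) * \<bar>Y k l \<theta>\<bar> \<le> (hardy_norm (F k l))\<^sup>2 + (Y k l \<theta>)\<^sup>2"
        using sum_squares_bound[of "hardy_norm (F k l)" "\<bar>Y k l \<theta>\<bar>"] by simp
      moreover have "0 \<le> hardy_norm (F k l) * \<bar>Y k l \<theta>\<bar>"
        by (intro mult_nonneg_nonneg hardy_norm_nonneg that) simp
      ultimately show ?thesis by linarith
    qed
    then have "(\<Sum>l\<in>L k. hardy_norm (F k l) * \<bar>Y k l \<theta>\<bar>) \<le> (\<Sum>l\<in>L k. (hardy_norm (F k l))\<^sup>2 + (Y k l \<theta>)\<^sup>2)"
      by (rule sum_mono)
    also have "\<dots> \<le> T + K * real (Suc k) ^ d"
      unfolding sum.distrib by (intro add_mono T K(2) \<theta>)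
    also have "T \<le> T * real (Suc k) ^ d"
      using mult_left_mono[OF one T_nonneg] by simp
    finally show ?thesis by (simp add: algebra_simps)
  qed
  obtain \<theta>\<^sub>0 where \<theta>\<^sub>0: "\<theta>\<^sub>0 \<in> usphere d" using usphere_nonempty[OF d] by blast
  have "(\<Sum>l\<in>L k. hardy_norm (F k l) * \<bar>Y k l (direction d x)\<bar>) \<le> (T + K) * real (Suc k) ^ d" for k x
  proof (cases "nrm d x = 0")
    case False
    then have "0 < nrm d x" using nrm_nonneg[of d x] by simp
    then show ?thesis by (intro sphere direction_in_usphere)
  next
    case True
    have "hardy_norm (F k l) * \<bar>Y k l (direction d x)\<bar> \<le> hardy_norm (F k l) * \<bar>Y k l \<theta>\<^sub>0\<bar>" if l: "l \<in> L k" for l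
    proof -
      have "Y k l (direction d x) = 0 ^ k * Y k l \<theta>\<^sub>0"
        by (intro homogeneous_direction_origin harmonic_polysD(1)[OF harmonic_basisD(1)[OF Y l]] True)
      then have "\<bar>Y k l (direction d x)\<bar> \<le> \<bar>Y k l \<theta>\<^sub>0\<bar>" by (simp add: power_0_left)
      then show ?thesis by (intro mult_left_mono hardy_norm_nonneg l)
    qed
    then show ?thesis
      by (rule order_trans[OF sum_mono sphere[OF \<theta>\<^sub>0]])
  qed
  moreover have "0 \<le> T + K" using T_nonneg K(1) by simp
  ultimately show thesis by (rule that[rotated])
qed

text \<open>Provides one summable majorant, uniform in z and x, for the exchanges of sum and
  integral below; the moments need the version with Hardy norms.\<close>

lemma layer_bound:
  assumes r: "r < 1"
  obtains B where "summable B" and "\<And>k. 0 \<le> B k"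
    and "\<And>k x. 0 \<le> r \<Longrightarrow> r ^ k * (\<Sum>l\<in>L k. hardy_norm (F k l) * \<bar>Y k l (direction d x)\<bar>) \<le> B k"
    and "\<And>k z x. cmod z \<le> r \<Longrightarrow> (\<Sum>l\<in>L k. cmod (F k l z * complex_of_real (Y k l (direction d x)))) \<le> B k"
proof -
  obtain C where C: "0 \<le> C"
    "\<And>k x. (\<Sum>l\<in>L k. hardy_norm (F k l) * \<bar>Y k l (direction d x)\<bar>) \<le> C * real (Suc k) ^ d"
    by (rule angular_bound, rule that)
  \<comment> \<open>For negative \<open>r\<close> both estimates are vacuous; replacing it by 0
    keeps the majorant nonnegative and summable.\<close>
  define q where "q = max 0 r"
  have q: "0 \<le> q" "q < 1" "r \<le> q" using r by (auto simp: q_def)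
  have q2: "0 < 1 - q\<^sup>2" using q by (simp add: power_less_one_iff)
  have q3: "1 \<le> 1 / (1 - q\<^sup>2)" using q2 by simp
  define B where "B k = C / (1 - q\<^sup>2) * (q ^ k * real (Suc k) ^ d)" for k
  show thesis
  proof (rule that[of B])
    show "summable B"
      unfolding B_def by (intro summable_mult summable_power_times_poly q)
    show "0 \<le> B k" for k
      unfolding B_def using C(1) q q2 by (intro mult_nonneg_nonneg divide_nonneg_nonneg) auto
    show "(\<Sum>l\<in>L k. cmod (F k l z * complex_of_real (Y k l (direction d x)))) \<le> B k" if z: "cmod z \<le> r" for k z x
    proof -
      have zq: "cmod z \<le> q" using z q by simp
      have "cmod (F k l z * complex_of_real (Y k l (direction d x)))
          \<le> q ^ k / (1 - q\<^sup>2) * (hardy_norm (F k l) * \<bar>Y k l (direction d x)\<bar>)" if "l \<in> L k" for l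
        using mult_right_mono[OF coefficient_bound[OF that zq q(2)], of "\<bar>Y k l (direction d x)\<bar>"]
        by (simp add: norm_mult mult_ac)
      then have "(\<Sum>l\<in>L k. cmod (F k l z * complex_of_real (Y k l (direction d x))))
          \<le> q ^ k / (1 - q\<^sup>2) * (\<Sum>l\<in>L k. hardy_norm (F k l) * \<bar>Y k l (direction d x)\<bar>)"
        unfolding sum_distrib_left by (rule sum_mono)
      also have "\<dots> \<le> q ^ k / (1 - q\<^sup>2) * (C * real (Suc k) ^ d)"
        using q q2 by (intro mult_left_mono C(2)) auto
      finally show ?thesis by (simp add: B_def mult_ac)
    qed
    show "r ^ k * (\<Sum>l\<in>L k. hardy_norm (F k l) * \<bar>Y k l (direction d x)\<bar>) \<le> B k" if "0 \<le> r" for k x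
    proof -
      have "r ^ k * (\<Sum>l\<in>L k. hardy_norm (F k l) * \<bar>Y k l (direction d x)\<bar>) \<le> q ^ k * (C * real (Suc k) ^ d)"
        using that q by (intro mult_mono C(2) power_mono) (auto intro!: sum_nonneg mult_nonneg_nonneg hardy_norm_nonneg)
      also have "\<dots> \<le> 1 / (1 - q\<^sup>2) * (q ^ k * (C * real (Suc k) ^ d))"
        using mult_right_mono[OF q3, of "q ^ k * (C * real (Suc k) ^ d)"] q C(1) by simp
      finally show ?thesis by (simp add: B_def mult_ac)
    qed
  qed
qed

text \<open>The expansion is integrated term by term against one harmonic. Different degrees vanish
  by \<open>sphere_orthogonal\<close>, and orthonormality within degree k leaves a single
  coefficient.\<close>

lemma laplace_fourier_eq:
  assumes l: "l \<in> L k" and z: "z \<in> ball 0 1"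
  shows "laplace_fourier d Y f k l z = F k l z"
proof -
  interpret S: finite_measure "sphere_measure d" by (rule finite_measure_sphere)
  define u where "u m \<theta> = (\<Sum>j\<in>L m. F m j z * complex_of_real (Y m j \<theta>)) * complex_of_real (Y k l \<theta>)" for m \<theta>
  obtain B where B: "summable B" "\<And>k. 0 \<le> B k"
    "\<And>k x. (\<Sum>l\<in>L k. cmod (F k l z * complex_of_real (Y k l (direction d x)))) \<le> B k"
    using z by (auto intro: layer_bound[of "cmod z"])
  obtain K where K: "\<forall>x. nrm d x \<le> 1 \<longrightarrow> \<bar>Y k l x\<bar> \<le> K"
    using polyfuns_bounded[OF harmonic_basis_polyfuns[OF Y l]] by (elim exE)
  have bound: "norm (u m \<theta>) \<le> B m * K" if \<theta>: "\<theta> \<in> space (sphere_measure d)" for m \<theta>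
  proof -
    have S: "\<theta> \<in> usphere d" using \<theta> by (simp add: space_sphere_measure)
    have "cmod (\<Sum>j\<in>L m. F m j z * complex_of_real (Y m j \<theta>)) \<le> (\<Sum>j\<in>L m. cmod (F m j z * complex_of_real (Y m j \<theta>)))"
      by (rule norm_sum)
    also have "\<dots> \<le> B m"
      using B(3)[of m \<theta>] unfolding direction_usphere[OF S] .
    finally have "cmod (\<Sum>j\<in>L m. F m j z * complex_of_real (Y m j \<theta>)) \<le> B m" .
    moreover have "\<bar>Y k l \<theta>\<bar> \<le> K" using K S by (simp add: usphere_def)
    ultimately show ?thesis
      unfolding u_def norm_mult norm_of_real using B(2)[of m] by (intro mult_mono) auto
  qed
  have YY: "integrable (sphere_measure d) (\<lambda>\<theta>. complex_of_real (Y m j \<theta> * Y k l \<theta>))" if "j \<in> L m" for m j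
    by (intro integrable_of_real integrable_sphere polyfuns_mult harmonic_basis_polyfuns[OF Y] l that)
  have u_eq: "u m = (\<lambda>\<theta>. \<Sum>j\<in>L m. F m j z * complex_of_real (Y m j \<theta> * Y k l \<theta>))" for m
    unfolding u_def[abs_def] by (simp add: sum_distrib_right mult.assoc)
  have u_int: "integrable (sphere_measure d) (u m)" for m
    unfolding u_eq by (intro Bochner_Integration.integrable_sum integrable_mult_right YY)
  have u_val: "(\<integral>\<theta>. u m \<theta> \<partial>sphere_measure d) = (if m = k then F k l z else 0)" for m
  proof -
    have "(\<integral>\<theta>. u m \<theta> \<partial>sphere_measure d)
        = (\<Sum>j\<in>L m. F m j z * complex_of_real (\<integral>\<theta>. Y m j \<theta> * Y k l \<theta> \<partial>sphere_measure d))"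
      unfolding u_eq
      by (subst Bochner_Integration.integral_sum)
         (simp_all only: integrable_mult_right YY integral_mult_right_zero integral_complex_of_real)
    also have "\<dots> = (if m = k then F k l z else 0)"
    proof (cases "m = k")
      case True
      have "(\<Sum>j\<in>L k. F k j z * complex_of_real (\<integral>\<theta>. Y k j \<theta> * Y k l \<theta> \<partial>sphere_measure d))
          = (\<Sum>j\<in>L k. if j = l then F k l z else 0)"
        by (intro sum.cong refl) (simp add: harmonic_basisD(2)[OF Y _ l])
      also have "\<dots> = F k l z" using l by simp
      finally show ?thesis using True by simp
    next
      case False
      have "(\<integral>\<theta>. Y m j \<theta> * Y k l \<theta> \<partial>sphere_measure d) = 0" if "j \<in> L m" for j
        by (rule sphere_orthogonal[OF d harmonic_basisD(1)[OF Y that] harmonic_basisD(1)[OF Y l] False])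
      then show ?thesis using False by simp
    qed
    finally show ?thesis .
  qed
  have "(\<lambda>m. \<integral>\<theta>. u m \<theta> \<partial>sphere_measure d) sums (\<integral>\<theta>. (\<Sum>m. u m \<theta>) \<partial>sphere_measure d)"
  proof (rule sums_integral[OF u_int])
    show "AE \<theta> in sphere_measure d. summable (\<lambda>m. norm (u m \<theta>))"
      using bound by (intro AE_I2 summable_comparison_test'[OF summable_mult2[OF B(1), of K], of 0]) auto
    show "summable (\<lambda>m. \<integral>\<theta>. norm (u m \<theta>) \<partial>sphere_measure d)"
    proof (rule summable_comparison_test'[OF summable_mult2[OF summable_mult2[OF B(1), of K], of "measure (sphere_measure d) (space (sphere_measure d))"], of 0])
      fix m :: nat
      have "(\<integral>\<theta>. norm (u m \<theta>) \<partial>sphere_measure d) \<le> (\<integral>\<theta>. B m * K \<partial>sphere_measure d)"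
        by (intro integral_mono integrable_norm u_int S.integrable_const bound)
      then show "norm (\<integral>\<theta>. norm (u m \<theta>) \<partial>sphere_measure d) \<le> B m * K * measure (sphere_measure d) (space (sphere_measure d))"
        by (simp add: mult_ac)
    qed
  qed
  also have "(\<integral>\<theta>. (\<Sum>m. u m \<theta>) \<partial>sphere_measure d) = laplace_fourier d Y f k l z"
    unfolding laplace_fourier_def
  proof (rule Bochner_Integration.integral_cong[OF refl])
    fix \<theta> assume "\<theta> \<in> space (sphere_measure d)"
    then have "(\<lambda>m. u m \<theta>) sums (f z \<theta> * complex_of_real (Y k l \<theta>))"
      unfolding u_def by (intro sums_mult2 f_sums z) (simp add: space_sphere_measure)
    then show "(\<Sum>m. u m \<theta>) = f z \<theta> * complex_of_real (Y k l \<theta>)" by (rule sums_unique[symmetric])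
  qed
  also have "(\<lambda>m. \<integral>\<theta>. u m \<theta> \<partial>sphere_measure d) = (\<lambda>m. if m = k then F k l z else 0)"
    by (simp only: u_val)
  finally show ?thesis
    using sums_single[of k "\<lambda>_. F k l z"] sums_unique2 by blast
qed

lemma hardy_norm_laplace_fourier: "l \<in> L k \<Longrightarrow> hardy_norm (laplace_fourier d Y f k l) = hardy_norm (F k l)"
  by (intro hardy_norm_cong laplace_fourier_eq) simp_all

text \<open>Away from the origin the chosen unit vector is forced to be the direction. At the origin
  it is arbitrary while \<open>direction\<close> is the zero vector, but the terms agree: F vanishes
  at 0 for k \<ge> 1, and harmonics of degree 0 are constant.\<close>

lemma on_ball_sums:
  assumes x: "x \<in> space (borel_Rd d)" "nrm d x < 1"
  shows "(\<lambda>k. \<Sum>l\<in>L k. F k l (complex_of_real (nrm d x)) * complex_of_real (Y k l (direction d x))) sums on_ball d f x"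
proof -
  let ?z = "complex_of_real (nrm d x)"
  let ?P = "\<lambda>\<theta>. \<theta> \<in> usphere d \<and> (\<forall>i<d. x i = nrm d x * \<theta> i)"
  define \<theta> where "\<theta> = (SOME \<theta>. ?P \<theta>)"
  have ex: "\<exists>\<theta>. ?P \<theta>"
  proof (cases "nrm d x = 0")
    case True
    then have "x i = 0" if "i < d" for i
      using coord_le_nrm[OF that, of x] by simp
    then show ?thesis using usphere_nonempty[OF d] True by auto
  next
    case False
    then have "0 < nrm d x" using nrm_nonneg[of d x] by simp
    then show ?thesis
      by (intro exI[of _ "direction d x"] conjI direction_in_usphere) (simp_all add: direction_def)
  qed
  then have \<theta>: "\<theta> \<in> usphere d" "\<And>i. i < d \<Longrightarrow> x i = nrm d x * \<theta> i"
    unfolding \<theta>_def using someI_ex[OF ex] by blast+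
  have z: "?z \<in> ball 0 1" using x nrm_nonneg[of d x] by simp
  have eq: "F k l ?z * complex_of_real (Y k l \<theta>) = F k l ?z * complex_of_real (Y k l (direction d x))" if l: "l \<in> L k" for k l
  proof (cases "nrm d x = 0")
    case False
    then have "direction d x = direction d \<theta>"
      using \<theta> by (auto simp: direction_def usphere_def fun_eq_iff)
    then show ?thesis by (simp only: direction_usphere[OF \<theta>(1)])
  next
    case True
    have Yl: "Y k l (direction d x) = 0 ^ k * Y k l \<theta>"
      by (intro homogeneous_direction_origin harmonic_polysD(1)[OF harmonic_basisD(1)[OF Y l]] True)
    show ?thesis
    proof (cases "k = 0")
      case False
      obtain g where "\<forall>z\<in>ball 0 1. F k l z = g (z\<^sup>2) * z ^ k"
        using F[OF l] by (elim bexE)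
      then have "F k l ?z = 0" using z True False by (simp add: power_0_left)
      then show ?thesis by simp
    next
      case True
      then show ?thesis using Yl by simp
    qed
  qed
  have "(\<lambda>k. \<Sum>l\<in>L k. F k l ?z * complex_of_real (Y k l (direction d x)))
      = (\<lambda>k. \<Sum>l\<in>L k. F k l ?z * complex_of_real (Y k l \<theta>))"
    by (intro ext sum.cong refl) (rule eq[symmetric])
  then show ?thesis
    using f_sums[OF z \<theta>(1)] by (simp add: on_ball_def \<theta>_def)
qed

end

section \<open>The cubature error\<close>

definition variation_mass :: "'a measure \<Rightarrow> ('a set \<Rightarrow> real) \<Rightarrow> real" where
  "variation_mass M \<mu> = measure (upper_variation M \<mu>) (space M) + measure (upper_variation M (\<lambda>A. - \<mu> A)) (space M)"

lemma integrable_upper_variation_bounded: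
  fixes u :: "'a \<Rightarrow> 'b::{banach, second_countable_topology}"
  assumes "signed_measure M \<mu>" "u \<in> borel_measurable M" "\<And>x. x \<in> space M \<Longrightarrow> norm (u x) \<le> B"
  shows "integrable (upper_variation M \<mu>) u"
    and "(\<integral>x. norm (u x) \<partial>upper_variation M \<mu>) \<le> B * measure (upper_variation M \<mu>) (space M)"
proof -
  interpret finite_measure "upper_variation M \<mu>"
    by (rule finite_measure_upper_variation) fact
  have "u \<in> borel_measurable (upper_variation M \<mu>)"
    using assms(2) by (simp add: measurable_cong_sets[OF sets_upper_variation refl])
  then show int: "integrable (upper_variation M \<mu>) u"
    using assms(3) by (intro integrable_const_bound[where B = B] AE_I2) auto
  have "(\<integral>x. norm (u x) \<partial>upper_variation M \<mu>) \<le> (\<integral>x. B \<partial>upper_variation M \<mu>)"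
    using assms(3) by (intro integral_mono integrable_norm int integrable_const) auto
  then show "(\<integral>x. norm (u x) \<partial>upper_variation M \<mu>) \<le> B * measure (upper_variation M \<mu>) (space M)"
    by (simp add: mult.commute)
qed

lemma signed_integrable_bounded:
  fixes u :: "'a \<Rightarrow> 'b::{banach, second_countable_topology}"
  assumes "signed_measure M \<mu>" "u \<in> borel_measurable M" "\<And>x. x \<in> space M \<Longrightarrow> norm (u x) \<le> B"
  shows "signed_integrable M \<mu> u"
  using integrable_upper_variation_bounded(1)[OF _ assms(2,3)] assms(1) signed_measure_uminus
  by (auto simp: signed_integrable_def)

lemma norm_signed_integral_le:
  fixes u :: "'a \<Rightarrow> 'b::{banach, second_countable_topology}"
  assumes \<mu>: "signed_measure M \<mu>" and u: "u \<in> borel_measurable M" "\<And>x. x \<in> space M \<Longrightarrow> norm (u x) \<le> B"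
  shows "norm (signed_integral M \<mu> u) \<le> B * variation_mass M \<mu>"
proof -
  have "norm (signed_integral M \<mu> u)
      \<le> (\<integral>x. norm (u x) \<partial>upper_variation M \<mu>) + (\<integral>x. norm (u x) \<partial>upper_variation M (\<lambda>A. - \<mu> A))"
    unfolding signed_integral_def
    by (rule order_trans[OF norm_triangle_ineq4 add_mono[OF integral_norm_bound integral_norm_bound]])
  also have "\<dots> \<le> B * variation_mass M \<mu>"
    unfolding variation_mass_def distrib_left
    by (intro add_mono integrable_upper_variation_bounded(2)[OF _ u] \<mu> signed_measure_uminus)
  finally show ?thesis .
qed

text \<open>Both Jordan parts are finite measures, so one summable uniform bound allows the exchange
  for each of them.\<close>

lemma signed_integral_sums:
  fixes u :: "nat \<Rightarrow> 'a \<Rightarrow> 'b::{banach, second_countable_topology}"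
  assumes \<mu>: "signed_measure M \<mu>" and u: "\<And>k. u k \<in> borel_measurable M"
    and B: "\<And>k x. x \<in> space M \<Longrightarrow> norm (u k x) \<le> B k" "summable B"
  shows "(\<lambda>k. signed_integral M \<mu> (u k)) sums signed_integral M \<mu> (\<lambda>x. \<Sum>k. u k x)"
proof -
  have "(\<lambda>k. \<integral>x. u k x \<partial>upper_variation M \<mu>) sums (\<integral>x. (\<Sum>k. u k x) \<partial>upper_variation M \<mu>)"
    if \<mu>: "signed_measure M \<mu>" for \<mu>
  proof (rule sums_integral)
    note bd = integrable_upper_variation_bounded[OF \<mu> u B(1)]
    show "integrable (upper_variation M \<mu>) (u k)" for k
      by (rule bd(1))
    show "AE x in upper_variation M \<mu>. summable (\<lambda>k. norm (u k x))"
      using B by (intro AE_I2 summable_comparison_test'[OF B(2), of 0]) simp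
    show "summable (\<lambda>k. \<integral>x. norm (u k x) \<partial>upper_variation M \<mu>)"
      by (rule summable_comparison_test'[OF summable_mult2[OF B(2), of "measure (upper_variation M \<mu>) (space M)"], of 0])
         (simp add: bd(2))
  qed
  from sums_diff[OF this[OF \<mu>] this[OF signed_measure_uminus[OF \<mu>]]] show ?thesis
    by (simp only: signed_integral_def)
qed

lemma signed_integral_sum:
  fixes u :: "'i \<Rightarrow> 'a \<Rightarrow> 'b::{banach, second_countable_topology}"
  assumes "\<And>i. i \<in> I \<Longrightarrow> signed_integrable M \<mu> (u i)"
  shows "signed_integral M \<mu> (\<lambda>x. \<Sum>i\<in>I. u i x) = (\<Sum>i\<in>I. signed_integral M \<mu> (u i))"
  using assms by (simp add: signed_integral_def signed_integrable_def Bochner_Integration.integral_sum sum_subtractf)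

lemma signed_integral_mult_right:
  fixes c :: real
  shows "signed_integral M \<mu> (\<lambda>x. c * u x) = c * signed_integral M \<mu> u"
  by (simp add: signed_integral_def right_diff_distrib)

lemma signed_integral_bounded_linear:
  assumes "bounded_linear T" "signed_integrable M \<mu> u"
  shows "signed_integral M \<mu> (\<lambda>x. T (u x)) = T (signed_integral M \<mu> u)"
  using assms by (simp add: signed_integral_def signed_integrable_def integral_bounded_linear linear_diff bounded_linear.linear)

locale cubature_setting = harmonic_expansion +
  fixes N :: nat and b :: real and \<mu> :: "(nat \<Rightarrow> real) set \<Rightarrow> real" and \<nu> :: "nat \<Rightarrow> nat \<Rightarrow> real measure"
    and t w :: "nat \<Rightarrow> nat \<Rightarrow> nat \<Rightarrow> real"
  assumes b: "0 < b" "b < 1" and \<mu>: "signed_measure (borel_Rd d) \<mu>" and supp: "supported_in_cball d b \<mu>"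
    and \<nu>: "component_measures d Y b \<mu> \<nu>"
    and quad: "\<And>k l. l \<in> {1..harm_dim d k} \<Longrightarrow> interpolatory_quadrature N k b (\<nu> k l) (t k l) (w k l)"
begin

section \<open>Component measures and the layers of the expansion\<close>

lemma AE_supported:
  "AE x in upper_variation (borel_Rd d) \<mu>. nrm d x \<le> b"
  "AE x in upper_variation (borel_Rd d) (\<lambda>A. - \<mu> A). nrm d x \<le> b"
proof -
  have m: "nrm d \<in> borel_measurable (borel_Rd d)"
    unfolding borel_Rd_def by (rule nrm_measurable)
  show "AE x in upper_variation (borel_Rd d) \<mu>. nrm d x \<le> b"
    by (rule AE_upper_variation_supported[OF \<mu> supp m])
  have "supported_in_cball d b (\<lambda>A. - \<mu> A)"
    using supp by (simp add: supported_in_cball_def)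
  then show "AE x in upper_variation (borel_Rd d) (\<lambda>A. - \<mu> A). nrm d x \<le> b"
    by (rule AE_upper_variation_supported[OF signed_measure_uminus[OF \<mu>] _ m])
qed

lemma \<nu>_measure:
  assumes "l \<in> L k"
  shows "finite_measure (\<nu> k l)" "sets (\<nu> k l) = sets borel" "emeasure (\<nu> k l) (- {0..b}) = 0"
  using \<nu> assms unfolding component_measures_def by blast+

lemma \<nu>_integral:
  assumes "l \<in> L k" "continuous_on {0..b} g"
  shows "(LINT r:{0..b}|\<nu> k l. g r) = signed_integral (borel_Rd d) \<mu>
    (\<lambda>x. indicator {0..b} (nrm d x) * g (nrm d x) * Y k l (direction d x))"
  using \<nu> assms unfolding component_measures_def by blast

lemma coefficient_continuous:
  assumes l: "l \<in> L k"
  shows "continuous_on {0..<1} (\<lambda>r. F k l (complex_of_real r))"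
proof -
  obtain g where g: "g \<in> hardy_space" "\<forall>z\<in>ball 0 1. F k l z = g (z\<^sup>2) * z ^ k"
    using F[OF l] by (elim bexE)
  have "continuous_on (ball 0 1) g"
    using g(1) by (auto simp: hardy_space_def intro: holomorphic_on_imp_continuous_on)
  then have "continuous_on {0..<1} (\<lambda>r. g ((complex_of_real r)\<^sup>2))"
    by (rule continuous_on_compose2) (auto intro!: continuous_intros simp: norm_power power_less_one_iff)
  then have "continuous_on {0..<1} (\<lambda>r. g ((complex_of_real r)\<^sup>2) * complex_of_real r ^ k)"
    by (intro continuous_intros)
  then show ?thesis
    by (rule continuous_on_cong[THEN iffD2, rotated 2]) (use g(2) in auto)
qed

lemma borel_measurable_Y_direction:
  "l \<in> L k \<Longrightarrow> (\<lambda>x. Y k l (direction d x)) \<in> borel_measurable (borel_Rd d)"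
  unfolding borel_Rd_def
  by (rule measurable_compose[OF direction_measurable polyfuns_measurable[OF harmonic_basis_polyfuns[OF Y]]])

lemma borel_measurable_nrm: "nrm d \<in> borel_measurable (borel_Rd d)"
  unfolding borel_Rd_def by (rule nrm_measurable)

text \<open>The cut-off \<open>S\<close> is \<open>{0..b}\<close> where a uniform bound is needed,
  and \<open>{0..<1}\<close> where f has to be represented on the whole unit ball.\<close>

definition layer :: "real set \<Rightarrow> nat \<Rightarrow> nat \<Rightarrow> (nat \<Rightarrow> real) \<Rightarrow> complex" where
  "layer S k l x = indicator S (nrm d x) *\<^sub>R (F k l (complex_of_real (nrm d x)) * complex_of_real (Y k l (direction d x)))"

lemma borel_measurable_layer:
  assumes l: "l \<in> L k" and S: "S \<in> sets borel" "S \<subseteq> {0..<1}"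
  shows "layer S k l \<in> borel_measurable (borel_Rd d)"
proof -
  have "(\<lambda>r. indicator S r *\<^sub>R F k l (complex_of_real r)) \<in> borel_measurable borel"
    by (intro borel_measurable_continuous_on_indicator S continuous_on_subset[OF coefficient_continuous[OF l]])
  from measurable_compose[OF borel_measurable_nrm this]
  have "(\<lambda>x. (indicator S (nrm d x) *\<^sub>R F k l (complex_of_real (nrm d x))) * complex_of_real (Y k l (direction d x)))
      \<in> borel_measurable (borel_Rd d)"
    using borel_measurable_Y_direction[OF l] by measurable
  then show ?thesis unfolding layer_def[abs_def] by simp
qed

text \<open>The component measures are characterised through real continuous functions only, so the
  complex identity is obtained for real and imaginary parts.\<close>

lemma layer_integral:
  assumes l: "l \<in> L k"
  shows "signed_integral (borel_Rd d) \<mu> (layer {0..b} k l) = (LINT r:{0..b}|\<nu> k l. F k l (complex_of_real r))"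
    and "signed_integrable (borel_Rd d) \<mu> (layer {0..b} k l)"
proof -
  interpret \<nu>: finite_measure "\<nu> k l" by (rule \<nu>_measure[OF l])
  have cont: "continuous_on {0..b} (\<lambda>r. F k l (complex_of_real r))"
    by (rule continuous_on_subset[OF coefficient_continuous[OF l]]) (use b in auto)
  obtain B where B: "\<And>k z x. cmod z \<le> b \<Longrightarrow> (\<Sum>l\<in>L k. cmod (F k l z * complex_of_real (Y k l (direction d x)))) \<le> B k"
    "\<And>k. 0 \<le> B k"
    by (rule layer_bound[OF b(2)], rule that)
  have bound: "norm (layer {0..b} k l x) \<le> B k" for x
  proof (cases "nrm d x \<le> b")
    case True
    then have "norm (layer {0..b} k l x) \<le> cmod (F k l (complex_of_real (nrm d x)) * complex_of_real (Y k l (direction d x)))"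
      by (simp add: layer_def indicator_def)
    also have "\<dots> \<le> (\<Sum>l\<in>L k. cmod (F k l (complex_of_real (nrm d x)) * complex_of_real (Y k l (direction d x))))"
      by (rule member_le_sum[OF l]) auto
    also have "\<dots> \<le> B k" using True nrm_nonneg[of d x] by (intro B(1)) simp
    finally show ?thesis .
  qed (simp add: layer_def indicator_def B(2))
  show int: "signed_integrable (borel_Rd d) \<mu> (layer {0..b} k l)"
    by (rule signed_integrable_bounded[OF \<mu> borel_measurable_layer[OF l] bound]) (use b in auto)
  have int\<nu>: "integrable (\<nu> k l) (\<lambda>r. indicator {0..b} r *\<^sub>R F k l (complex_of_real r))"
  proof (rule \<nu>.integrable_const_bound[where B = "hardy_norm (F k l) * (b ^ k / (1 - b\<^sup>2))"])
    have "(\<lambda>r. indicator {0..b} r *\<^sub>R F k l (complex_of_real r)) \<in> borel_measurable borel"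
      by (intro borel_measurable_continuous_on_indicator cont) simp
    then show "(\<lambda>r. indicator {0..b} r *\<^sub>R F k l (complex_of_real r)) \<in> borel_measurable (\<nu> k l)"
      by (simp add: measurable_cong_sets[OF \<nu>_measure(2)[OF l] refl])
    have "0 \<le> hardy_norm (F k l) * (b ^ k / (1 - b\<^sup>2))"
      using coefficient_bound[OF l _ b(2), of 0] b norm_ge_zero order_trans by (metis less_imp_le norm_zero)
    moreover have "cmod (F k l (complex_of_real r)) \<le> hardy_norm (F k l) * (b ^ k / (1 - b\<^sup>2))" if "r \<in> {0..b}" for r
      using that by (intro coefficient_bound[OF l _ b(2)]) simp
    ultimately show "AE r in \<nu> k l. norm (indicator {0..b} r *\<^sub>R F k l (complex_of_real r)) \<le> hardy_norm (F k l) * (b ^ k / (1 - b\<^sup>2))"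
      by (intro AE_I2) (simp add: indicator_def del: times_divide_eq_right)
  qed
  \<comment> \<open>\<open>T\<close> stands for \<open>Re\<close> and \<open>Im\<close>; the second
    condition lets it pass the real factor coming from the harmonic.\<close>
  have part: "T (signed_integral (borel_Rd d) \<mu> (layer {0..b} k l)) = T (LINT r:{0..b}|\<nu> k l. F k l (complex_of_real r))"
    if T: "bounded_linear T" and Tm: "\<And>z y. T (z * complex_of_real y) = T z * y" for T :: "complex \<Rightarrow> real"
  proof -
    have Ts: "T (indicator S r *\<^sub>R z) = indicator S r * T z" for S :: "real set" and r z
      using linear_scale[OF bounded_linear.linear[OF T]] by simp
    have "T (LINT r:{0..b}|\<nu> k l. F k l (complex_of_real r)) = (LINT r:{0..b}|\<nu> k l. T (F k l (complex_of_real r)))"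
      unfolding set_lebesgue_integral_def using integral_bounded_linear[OF T int\<nu>] by (simp add: Ts)
    also have "\<dots> = signed_integral (borel_Rd d) \<mu> (\<lambda>x. indicator {0..b} (nrm d x) * T (F k l (complex_of_real (nrm d x))) * Y k l (direction d x))"
      by (rule \<nu>_integral[OF l]) (rule bounded_linear.continuous_on[OF T cont])
    also have "(\<lambda>x. indicator {0..b} (nrm d x) * T (F k l (complex_of_real (nrm d x))) * Y k l (direction d x)) = (\<lambda>x. T (layer {0..b} k l x))"
      by (simp add: layer_def Ts Tm mult.assoc)
    also have "signed_integral (borel_Rd d) \<mu> \<dots> = T (signed_integral (borel_Rd d) \<mu> (layer {0..b} k l))"
      by (rule signed_integral_bounded_linear[OF T int])
    finally show ?thesis ..
  qed
  show "signed_integral (borel_Rd d) \<mu> (layer {0..b} k l) = (LINT r:{0..b}|\<nu> k l. F k l (complex_of_real r))"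
    by (rule complex_eqI; rule part) (simp_all add: bounded_linear_Re bounded_linear_Im)
qed

lemma moment_restrict:
  assumes l: "l \<in> L k"
  shows "(LINT r:{0..1}|\<nu> k l. r ^ k) = (LINT r:{0..b}|\<nu> k l. r ^ k)"
  unfolding set_lebesgue_integral_def
proof (rule integral_cong_AE)
  have sets: "borel_measurable (\<nu> k l) = borel_measurable borel"
    by (rule measurable_cong_sets[OF \<nu>_measure(2)[OF l] refl])
  show "(\<lambda>r. indicator {0..1} r *\<^sub>R r ^ k) \<in> borel_measurable (\<nu> k l)"
    "(\<lambda>r. indicator {0..b} r *\<^sub>R r ^ k) \<in> borel_measurable (\<nu> k l)"
    unfolding sets by measurable
  have "AE r in \<nu> k l. r \<in> {0..b}"
    by (rule AE_I[OF _ \<nu>_measure(3)[OF l]]) (auto simp: \<nu>_measure(2)[OF l])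
  then show "AE r in \<nu> k l. indicator {0..1} r *\<^sub>R r ^ k = indicator {0..b} r *\<^sub>R r ^ k"
    using b by (auto simp: indicator_def)
qed

definition moment :: "nat \<Rightarrow> nat \<Rightarrow> real" where
  "moment k l = (LINT r:{0..1}|\<nu> k l. r ^ k)"

lemma moment_nonneg: "0 \<le> moment k l"
  unfolding moment_def set_lebesgue_integral_def by (intro integral_nonneg_AE) (auto simp: indicator_def)

text \<open>The weighted moments of one degree are combined into a single integral against \<mu>
  before estimating, so that the majorant for the whole layer applies under the integral.\<close>

lemma summable_moments: "summable (\<lambda>k. \<Sum>l\<in>L k. hardy_norm (F k l) * moment k l)"
proof -
  obtain B where B: "summable B" "\<And>k. 0 \<le> B k"
    "\<And>k x. 0 \<le> b \<Longrightarrow> b ^ k * (\<Sum>l\<in>L k. hardy_norm (F k l) * \<bar>Y k l (direction d x)\<bar>) \<le> B k"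
    by (rule layer_bound[OF b(2)], rule that)
  define h where "h k l x = indicator {0..b} (nrm d x) * nrm d x ^ k * Y k l (direction d x)" for k l x
  have h: "h k l \<in> borel_measurable (borel_Rd d)" if "l \<in> L k" for k l
    unfolding h_def[abs_def] using borel_measurable_nrm borel_measurable_Y_direction[OF that] by measurable
  have bound: "(\<Sum>l\<in>L k. hardy_norm (F k l) * \<bar>h k l x\<bar>) \<le> B k" for k x
  proof -
    have r: "indicator {0..b} (nrm d x) * nrm d x ^ k \<le> b ^ k"
      using b by (auto simp: indicator_def intro: power_mono)
    have "(\<Sum>l\<in>L k. hardy_norm (F k l) * \<bar>h k l x\<bar>)
        = indicator {0..b} (nrm d x) * nrm d x ^ k * (\<Sum>l\<in>L k. hardy_norm (F k l) * \<bar>Y k l (direction d x)\<bar>)"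
      unfolding sum_distrib_left by (intro sum.cong refl) (simp add: h_def abs_mult nrm_nonneg)
    also have "\<dots> \<le> b ^ k * (\<Sum>l\<in>L k. hardy_norm (F k l) * \<bar>Y k l (direction d x)\<bar>)"
      by (intro mult_right_mono r sum_nonneg mult_nonneg_nonneg hardy_norm_nonneg) auto
    also have "\<dots> \<le> B k" using b by (intro B(3)) simp
    finally show ?thesis .
  qed
  have moment: "hardy_norm (F k l) * moment k l = signed_integral (borel_Rd d) \<mu> (\<lambda>x. hardy_norm (F k l) * h k l x)"
    if l: "l \<in> L k" for k l
    unfolding moment_def moment_restrict[OF l] signed_integral_mult_right h_def
    by (subst \<nu>_integral[OF l]) (auto intro!: continuous_intros)
  have int: "signed_integrable (borel_Rd d) \<mu> (\<lambda>x. hardy_norm (F k l) * h k l x)" if l: "l \<in> L k" for k l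
  proof (rule signed_integrable_bounded[OF \<mu>])
    show "(\<lambda>x. hardy_norm (F k l) * h k l x) \<in> borel_measurable (borel_Rd d)"
      using h[OF l] by measurable
    fix x
    have "norm (hardy_norm (F k l) * h k l x) = hardy_norm (F k l) * \<bar>h k l x\<bar>"
      using hardy_norm_nonneg[OF l] by (simp add: abs_mult)
    also have "\<dots> \<le> (\<Sum>l\<in>L k. hardy_norm (F k l) * \<bar>h k l x\<bar>)"
      by (rule member_le_sum[OF l]) (auto intro!: mult_nonneg_nonneg hardy_norm_nonneg)
    finally show "norm (hardy_norm (F k l) * h k l x) \<le> B k" using bound[of k x] by simp
  qed
  show ?thesis
  proof (rule summable_comparison_test'[OF summable_mult2[OF B(1), of "variation_mass (borel_Rd d) \<mu>"], of 0])
    fix k :: nat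
    have "(\<Sum>l\<in>L k. hardy_norm (F k l) * moment k l)
        = signed_integral (borel_Rd d) \<mu> (\<lambda>x. \<Sum>l\<in>L k. hardy_norm (F k l) * h k l x)"
      by (subst signed_integral_sum[OF int]) (simp_all add: moment)
    also have "norm \<dots> \<le> B k * variation_mass (borel_Rd d) \<mu>"
    proof (rule norm_signed_integral_le[OF \<mu>])
      show "(\<lambda>x. \<Sum>l\<in>L k. hardy_norm (F k l) * h k l x) \<in> borel_measurable (borel_Rd d)"
        using h by (intro borel_measurable_sum borel_measurable_times) auto
      fix x
      have "norm (\<Sum>l\<in>L k. hardy_norm (F k l) * h k l x) \<le> (\<Sum>l\<in>L k. norm (hardy_norm (F k l) * h k l x))"
        by (rule norm_sum)
      also have "\<dots> = (\<Sum>l\<in>L k. hardy_norm (F k l) * \<bar>h k l x\<bar>)"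
        by (intro sum.cong refl) (simp add: abs_mult hardy_norm_nonneg)
      finally show "norm (\<Sum>l\<in>L k. hardy_norm (F k l) * h k l x) \<le> B k" using bound[of k x] by simp
    qed
    finally show "norm (\<Sum>l\<in>L k. hardy_norm (F k l) * moment k l) \<le> B k * variation_mass (borel_Rd d) \<mu>" .
  qed
qed

text \<open>The restriction of f may be unbounded near the unit sphere, but \<mu> lives on radius at
  most b. There f agrees with the sum of the layers cut off at b, which has a summable uniform
  majorant.\<close>

lemma integral_on_ball:
  defines "v \<equiv> \<lambda>x. indicator (unit_ball_Rd d) x *\<^sub>R on_ball d f x"
  shows "signed_integrable (borel_Rd d) \<mu> v"
    and "(\<lambda>k. \<Sum>l\<in>L k. LINT r:{0..b}|\<nu> k l. F k l (complex_of_real r)) sums signed_integral (borel_Rd d) \<mu> v"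
proof -
  obtain B where B: "summable B" "\<And>k. 0 \<le> B k"
    "\<And>k z x. cmod z \<le> b \<Longrightarrow> (\<Sum>l\<in>L k. cmod (F k l z * complex_of_real (Y k l (direction d x)))) \<le> B k"
    by (rule layer_bound[OF b(2)], rule that)
  define U where "U S k x = (\<Sum>l\<in>L k. layer S k l x)" for S k x
  have U: "U S k \<in> borel_measurable (borel_Rd d)" if "S \<in> sets borel" "S \<subseteq> {0..<1}" for S k
    unfolding U_def[abs_def] by (intro borel_measurable_sum borel_measurable_layer that)
  have Ub: "U {0..b} k \<in> borel_measurable (borel_Rd d)" for k
    by (rule U) (use b in auto)
  have bound: "norm (U {0..b} k x) \<le> B k" for k x
  proof (cases "nrm d x \<le> b")
    case True
    then have "norm (U {0..b} k x) \<le> (\<Sum>l\<in>L k. cmod (F k l (complex_of_real (nrm d x)) * complex_of_real (Y k l (direction d x))))"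
      unfolding U_def by (intro order_trans[OF norm_sum] sum_mono) (simp add: layer_def indicator_def)
    also have "\<dots> \<le> B k" using True nrm_nonneg[of d x] by (intro B(3)) simp
    finally show ?thesis .
  qed (simp add: U_def layer_def B(2))
  have U_sums: "(\<lambda>k. U S k x) sums on_ball d f x"
    if "x \<in> space (borel_Rd d)" "nrm d x \<in> S" "S \<subseteq> {0..<1}" for x S
    using on_ball_sums[of x] that by (force simp: U_def layer_def)
  have v_eq: "v x = (\<Sum>k. U {0..<1} k x)" if x: "x \<in> space (borel_Rd d)" for x
  proof (cases "nrm d x < 1")
    case True
    then show ?thesis
      using sums_unique[OF U_sums[OF x, of "{0..<1}"]] x nrm_nonneg[of d x] by (simp add: v_def unit_ball_Rd_def)
  qed (simp add: v_def unit_ball_Rd_def U_def layer_def)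
  \<comment> \<open>The choice operator in \<open>on_ball\<close> hides measurability; it is
    recovered from the series of measurable layers over the whole open ball.\<close>
  have v: "v \<in> borel_measurable (borel_Rd d)"
  proof -
    have "(\<lambda>x. \<Sum>k. U {0..<1} k x) \<in> borel_measurable (borel_Rd d)"
      by (intro borel_measurable_suminf U) auto
    then show ?thesis using v_eq by (simp cong: measurable_cong)
  qed
  define u where "u x = (\<Sum>k. U {0..b} k x)" for x
  have u: "u \<in> borel_measurable (borel_Rd d)"
    unfolding u_def[abs_def] by (intro borel_measurable_suminf Ub)
  have uv: "u x = v x" if "x \<in> space (borel_Rd d)" "nrm d x \<le> b" for x
  proof -
    have "{0..b} \<subseteq> {0..<1}" "nrm d x \<in> {0..b}" using b that nrm_nonneg[of d x] by auto
    from sums_unique[OF U_sums[OF that(1) this(2,1)]] show ?thesis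
      using that b by (simp add: v_def u_def unit_ball_Rd_def)
  qed
  have u_bound: "norm (u x) \<le> (\<Sum>k. B k)" for x
    unfolding u_def by (rule norm_suminf_le[OF bound B(1)])
  have "AE x in upper_variation (borel_Rd d) \<mu>'. v x = u x"
    if "AE x in upper_variation (borel_Rd d) \<mu>'. nrm d x \<le> b" for \<mu>'
    using that AE_space
  proof eventually_elim
    case (elim x)
    then show ?case using uv[of x] by simp
  qed
  note ae = this[OF AE_supported(1)] this[OF AE_supported(2)]
  have meas: "g \<in> borel_measurable (upper_variation (borel_Rd d) \<mu>')" if "g \<in> borel_measurable (borel_Rd d)"
    for g :: "_ \<Rightarrow> complex" and \<mu>'
    using that by (simp add: measurable_cong_sets[OF sets_upper_variation refl])
  have "signed_integrable (borel_Rd d) \<mu> u"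
    by (rule signed_integrable_bounded[OF \<mu> u u_bound])
  then show "signed_integrable (borel_Rd d) \<mu> v"
    unfolding signed_integrable_def
    using integrable_cong_AE[OF meas[OF v] meas[OF u]] ae by blast
  have "signed_integral (borel_Rd d) \<mu> v = signed_integral (borel_Rd d) \<mu> u"
    unfolding signed_integral_def
    by (intro arg_cong2[where f = "(-)"] integral_cong_AE meas v u ae)
  moreover have "(\<lambda>k. signed_integral (borel_Rd d) \<mu> (U {0..b} k)) sums signed_integral (borel_Rd d) \<mu> u"
    unfolding u_def[abs_def] by (rule signed_integral_sums[OF \<mu> Ub bound B(1)])
  moreover have "signed_integral (borel_Rd d) \<mu> (U {0..b} k) = (\<Sum>l\<in>L k. LINT r:{0..b}|\<nu> k l. F k l (complex_of_real r))" for k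
    unfolding U_def[abs_def] by (subst signed_integral_sum) (simp_all add: layer_integral)
  ultimately show "(\<lambda>k. \<Sum>l\<in>L k. LINT r:{0..b}|\<nu> k l. F k l (complex_of_real r)) sums signed_integral (borel_Rd d) \<mu> v"
    by simp
qed

section \<open>Summing the quadrature errors\<close>

lemma cubature_term_error:
  "cmod ((\<Sum>l\<in>L k. LINT r:{0..b}|\<nu> k l. F k l (complex_of_real r)) - cubature_term N d Y t w f k)
    \<le> 1 / (1 - b) ^ (N + 2) * (\<Sum>l\<in>L k. hardy_norm (F k l) * moment k l)"
proof -
  have pos: "0 < 1 - b" "1 - b \<le> 1 - b\<^sup>2"
    using b mult_left_le_one_le[of b b] by (simp_all add: power2_eq_square)
  \<comment> \<open>The sharper constant of the quadrature estimate is weakened here, using b^2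
    \<le> b.\<close>
  have c: "1 / (1 - b\<^sup>2) ^ (N + 2) \<le> 1 / (1 - b) ^ (N + 2)"
    using pos by (intro divide_left_mono power_mono mult_pos_pos zero_less_power) linarith+
  have "cmod ((LINT r:{0..b}|\<nu> k l. F k l (complex_of_real r))
      - (\<Sum>j\<le>N. complex_of_real (w k l j) * laplace_fourier d Y f k l (complex_of_real (t k l j))))
    \<le> 1 / (1 - b) ^ (N + 2) * (hardy_norm (F k l) * moment k l)" if l: "l \<in> L k" for l
  proof -
    obtain c where c': "\<And>m. cmod (c m) \<le> hardy_norm (F k l)"
      "\<And>z. z \<in> ball 0 1 \<Longrightarrow> (\<lambda>m. c m * z ^ (k + 2 * m)) sums F k l z"
      by (rule coefficient_series[OF l], rule that)
    have series: "(\<lambda>m. c m * complex_of_real (r ^ (k + 2 * m))) sums F k l (complex_of_real r)" if "r \<in> {0..b}" for r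
      using c'(2)[of "complex_of_real r"] that b by simp
    have "laplace_fourier d Y f k l (complex_of_real (t k l j)) = F k l (complex_of_real (t k l j))" if "j \<le> N" for j
      using quad[OF l] that b by (intro laplace_fourier_eq[OF l]) (auto simp: interpolatory_quadrature_def)
    then have "cmod ((LINT r:{0..b}|\<nu> k l. F k l (complex_of_real r))
        - (\<Sum>j\<le>N. complex_of_real (w k l j) * laplace_fourier d Y f k l (complex_of_real (t k l j))))
      = cmod ((LINT r:{0..b}|\<nu> k l. F k l (complex_of_real r))
        - (\<Sum>j\<le>N. complex_of_real (w k l j) * F k l (complex_of_real (t k l j))))"
      by simp
    also have "\<dots> \<le> 1 / (1 - b\<^sup>2) ^ (N + 2) * hardy_norm (F k l) * (LINT r:{0..b}|\<nu> k l. r ^ k)"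
      by (rule quadrature_series_error[OF \<nu>_measure(1,2)[OF l] b quad[OF l] c'(1) series])
    also have "\<dots> = 1 / (1 - b\<^sup>2) ^ (N + 2) * (hardy_norm (F k l) * moment k l)"
      by (simp add: moment_def moment_restrict[OF l])
    also have "\<dots> \<le> 1 / (1 - b) ^ (N + 2) * (hardy_norm (F k l) * moment k l)"
      by (intro mult_right_mono c mult_nonneg_nonneg hardy_norm_nonneg l moment_nonneg)
    finally show ?thesis .
  qed
  then show ?thesis
    unfolding cubature_term_def sum_subtractf[symmetric] sum_distrib_left
    by (intro order_trans[OF norm_sum] sum_mono)
qed

text \<open>Convergence of the cubature series is a result, not an input: each of its terms is an
  exact layer integral minus an error, and both of these series converge.\<close>

lemma cubature_error_estimate:
  "summable (cubature_term N d Y t w f)"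
  "cmod (cubature_error N d Y \<mu> t w f) \<le> 1 / (1 - b) ^ (N + 2) * (\<Sum>k. \<Sum>l\<in>L k. hardy_norm (F k l) * moment k l)"
proof -
  let ?T = "\<lambda>k. \<Sum>l\<in>L k. LINT r:{0..b}|\<nu> k l. F k l (complex_of_real r)"
  let ?e = "\<lambda>k. ?T k - cubature_term N d Y t w f k"
  let ?m = "\<lambda>k. 1 / (1 - b) ^ (N + 2) * (\<Sum>l\<in>L k. hardy_norm (F k l) * moment k l)"
  note T = integral_on_ball(2)
  have m: "summable ?m" by (intro summable_mult summable_moments)
  have e: "summable ?e"
    by (rule summable_comparison_test'[OF m cubature_term_error])
  have "summable (\<lambda>k. ?T k - ?e k)"
    by (intro summable_diff sums_summable[OF T] e)
  then show c: "summable (cubature_term N d Y t w f)" by simp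
  have "cubature_error N d Y \<mu> t w f = suminf ?e"
    unfolding cubature_error_def cubature_def sums_unique[OF T]
    by (rule suminf_diff[OF sums_summable[OF T] c])
  then have "cmod (cubature_error N d Y \<mu> t w f) \<le> suminf ?m"
    using norm_suminf_le[OF cubature_term_error m] by simp
  also have "suminf ?m = 1 / (1 - b) ^ (N + 2) * (\<Sum>k. \<Sum>l\<in>L k. hardy_norm (F k l) * moment k l)"
    by (rule suminf_mult[OF summable_moments])
  finally show "cmod (cubature_error N d Y \<mu> t w f)
      \<le> 1 / (1 - b) ^ (N + 2) * (\<Sum>k. \<Sum>l\<in>L k. hardy_norm (F k l) * moment k l)" .
qed

end

theorem theorem27:
  fixes N :: nat
  shows "\<exists>C\<^sub>N::real.
    \<forall>(d::nat) (Y :: nat \<Rightarrow> nat \<Rightarrow> (nat \<Rightarrow> real) \<Rightarrow> real) (b::real) (\<mu> :: (nat \<Rightarrow> real) set \<Rightarrow> real)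
     (\<nu> :: nat \<Rightarrow> nat \<Rightarrow> real measure) (t :: nat \<Rightarrow> nat \<Rightarrow> nat \<Rightarrow> real) (w :: nat \<Rightarrow> nat \<Rightarrow> nat \<Rightarrow> real)
     (f :: complex \<Rightarrow> (nat \<Rightarrow> real) \<Rightarrow> complex).
      2 \<le> d \<and> harmonic_basis d Y \<and> 0 < b \<and> b < 1 \<and>
      signed_measure (borel_Rd d) \<mu> \<and> supported_in_cball d b \<mu> \<and> pseudo_positive d Y \<mu> \<and>
      component_measures d Y b \<mu> \<nu> \<and>
      (\<forall>k. \<forall>l\<in>{1..harm_dim d k}. interpolatory_quadrature N k b (\<nu> k l) (t k l) (w k l)) \<and>
      f \<in> polyharmonic_hardy_space d Y
      \<longrightarrow>
      signed_integrable (borel_Rd d) \<mu> (\<lambda>x. indicator (unit_ball_Rd d) x *\<^sub>R on_ball d f x) \<and>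
      summable (cubature_term N d Y t w f) \<and>
      summable (\<lambda>k. \<Sum>l=1..harm_dim d k.
        hardy_norm (laplace_fourier d Y f k l) * (LINT r:{0..1}|\<nu> k l. r ^ k)) \<and>
      cmod (cubature_error N d Y \<mu> t w f) \<le>
        C\<^sub>N / (1 - b) ^ (N + 2) * (L_Gamma / (2 * pi)) *
        (\<Sum>k. \<Sum>l=1..harm_dim d k.
          hardy_norm (laplace_fourier d Y f k l) * (LINT r:{0..1}|\<nu> k l. r ^ k))"
proof (intro exI[of _ 1] allI impI, elim conjE)
  fix d Y b \<mu> \<nu> t w f
  assume d: "2 \<le> d" and Y: "harmonic_basis d Y" and b: "0 < b" "b < 1"
    and \<mu>: "signed_measure (borel_Rd d) \<mu>" "supported_in_cball d b \<mu>"
    and \<nu>: "component_measures d Y b \<mu> \<nu>"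
    and quad: "\<forall>k. \<forall>l\<in>{1..harm_dim d k}. interpolatory_quadrature N k b (\<nu> k l) (t k l) (w k l)"
    and f: "f \<in> polyharmonic_hardy_space d Y"
  obtain F where F: "\<forall>k. \<forall>l\<in>{1..harm_dim d k}. \<exists>g\<in>hardy_space. \<forall>z\<in>ball 0 1. F k l z = g (z\<^sup>2) * z ^ k"
    "summable (\<lambda>k. \<Sum>l=1..harm_dim d k. (hardy_norm (F k l))\<^sup>2)"
    "\<forall>z\<in>ball 0 1. \<forall>\<theta>\<in>usphere d.
      (\<lambda>k. \<Sum>l=1..harm_dim d k. F k l z * complex_of_real (Y k l \<theta>)) sums f z \<theta>"
    using f unfolding polyharmonic_hardy_space_def mem_Collect_eq by (elim conjE exE)
  interpret cubature_setting d Y f F N b \<mu> \<nu> t w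
    by unfold_locales (use d Y b \<mu> \<nu> quad F in auto)
  \<comment> \<open>The estimate was derived for the family \<open>F\<close>; equality on the disc
    makes the Hardy norms of the Laplace-Fourier coefficients the same.\<close>
  have moments: "(\<Sum>l=1..harm_dim d k. hardy_norm (laplace_fourier d Y f k l) * (LINT r:{0..1}|\<nu> k l. r ^ k))
      = (\<Sum>l\<in>L k. hardy_norm (F k l) * moment k l)" for k
    by (intro sum.cong refl) (simp only: hardy_norm_laplace_fourier moment_def)
  show "signed_integrable (borel_Rd d) \<mu> (\<lambda>x. indicator (unit_ball_Rd d) x *\<^sub>R on_ball d f x) \<and>
      summable (cubature_term N d Y t w f) \<and>
      summable (\<lambda>k. \<Sum>l=1..harm_dim d k.
        hardy_norm (laplace_fourier d Y f k l) * (LINT r:{0..1}|\<nu> k l. r ^ k)) \<and>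
      cmod (cubature_error N d Y \<mu> t w f) \<le>
        1 / (1 - b) ^ (N + 2) * (L_Gamma / (2 * pi)) *
        (\<Sum>k. \<Sum>l=1..harm_dim d k.
          hardy_norm (laplace_fourier d Y f k l) * (LINT r:{0..1}|\<nu> k l. r ^ k))"
    unfolding moments L_Gamma_eq
    using integral_on_ball(1) cubature_error_estimate summable_moments by simp
qed

end
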